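(* Let $\mathscr{C}$ and $\mathscr{D}$ be two symmetric monoidal categories (good, as specified in the context), and let $L\colon\mathscr{C}\rightleftarrows\mathscr{D}\colon R$ be a pair of adjoint functors, with $R$ the right adjoint. Let $\varphi$ be a lax-monoidal structure on $R$ such that the adjoint colax-monoidal structure $c_L$ on $L$ is quasi-symmetric. For monoids $X,Y$ in $\mathscr{C}$, let $\Psi_{X,Y}\colon L^{\mathrm{mon}}(X\otimes Y)\to\mathrm{colim}(\mathcal{D}(X)\otimes\mathcal{D}(Y))$ and $i_{X,Y}\colon\mathrm{colim}(\mathcal{D}(X)\otimes\mathcal{D}(Y))\to L^{\mathrm{mon}}(X)\otimes L^{\mathrm{mon}}(Y)$ be the maps of monoids defined in the context, and put $\Theta_{X,Y}=i_{X,Y}\circ\Psi_{X,Y}$. Then $$\Theta_{X,Y}\colon L^{\mathrm{mon}}(X\otimes Y)\to L^{\mathrm{mon}}(X)\otimes L^{\mathrm{mon}}(Y)$$ is a colax-monoidal structure on the functor $L^{\mathrm{mon}}$, isomorphic to the canonical one.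
   Context: Good monoidal categories: $\mathscr{C}$ and $\mathscr{D}$ have the colimits needed for the following constructions (finite colimits and the countable coproducts below), the functors $-\otimes a$ and $a\otimes-$ commute with them, and the co-equalizers of monoids used below exist. $\mathrm{Mon}\,\mathscr{M}$ is the category of monoids in $\mathscr{M}$; $T_{\mathscr{M}}(X)=1\coprod X\coprod X\otimes X\coprod\cdots$ is the free monoid functor, left adjoint to the forgetful functor. A colax-monoidal structure on $F$ is a natural map $F(X\otimes Y)\to F(X)\otimes F(Y)$ together with a morphism $F(1)\to 1$ satisfying the coassociativity and counit axioms; a lax-monoidal structure is the dual notion. Structures are denoted by their binary maps. Two colax-monoidal structures on a functor $F$ are isomorphic if some natural automorphism of $F$ intertwines them. With unit $\eta\colon\mathrm{Id}\to RL$ and counit $\epsilon\colon LR\to\mathrm{Id}$, the colax-monoidal structure $c_L$ on $L$ adjoint to $\varphi$ is $L(X\otimes Y)\xrightarrow{L(\eta\otimes\eta)}L(RLX\otimes RLY)\xrightarrow{L(\varphi)}LR(LX\otimes LY)\xrightarrow{\epsilon}LX\otimes LY$. The same formula assigns to a lax-monoidal structure on the right adjoint of any adjunction its adjoint colax-monoidal structure on the left adjoint. A colax-monoidal structure $c$ on a functor $F$ between symmetric monoidal categories is quasi-symmetric if for all $X,Y,Z,W$ the compositions $F(X\otimes Y\otimes Z\otimes W)\xrightarrow{c}F(X\otimes Y)\otimes F(Z\otimes W)\xrightarrow{c\otimes c}F(X)\otimes F(Y)\otimes F(Z)\otimes F(W)\xrightarrow{\sigma_{F(Y),F(Z)}}F(X)\otimes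 F(Z)\otimes F(Y)\otimes F(W)$ and $F(X\otimes Y\otimes Z\otimes W)\xrightarrow{F(\sigma_{Y,Z})}F(X\otimes Z\otimes Y\otimes W)\xrightarrow{c}F(X\otimes Z)\otimes F(Y\otimes W)\xrightarrow{c\otimes c}F(X)\otimes F(Z)\otimes F(Y)\otimes F(W)$ coincide ($\sigma$ is the symmetry). $R^{\mathrm{mon}}\colon\mathrm{Mon}\,\mathscr{D}\to\mathrm{Mon}\,\mathscr{C}$ equals $R$ on underlying objects, with product $RX\otimes RX\xrightarrow{\varphi}R(X\otimes X)\xrightarrow{R(m_X)}RX$; $\varphi$ induces a lax-monoidal structure $\varphi^{\mathrm{mon}}$ on $R^{\mathrm{mon}}$. For a monoid $X$ in $\mathscr{C}$ let $\mathcal{D}(X)$ be the diagram $\alpha_X,\beta_X\colon\mathcal{D}_1(X)=T_{\mathscr{D}}(L(T_{\mathscr{C}}X))\rightrightarrows\mathcal{D}_2(X)=T_{\mathscr{D}}(LX)$ in $\mathrm{Mon}\,\mathscr{D}$, where $\alpha_X$ is induced by the product map $T_{\mathscr{C}}X\to X$ and $\beta_X$ is given on generators $L(X^{\otimes n})$ by the iterated map $c_L\colon L(X^{\otimes n})\to L(X)^{\otimes n}$. $L^{\mathrm{mon}}(X)=\mathrm{colim}\,\mathcal{D}(X)$ is its co-equalizer in $\mathrm{Mon}\,\mathscr{D}$; the functor $L^{\mathrm{mon}}$ is left adjoint to $R^{\mathrm{mon}}$. The canonical colax-monoidal structure on $L^{\mathrm{mon}}$ is the one adjoint to $\varphi^{\mathrm{mon}}$.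 $\mathcal{D}(X)\otimes\mathcal{D}(Y)$ is the diagram $\alpha_X\otimes\alpha_Y,\ \beta_X\otimes\beta_Y\colon\mathcal{D}_1(X)\otimes\mathcal{D}_1(Y)\rightrightarrows\mathcal{D}_2(X)\otimes\mathcal{D}_2(Y)$ in $\mathrm{Mon}\,\mathscr{D}$. The map $i_{X,Y}$ is induced by tensor products $\mathcal{D}_r(X)\otimes\mathcal{D}_r(Y)\to\mathrm{colim}\,\mathcal{D}(X)\otimes\mathrm{colim}\,\mathcal{D}(Y)$, $r=1,2$, of the universal colimit maps. Let $\theta\colon T(A\otimes B)\to T(A)\otimes T(B)$ be the monoid map which on $(A\otimes B)^{\otimes n}$ is the permutation of factors $(A\otimes B)^{\otimes n}\to A^{\otimes n}\otimes B^{\otimes n}$. Define maps of monoids $\Psi'_{X,Y}\colon T_{\mathscr{D}}(L(T_{\mathscr{C}}(X\otimes Y)))\xrightarrow{\theta_*}T_{\mathscr{D}}(L(T_{\mathscr{C}}X\otimes T_{\mathscr{C}}Y))\xrightarrow{(c_L)_*}T_{\mathscr{D}}(L(T_{\mathscr{C}}X)\otimes L(T_{\mathscr{C}}Y))\xrightarrow{\theta}T_{\mathscr{D}}(L(T_{\mathscr{C}}X))\otimes T_{\mathscr{D}}(L(T_{\mathscr{C}}Y))$ and $\Psi''_{X,Y}\colon T_{\mathscr{D}}(L(X\otimes Y))\xrightarrow{(c_L)_*}T_{\mathscr{D}}(LX\otimes LY)\xrightarrow{\theta}T_{\mathscr{D}}(LX)\otimes T_{\mathscr{D}}(LY)$.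 When $c_L$ is quasi-symmetric, $(\Psi',\Psi'')$ is a map of diagrams $\mathcal{D}(X\otimes Y)\to\mathcal{D}(X)\otimes\mathcal{D}(Y)$, and $\Psi_{X,Y}$ is the induced map on colimits. *)

theory Defs
  imports Main
begin

section \<open>Categories, functors, natural transformations\<close>

record ('o, 'a) cat =
  Obj :: "'o set"
  Arr :: "'a set"
  Dom :: "'a \<Rightarrow> 'o"
  Cod :: "'a \<Rightarrow> 'o"
  Ide :: "'o \<Rightarrow> 'a"
  Comp :: "'a \<Rightarrow> 'a \<Rightarrow> 'a"  (infixr "\<cdot>\<index>" 55)

definition hom :: "('o, 'a, 'm) cat_scheme \<Rightarrow> 'o \<Rightarrow> 'o \<Rightarrow> 'a set" where
  "hom K a b = {f \<in> Arr K. Dom K f = a \<and> Cod K f = b}"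

locale category =
  fixes K :: "('o, 'a, 'm) cat_scheme" (structure)
  assumes Dom_Obj: "f \<in> Arr K \<Longrightarrow> Dom K f \<in> Obj K"
    and Cod_Obj: "f \<in> Arr K \<Longrightarrow> Cod K f \<in> Obj K"
    and Ide_hom: "a \<in> Obj K \<Longrightarrow> Ide K a \<in> hom K a a"
    and Comp_hom: "\<lbrakk>f \<in> hom K a b; g \<in> hom K b c\<rbrakk> \<Longrightarrow> g \<cdot> f \<in> hom K a c"
    and Comp_Ide_left: "f \<in> hom K a b \<Longrightarrow> Ide K b \<cdot> f = f"
    and Comp_Ide_right: "f \<in> hom K a b \<Longrightarrow> f \<cdot> Ide K a = f"
    and Comp_assoc: "\<lbrakk>f \<in> hom K a b; g \<in> hom K b c; h \<in> hom K c d\<rbrakk>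
      \<Longrightarrow> (h \<cdot> g) \<cdot> f = h \<cdot> (g \<cdot> f)"

definition inverse_arrows :: "('o, 'a, 'm) cat_scheme \<Rightarrow> 'a \<Rightarrow> 'a \<Rightarrow> bool" where
  "inverse_arrows K f g \<longleftrightarrow> f \<in> Arr K \<and> g \<in> hom K (Cod K f) (Dom K f) \<and>
     g \<cdot>\<^bsub>K\<^esub> f = Ide K (Dom K f) \<and> f \<cdot>\<^bsub>K\<^esub> g = Ide K (Cod K f)"

definition is_iso :: "('o, 'a, 'm) cat_scheme \<Rightarrow> 'a \<Rightarrow> bool" where
  "is_iso K f \<longleftrightarrow> (\<exists>g. inverse_arrows K f g)"

definition arr_inv :: "('o, 'a, 'm) cat_scheme \<Rightarrow> 'a \<Rightarrow> 'a" where
  "arr_inv K f = (THE g. inverse_arrows K f g)"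

record ('o, 'a, 'p, 'b) ftr =
  fob :: "'o \<Rightarrow> 'p"
  far :: "'a \<Rightarrow> 'b"

locale cat_functor = A: category A + B: category B
  for A :: "('o, 'a, 'm) cat_scheme" and B :: "('p, 'b, 'n) cat_scheme"
    and F :: "('o, 'a, 'p, 'b) ftr" +
  assumes fob_Obj: "a \<in> Obj A \<Longrightarrow> fob F a \<in> Obj B"
    and far_hom: "f \<in> hom A a b \<Longrightarrow> far F f \<in> hom B (fob F a) (fob F b)"
    and far_Ide: "a \<in> Obj A \<Longrightarrow> far F (Ide A a) = Ide B (fob F a)"
    and far_Comp: "\<lbrakk>f \<in> hom A a b; g \<in> hom A b c\<rbrakk>
      \<Longrightarrow> far F (g \<cdot>\<^bsub>A\<^esub> f) = far F g \<cdot>\<^bsub>B\<^esub> far F f"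

definition id_ftr :: "('o, 'a, 'o, 'a) ftr" where
  "id_ftr = \<lparr>fob = (\<lambda>a. a), far = (\<lambda>f. f)\<rparr>"

definition comp_ftr :: "('p, 'b, 'q, 'c) ftr \<Rightarrow> ('o, 'a, 'p, 'b) ftr \<Rightarrow> ('o, 'a, 'q, 'c) ftr" where
  "comp_ftr G F = \<lparr>fob = (\<lambda>a. fob G (fob F a)), far = (\<lambda>f. far G (far F f))\<rparr>"

definition natural :: "('o, 'a, 'm) cat_scheme \<Rightarrow> ('p, 'b, 'n) cat_scheme
    \<Rightarrow> ('o, 'a, 'p, 'b) ftr \<Rightarrow> ('o, 'a, 'p, 'b) ftr \<Rightarrow> ('o \<Rightarrow> 'b) \<Rightarrow> bool" where
  "natural A B F G t \<longleftrightarrow>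
     (\<forall>a\<in>Obj A. t a \<in> hom B (fob F a) (fob G a)) \<and>
     (\<forall>f\<in>Arr A. t (Cod A f) \<cdot>\<^bsub>B\<^esub> far F f = far G f \<cdot>\<^bsub>B\<^esub> t (Dom A f))"

locale adjunction = L: cat_functor C D L + R: cat_functor D C R
  for C :: "('o, 'a, 'm) cat_scheme" and D :: "('p, 'b, 'n) cat_scheme"
    and L :: "('o, 'a, 'p, 'b) ftr" and R :: "('p, 'b, 'o, 'a) ftr"
    and \<eta> :: "'o \<Rightarrow> 'a" and \<epsilon> :: "'p \<Rightarrow> 'b" +
  assumes unit_natural: "natural C C id_ftr (comp_ftr R L) \<eta>"
    and counit_natural: "natural D D (comp_ftr L R) id_ftr \<epsilon>"
    and triangle_left: "X \<in> Obj C \<Longrightarrow> \<epsilon> (fob L X) \<cdot>\<^bsub>D\<^esub> far L (\<eta> X) = Ide D (fob L X)"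
    and triangle_right: "Y \<in> Obj D \<Longrightarrow> far R (\<epsilon> Y) \<cdot>\<^bsub>C\<^esub> \<eta> (fob R Y) = Ide C (fob R Y)"


section \<open>Colimits\<close>

definition cocone :: "('i, 'j, 'm) cat_scheme \<Rightarrow> ('o, 'a, 'n) cat_scheme
    \<Rightarrow> ('i, 'j, 'o, 'a) ftr \<Rightarrow> 'o \<Rightarrow> ('i \<Rightarrow> 'a) \<Rightarrow> bool" where
  "cocone J K F P \<iota> \<longleftrightarrow> P \<in> Obj K \<and>
     (\<forall>j\<in>Obj J. \<iota> j \<in> hom K (fob F j) P) \<and>
     (\<forall>u\<in>Arr J. \<iota> (Cod J u) \<cdot>\<^bsub>K\<^esub> far F u = \<iota> (Dom J u))"

definition colimit_cocone :: "('i, 'j, 'm) cat_scheme \<Rightarrow> ('o, 'a, 'n) cat_scheme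
    \<Rightarrow> ('i, 'j, 'o, 'a) ftr \<Rightarrow> 'o \<Rightarrow> ('i \<Rightarrow> 'a) \<Rightarrow> bool" where
  "colimit_cocone J K F P \<iota> \<longleftrightarrow> cocone J K F P \<iota> \<and>
     (\<forall>Q \<kappa>. cocone J K F Q \<kappa> \<longrightarrow>
        (\<exists>!h. h \<in> hom K P Q \<and> (\<forall>j\<in>Obj J. h \<cdot>\<^bsub>K\<^esub> \<iota> j = \<kappa> j)))"

definition preserves_colimits :: "('i, 'j, 'm) cat_scheme \<Rightarrow> ('o, 'a, 'n) cat_scheme
    \<Rightarrow> ('p, 'b, 'k) cat_scheme \<Rightarrow> ('o, 'a, 'p, 'b) ftr \<Rightarrow> ('i, 'j, 'o, 'a) ftr \<Rightarrow> bool" where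
  "preserves_colimits J A B G F \<longleftrightarrow>
     (\<forall>P \<iota>. colimit_cocone J A F P \<iota> \<longrightarrow>
        colimit_cocone J B (comp_ftr G F) (fob G P) (\<lambda>j. far G (\<iota> j)))"

text \<open>Up to isomorphism, every finite category has its objects and arrows in \<^typ>\<open>nat\<close>.\<close>

definition finite_shape :: "(nat, nat) cat \<Rightarrow> bool" where
  "finite_shape J \<longleftrightarrow> category J \<and> finite (Obj J) \<and> finite (Arr J)"

definition nat_discrete :: "(nat, nat) cat" where
  "nat_discrete = \<lparr>Obj = UNIV, Arr = UNIV, Dom = (\<lambda>n. n), Cod = (\<lambda>n. n),
     Ide = (\<lambda>n. n), Comp = (\<lambda>m n. n)\<rparr>"

definition sequence_diagram :: "('o, 'a, 'm) cat_scheme \<Rightarrow> (nat \<Rightarrow> 'o) \<Rightarrow> (nat, nat, 'o, 'a) ftr" where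
  "sequence_diagram K X = \<lparr>fob = X, far = (\<lambda>n. Ide K (X n))\<rparr>"

abbreviation is_coproduct :: "('o, 'a, 'm) cat_scheme \<Rightarrow> (nat \<Rightarrow> 'o) \<Rightarrow> 'o \<Rightarrow> (nat \<Rightarrow> 'a) \<Rightarrow> bool" where
  "is_coproduct K X P \<iota> \<equiv> colimit_cocone nat_discrete K (sequence_diagram K X) P \<iota>"

definition is_coequalizer :: "('o, 'a, 'm) cat_scheme \<Rightarrow> 'a \<Rightarrow> 'a \<Rightarrow> 'a \<Rightarrow> bool" where
  "is_coequalizer K f g q \<longleftrightarrow>
     f \<in> Arr K \<and> g \<in> hom K (Dom K f) (Cod K f) \<and>
     q \<in> Arr K \<and> Dom K q = Cod K f \<and> q \<cdot>\<^bsub>K\<^esub> f = q \<cdot>\<^bsub>K\<^esub> g \<and>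
     (\<forall>h\<in>Arr K. Dom K h = Cod K f \<and> h \<cdot>\<^bsub>K\<^esub> f = h \<cdot>\<^bsub>K\<^esub> g \<longrightarrow>
        (\<exists>!k. k \<in> hom K (Cod K q) (Cod K h) \<and> k \<cdot>\<^bsub>K\<^esub> q = h))"

text \<open>A chosen coequalizer, recorded by its universal map; the colimit object is the codomain.\<close>

definition coeq :: "('o, 'a, 'm) cat_scheme \<Rightarrow> 'a \<Rightarrow> 'a \<Rightarrow> 'a" where
  "coeq K f g = (SOME q. is_coequalizer K f g q)"

text \<open>The colimit of a parallel pair \<open>f, g\<close> has universal maps \<open>coeq K f g \<cdot> f\<close> on the source
  and \<open>coeq K f g\<close> on the target.  The arrow out of the colimit with components \<open>s\<close> (source)
  and \<open>t\<close> (target):\<close>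

definition coeq_desc :: "('o, 'a, 'm) cat_scheme \<Rightarrow> 'a \<Rightarrow> 'a \<Rightarrow> 'a \<Rightarrow> 'a \<Rightarrow> 'a" where
  "coeq_desc K f g s t = (THE h. h \<in> hom K (Cod K (coeq K f g)) (Cod K t) \<and>
     h \<cdot>\<^bsub>K\<^esub> (coeq K f g \<cdot>\<^bsub>K\<^esub> f) = s \<and> h \<cdot>\<^bsub>K\<^esub> coeq K f g = t)"

text \<open>The arrow on colimits induced by a map \<open>(u, v)\<close> of parallel pairs from \<open>(f, g)\<close>
  to \<open>(f', g')\<close>:\<close>

definition coeq_map :: "('o, 'a, 'm) cat_scheme \<Rightarrow> 'a \<Rightarrow> 'a \<Rightarrow> 'a \<Rightarrow> 'a \<Rightarrow> 'a \<Rightarrow> 'a \<Rightarrow> 'a" where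
  "coeq_map K f g f' g' u v = coeq_desc K f g
     ((coeq K f' g' \<cdot>\<^bsub>K\<^esub> f') \<cdot>\<^bsub>K\<^esub> u) (coeq K f' g' \<cdot>\<^bsub>K\<^esub> v)"


section \<open>Monoidal and symmetric monoidal categories\<close>

text \<open>\<open>asc X Y Z : (X \<otimes> Y) \<otimes> Z \<rightarrow> X \<otimes> (Y \<otimes> Z)\<close>, \<open>lun X : 1 \<otimes> X \<rightarrow> X\<close>,
  \<open>run X : X \<otimes> 1 \<rightarrow> X\<close>, \<open>brd X Y : X \<otimes> Y \<rightarrow> Y \<otimes> X\<close>.\<close>

record ('o, 'a) moncat = "('o, 'a) cat" +
  tob :: "'o \<Rightarrow> 'o \<Rightarrow> 'o"  (infixr "\<otimes>\<index>" 70)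
  tar :: "'a \<Rightarrow> 'a \<Rightarrow> 'a"  (infixr "\<otimes>\<^sub>a\<index>" 70)
  uno :: "'o"  ("\<one>\<index>")
  asc :: "'o \<Rightarrow> 'o \<Rightarrow> 'o \<Rightarrow> 'a"
  lun :: "'o \<Rightarrow> 'a"
  run :: "'o \<Rightarrow> 'a"

record ('o, 'a) smcat = "('o, 'a) moncat" +
  brd :: "'o \<Rightarrow> 'o \<Rightarrow> 'a"

locale monoidal_category = category M
  for M :: "('o, 'a, 'm) moncat_scheme" (structure) +
  assumes tob_Obj: "\<lbrakk>X \<in> Obj M; Y \<in> Obj M\<rbrakk> \<Longrightarrow> X \<otimes> Y \<in> Obj M"
    and tar_hom: "\<lbrakk>f \<in> hom M X X'; g \<in> hom M Y Y'\<rbrakk> \<Longrightarrow> f \<otimes>\<^sub>a g \<in> hom M (X \<otimes> Y) (X' \<otimes> Y')"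
    and tar_Ide: "\<lbrakk>X \<in> Obj M; Y \<in> Obj M\<rbrakk> \<Longrightarrow> Ide M X \<otimes>\<^sub>a Ide M Y = Ide M (X \<otimes> Y)"
    and tar_Comp: "\<lbrakk>f \<in> hom M X X'; f' \<in> hom M X' X''; g \<in> hom M Y Y'; g' \<in> hom M Y' Y''\<rbrakk>
      \<Longrightarrow> (f' \<cdot> f) \<otimes>\<^sub>a (g' \<cdot> g) = (f' \<otimes>\<^sub>a g') \<cdot> (f \<otimes>\<^sub>a g)"
    and uno_Obj: "\<one> \<in> Obj M"
    and asc_hom: "\<lbrakk>X \<in> Obj M; Y \<in> Obj M; Z \<in> Obj M\<rbrakk>
      \<Longrightarrow> asc M X Y Z \<in> hom M ((X \<otimes> Y) \<otimes> Z) (X \<otimes> (Y \<otimes> Z))"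
    and asc_iso: "\<lbrakk>X \<in> Obj M; Y \<in> Obj M; Z \<in> Obj M\<rbrakk> \<Longrightarrow> is_iso M (asc M X Y Z)"
    and asc_natural: "\<lbrakk>f \<in> hom M X X'; g \<in> hom M Y Y'; h \<in> hom M Z Z'\<rbrakk>
      \<Longrightarrow> asc M X' Y' Z' \<cdot> ((f \<otimes>\<^sub>a g) \<otimes>\<^sub>a h) = (f \<otimes>\<^sub>a (g \<otimes>\<^sub>a h)) \<cdot> asc M X Y Z"
    and lun_hom: "X \<in> Obj M \<Longrightarrow> lun M X \<in> hom M (\<one> \<otimes> X) X"
    and lun_iso: "X \<in> Obj M \<Longrightarrow> is_iso M (lun M X)"
    and lun_natural: "f \<in> hom M X X' \<Longrightarrow> lun M X' \<cdot> (Ide M \<one> \<otimes>\<^sub>a f) = f \<cdot> lun M X"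
    and run_hom: "X \<in> Obj M \<Longrightarrow> run M X \<in> hom M (X \<otimes> \<one>) X"
    and run_iso: "X \<in> Obj M \<Longrightarrow> is_iso M (run M X)"
    and run_natural: "f \<in> hom M X X' \<Longrightarrow> run M X' \<cdot> (f \<otimes>\<^sub>a Ide M \<one>) = f \<cdot> run M X"
    and pentagon: "\<lbrakk>W \<in> Obj M; X \<in> Obj M; Y \<in> Obj M; Z \<in> Obj M\<rbrakk>
      \<Longrightarrow> (Ide M W \<otimes>\<^sub>a asc M X Y Z) \<cdot> (asc M W (X \<otimes> Y) Z \<cdot> (asc M W X Y \<otimes>\<^sub>a Ide M Z))
          = asc M W X (Y \<otimes> Z) \<cdot> asc M (W \<otimes> X) Y Z"
    and triangle: "\<lbrakk>X \<in> Obj M; Y \<in> Obj M\<rbrakk>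
      \<Longrightarrow> (Ide M X \<otimes>\<^sub>a lun M Y) \<cdot> asc M X \<one> Y = run M X \<otimes>\<^sub>a Ide M Y"

locale symmetric_monoidal_category = monoidal_category M
  for M :: "('o, 'a, 'm) smcat_scheme" (structure) +
  assumes brd_hom: "\<lbrakk>X \<in> Obj M; Y \<in> Obj M\<rbrakk> \<Longrightarrow> brd M X Y \<in> hom M (X \<otimes> Y) (Y \<otimes> X)"
    and brd_natural: "\<lbrakk>f \<in> hom M X X'; g \<in> hom M Y Y'\<rbrakk>
      \<Longrightarrow> brd M X' Y' \<cdot> (f \<otimes>\<^sub>a g) = (g \<otimes>\<^sub>a f) \<cdot> brd M X Y"
    and brd_symmetric: "\<lbrakk>X \<in> Obj M; Y \<in> Obj M\<rbrakk> \<Longrightarrow> brd M Y X \<cdot> brd M X Y = Ide M (X \<otimes> Y)"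
    and hexagon: "\<lbrakk>X \<in> Obj M; Y \<in> Obj M; Z \<in> Obj M\<rbrakk>
      \<Longrightarrow> asc M Y Z X \<cdot> (brd M X (Y \<otimes> Z) \<cdot> asc M X Y Z)
          = (Ide M Y \<otimes>\<^sub>a brd M X Z) \<cdot> (asc M Y X Z \<cdot> (brd M X Y \<otimes>\<^sub>a Ide M Z))"

text \<open>\<open>\<sigma>\<^bsub>B,C\<^esub>\<close> inside a fourfold product: \<open>(A \<otimes> B) \<otimes> (C \<otimes> D) \<rightarrow> (A \<otimes> C) \<otimes> (B \<otimes> D)\<close>.\<close>

definition interchange :: "('o, 'a, 'm) smcat_scheme \<Rightarrow> 'o \<Rightarrow> 'o \<Rightarrow> 'o \<Rightarrow> 'o \<Rightarrow> 'a" where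
  "interchange M A B C D =
     arr_inv M (asc M A C (B \<otimes>\<^bsub>M\<^esub> D)) \<cdot>\<^bsub>M\<^esub>
     (Ide M A \<otimes>\<^sub>a\<^bsub>M\<^esub>
        (asc M C B D \<cdot>\<^bsub>M\<^esub> ((brd M B C \<otimes>\<^sub>a\<^bsub>M\<^esub> Ide M D) \<cdot>\<^bsub>M\<^esub> arr_inv M (asc M B C D)))) \<cdot>\<^bsub>M\<^esub>
     asc M A B (C \<otimes>\<^bsub>M\<^esub> D)"


section \<open>Lax- and colax-monoidal structures\<close>

locale colax_monoidal = A: monoidal_category A + B: monoidal_category B + cat_functor A B F
  for A :: "('o, 'a, 'm) moncat_scheme" and B :: "('p, 'b, 'n) moncat_scheme"
    and F :: "('o, 'a, 'p, 'b) ftr" and c :: "'o \<Rightarrow> 'o \<Rightarrow> 'b" and e :: "'b" +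
  assumes c_hom: "\<lbrakk>X \<in> Obj A; Y \<in> Obj A\<rbrakk>
      \<Longrightarrow> c X Y \<in> hom B (fob F (X \<otimes>\<^bsub>A\<^esub> Y)) (fob F X \<otimes>\<^bsub>B\<^esub> fob F Y)"
    and c_natural: "\<lbrakk>f \<in> hom A X X'; g \<in> hom A Y Y'\<rbrakk>
      \<Longrightarrow> c X' Y' \<cdot>\<^bsub>B\<^esub> far F (f \<otimes>\<^sub>a\<^bsub>A\<^esub> g) = (far F f \<otimes>\<^sub>a\<^bsub>B\<^esub> far F g) \<cdot>\<^bsub>B\<^esub> c X Y"
    and e_hom: "e \<in> hom B (fob F \<one>\<^bsub>A\<^esub>) \<one>\<^bsub>B\<^esub>"
    and coassoc: "\<lbrakk>X \<in> Obj A; Y \<in> Obj A; Z \<in> Obj A\<rbrakk>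
      \<Longrightarrow> asc B (fob F X) (fob F Y) (fob F Z) \<cdot>\<^bsub>B\<^esub>
            ((c X Y \<otimes>\<^sub>a\<^bsub>B\<^esub> Ide B (fob F Z)) \<cdot>\<^bsub>B\<^esub> c (X \<otimes>\<^bsub>A\<^esub> Y) Z)
          = (Ide B (fob F X) \<otimes>\<^sub>a\<^bsub>B\<^esub> c Y Z) \<cdot>\<^bsub>B\<^esub> (c X (Y \<otimes>\<^bsub>A\<^esub> Z) \<cdot>\<^bsub>B\<^esub> far F (asc A X Y Z))"
    and counit_left: "X \<in> Obj A
      \<Longrightarrow> lun B (fob F X) \<cdot>\<^bsub>B\<^esub> ((e \<otimes>\<^sub>a\<^bsub>B\<^esub> Ide B (fob F X)) \<cdot>\<^bsub>B\<^esub> c \<one>\<^bsub>A\<^esub> X) = far F (lun A X)"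
    and counit_right: "X \<in> Obj A
      \<Longrightarrow> run B (fob F X) \<cdot>\<^bsub>B\<^esub> ((Ide B (fob F X) \<otimes>\<^sub>a\<^bsub>B\<^esub> e) \<cdot>\<^bsub>B\<^esub> c X \<one>\<^bsub>A\<^esub>) = far F (run A X)"

locale lax_monoidal = A: monoidal_category A + B: monoidal_category B + cat_functor A B F
  for A :: "('o, 'a, 'm) moncat_scheme" and B :: "('p, 'b, 'n) moncat_scheme"
    and F :: "('o, 'a, 'p, 'b) ftr" and \<phi> :: "'o \<Rightarrow> 'o \<Rightarrow> 'b" and \<phi>\<^sub>0 :: "'b" +
  assumes \<phi>_hom: "\<lbrakk>X \<in> Obj A; Y \<in> Obj A\<rbrakk>
      \<Longrightarrow> \<phi> X Y \<in> hom B (fob F X \<otimes>\<^bsub>B\<^esub> fob F Y) (fob F (X \<otimes>\<^bsub>A\<^esub> Y))"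
    and \<phi>_natural: "\<lbrakk>f \<in> hom A X X'; g \<in> hom A Y Y'\<rbrakk>
      \<Longrightarrow> \<phi> X' Y' \<cdot>\<^bsub>B\<^esub> (far F f \<otimes>\<^sub>a\<^bsub>B\<^esub> far F g) = far F (f \<otimes>\<^sub>a\<^bsub>A\<^esub> g) \<cdot>\<^bsub>B\<^esub> \<phi> X Y"
    and \<phi>\<^sub>0_hom: "\<phi>\<^sub>0 \<in> hom B \<one>\<^bsub>B\<^esub> (fob F \<one>\<^bsub>A\<^esub>)"
    and lax_assoc: "\<lbrakk>X \<in> Obj A; Y \<in> Obj A; Z \<in> Obj A\<rbrakk>
      \<Longrightarrow> far F (asc A X Y Z) \<cdot>\<^bsub>B\<^esub>
            (\<phi> (X \<otimes>\<^bsub>A\<^esub> Y) Z \<cdot>\<^bsub>B\<^esub> (\<phi> X Y \<otimes>\<^sub>a\<^bsub>B\<^esub> Ide B (fob F Z)))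
          = \<phi> X (Y \<otimes>\<^bsub>A\<^esub> Z) \<cdot>\<^bsub>B\<^esub> ((Ide B (fob F X) \<otimes>\<^sub>a\<^bsub>B\<^esub> \<phi> Y Z) \<cdot>\<^bsub>B\<^esub>
            asc B (fob F X) (fob F Y) (fob F Z))"
    and lax_unit_left: "X \<in> Obj A
      \<Longrightarrow> far F (lun A X) \<cdot>\<^bsub>B\<^esub> (\<phi> \<one>\<^bsub>A\<^esub> X \<cdot>\<^bsub>B\<^esub> (\<phi>\<^sub>0 \<otimes>\<^sub>a\<^bsub>B\<^esub> Ide B (fob F X))) = lun B (fob F X)"
    and lax_unit_right: "X \<in> Obj A
      \<Longrightarrow> far F (run A X) \<cdot>\<^bsub>B\<^esub> (\<phi> X \<one>\<^bsub>A\<^esub> \<cdot>\<^bsub>B\<^esub> (Ide B (fob F X) \<otimes>\<^sub>a\<^bsub>B\<^esub> \<phi>\<^sub>0)) = run B (fob F X)"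

definition colax_isomorphic :: "('o, 'a, 'm) moncat_scheme \<Rightarrow> ('p, 'b, 'n) moncat_scheme
    \<Rightarrow> ('o, 'a, 'p, 'b) ftr \<Rightarrow> ('o \<Rightarrow> 'o \<Rightarrow> 'b) \<Rightarrow> 'b \<Rightarrow> ('o \<Rightarrow> 'o \<Rightarrow> 'b) \<Rightarrow> 'b \<Rightarrow> bool" where
  "colax_isomorphic A B F c e c' e' \<longleftrightarrow>
     (\<exists>t. natural A B F F t \<and> (\<forall>X\<in>Obj A. is_iso B (t X)) \<and>
       (\<forall>X\<in>Obj A. \<forall>Y\<in>Obj A. (t X \<otimes>\<^sub>a\<^bsub>B\<^esub> t Y) \<cdot>\<^bsub>B\<^esub> c X Y = c' X Y \<cdot>\<^bsub>B\<^esub> t (X \<otimes>\<^bsub>A\<^esub> Y)) \<and>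
       e = e' \<cdot>\<^bsub>B\<^esub> t \<one>\<^bsub>A\<^esub>)"

definition adj_colax :: "('o, 'a, 'm) moncat_scheme \<Rightarrow> ('p, 'b, 'n) moncat_scheme
    \<Rightarrow> ('o, 'a, 'p, 'b) ftr \<Rightarrow> ('o \<Rightarrow> 'a) \<Rightarrow> ('p \<Rightarrow> 'b)
    \<Rightarrow> ('p \<Rightarrow> 'p \<Rightarrow> 'a) \<Rightarrow> 'o \<Rightarrow> 'o \<Rightarrow> 'b" where
  "adj_colax C D L \<eta> \<epsilon> \<phi> X Y =
     \<epsilon> (fob L X \<otimes>\<^bsub>D\<^esub> fob L Y) \<cdot>\<^bsub>D\<^esub> (far L (\<phi> (fob L X) (fob L Y)) \<cdot>\<^bsub>D\<^esub> far L (\<eta> X \<otimes>\<^sub>a\<^bsub>C\<^esub> \<eta> Y))"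

definition adj_colax_unit :: "('p, 'b, 'n) moncat_scheme
    \<Rightarrow> ('o, 'a, 'p, 'b) ftr \<Rightarrow> ('p \<Rightarrow> 'b) \<Rightarrow> 'a \<Rightarrow> 'b" where
  "adj_colax_unit D L \<epsilon> \<phi>\<^sub>0 = \<epsilon> \<one>\<^bsub>D\<^esub> \<cdot>\<^bsub>D\<^esub> far L \<phi>\<^sub>0"

definition quasi_symmetric :: "('o, 'a, 'm) smcat_scheme \<Rightarrow> ('p, 'b, 'n) smcat_scheme
    \<Rightarrow> ('o, 'a, 'p, 'b) ftr \<Rightarrow> ('o \<Rightarrow> 'o \<Rightarrow> 'b) \<Rightarrow> bool" where
  "quasi_symmetric A B F c \<longleftrightarrow>
     (\<forall>X\<in>Obj A. \<forall>Y\<in>Obj A. \<forall>Z\<in>Obj A. \<forall>W\<in>Obj A.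
        interchange B (fob F X) (fob F Y) (fob F Z) (fob F W) \<cdot>\<^bsub>B\<^esub>
          ((c X Y \<otimes>\<^sub>a\<^bsub>B\<^esub> c Z W) \<cdot>\<^bsub>B\<^esub> c (X \<otimes>\<^bsub>A\<^esub> Y) (Z \<otimes>\<^bsub>A\<^esub> W))
        = (c X Z \<otimes>\<^sub>a\<^bsub>B\<^esub> c Y W) \<cdot>\<^bsub>B\<^esub>
          (c (X \<otimes>\<^bsub>A\<^esub> Z) (Y \<otimes>\<^bsub>A\<^esub> W) \<cdot>\<^bsub>B\<^esub> far F (interchange A X Y Z W)))"


section \<open>Monoids\<close>

record ('o, 'a) mnd =
  Car :: "'o"
  Mul :: "'a"
  Unt :: "'a"

definition is_monoid :: "('o, 'a, 'm) moncat_scheme \<Rightarrow> ('o, 'a) mnd \<Rightarrow> bool" where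
  "is_monoid M x \<longleftrightarrow> Car x \<in> Obj M \<and>
     Mul x \<in> hom M (Car x \<otimes>\<^bsub>M\<^esub> Car x) (Car x) \<and> Unt x \<in> hom M \<one>\<^bsub>M\<^esub> (Car x) \<and>
     Mul x \<cdot>\<^bsub>M\<^esub> (Mul x \<otimes>\<^sub>a\<^bsub>M\<^esub> Ide M (Car x))
       = Mul x \<cdot>\<^bsub>M\<^esub> ((Ide M (Car x) \<otimes>\<^sub>a\<^bsub>M\<^esub> Mul x) \<cdot>\<^bsub>M\<^esub> asc M (Car x) (Car x) (Car x)) \<and>
     Mul x \<cdot>\<^bsub>M\<^esub> (Unt x \<otimes>\<^sub>a\<^bsub>M\<^esub> Ide M (Car x)) = lun M (Car x) \<and>
     Mul x \<cdot>\<^bsub>M\<^esub> (Ide M (Car x) \<otimes>\<^sub>a\<^bsub>M\<^esub> Unt x) = run M (Car x)"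

definition is_monoid_map :: "('o, 'a, 'm) moncat_scheme
    \<Rightarrow> ('o, 'a) mnd \<Rightarrow> 'a \<Rightarrow> ('o, 'a) mnd \<Rightarrow> bool" where
  "is_monoid_map M x f y \<longleftrightarrow> f \<in> hom M (Car x) (Car y) \<and>
     f \<cdot>\<^bsub>M\<^esub> Mul x = Mul y \<cdot>\<^bsub>M\<^esub> (f \<otimes>\<^sub>a\<^bsub>M\<^esub> f) \<and> f \<cdot>\<^bsub>M\<^esub> Unt x = Unt y"

definition tensor_mnd :: "('o, 'a, 'm) smcat_scheme
    \<Rightarrow> ('o, 'a) mnd \<Rightarrow> ('o, 'a) mnd \<Rightarrow> ('o, 'a) mnd" where
  "tensor_mnd M x y = \<lparr>Car = Car x \<otimes>\<^bsub>M\<^esub> Car y,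
     Mul = (Mul x \<otimes>\<^sub>a\<^bsub>M\<^esub> Mul y) \<cdot>\<^bsub>M\<^esub> interchange M (Car x) (Car y) (Car x) (Car y),
     Unt = (Unt x \<otimes>\<^sub>a\<^bsub>M\<^esub> Unt y) \<cdot>\<^bsub>M\<^esub> arr_inv M (lun M \<one>\<^bsub>M\<^esub>)\<rparr>"

definition unit_mnd :: "('o, 'a, 'm) smcat_scheme \<Rightarrow> ('o, 'a) mnd" where
  "unit_mnd M = \<lparr>Car = \<one>\<^bsub>M\<^esub>, Mul = lun M \<one>\<^bsub>M\<^esub>, Unt = Ide M \<one>\<^bsub>M\<^esub>\<rparr>"

text \<open>Arrows of the category of monoids carry their source and target monoid, since an arrow
  of \<open>M\<close> only determines the underlying objects.\<close>

type_synonym ('o, 'a) mnd_arr = "('o, 'a) mnd \<times> 'a \<times> ('o, 'a) mnd"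

definition und :: "('o, 'a) mnd_arr \<Rightarrow> 'a" where
  "und F = fst (snd F)"

definition Mon :: "('o, 'a, 'm) smcat_scheme \<Rightarrow> (('o, 'a) mnd, ('o, 'a) mnd_arr) moncat" where
  "Mon M = \<lparr>
     Obj = {x. is_monoid M x},
     Arr = {(x, f, y). is_monoid M x \<and> is_monoid M y \<and> is_monoid_map M x f y},
     Dom = (\<lambda>(x, f, y). x),
     Cod = (\<lambda>(x, f, y). y),
     Ide = (\<lambda>x. (x, Ide M (Car x), x)),
     Comp = (\<lambda>(y, g, z) (x, f, y'). (x, g \<cdot>\<^bsub>M\<^esub> f, z)),
     tob = tensor_mnd M,
     tar = (\<lambda>(x, f, y) (x', f', y'). (tensor_mnd M x x', f \<otimes>\<^sub>a\<^bsub>M\<^esub> f', tensor_mnd M y y')),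
     uno = unit_mnd M,
     asc = (\<lambda>x y z. (tensor_mnd M (tensor_mnd M x y) z, asc M (Car x) (Car y) (Car z),
                     tensor_mnd M x (tensor_mnd M y z))),
     lun = (\<lambda>x. (tensor_mnd M (unit_mnd M) x, lun M (Car x), x)),
     run = (\<lambda>x. (tensor_mnd M x (unit_mnd M), run M (Car x), x))\<rparr>"


section \<open>Free monoids\<close>

fun tpow :: "('o, 'a, 'm) moncat_scheme \<Rightarrow> 'o \<Rightarrow> nat \<Rightarrow> 'o" where
  "tpow M X 0 = \<one>\<^bsub>M\<^esub>"
| "tpow M X (Suc n) = tpow M X n \<otimes>\<^bsub>M\<^esub> X"

text \<open>The canonical isomorphism \<open>X\<^sup>m \<otimes> X\<^sup>n \<rightarrow> X\<^sup>m\<^sup>+\<^sup>n\<close>.\<close>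

fun tpow_concat :: "('o, 'a, 'm) moncat_scheme \<Rightarrow> 'o \<Rightarrow> nat \<Rightarrow> nat \<Rightarrow> 'a" where
  "tpow_concat M X m 0 = run M (tpow M X m)"
| "tpow_concat M X m (Suc n) =
     (tpow_concat M X m n \<otimes>\<^sub>a\<^bsub>M\<^esub> Ide M X) \<cdot>\<^bsub>M\<^esub> arr_inv M (asc M (tpow M X m) (tpow M X n) X)"

definition power_coproduct :: "('o, 'a, 'm) moncat_scheme \<Rightarrow> 'o \<Rightarrow> 'o \<times> (nat \<Rightarrow> 'a)" where
  "power_coproduct M X = (SOME (P, \<iota>). is_coproduct M (tpow M X) P \<iota>)"

definition tinj :: "('o, 'a, 'm) moncat_scheme \<Rightarrow> 'o \<Rightarrow> nat \<Rightarrow> 'a" where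
  "tinj M X = snd (power_coproduct M X)"

text \<open>The free monoid \<open>T\<^sub>M(X)\<close>, with the concatenation product.\<close>

definition free_monoid :: "('o, 'a, 'm) moncat_scheme \<Rightarrow> 'o \<Rightarrow> ('o, 'a) mnd" where
  "free_monoid M X = (let P = fst (power_coproduct M X) in
     \<lparr>Car = P,
      Mul = (THE \<mu>. \<mu> \<in> hom M (P \<otimes>\<^bsub>M\<^esub> P) P \<and>
        (\<forall>m n. \<mu> \<cdot>\<^bsub>M\<^esub> (tinj M X m \<otimes>\<^sub>a\<^bsub>M\<^esub> tinj M X n) = tinj M X (m + n) \<cdot>\<^bsub>M\<^esub> tpow_concat M X m n)),
      Unt = tinj M X 0\<rparr>)"

abbreviation TC :: "('o, 'a, 'm) moncat_scheme \<Rightarrow> 'o \<Rightarrow> 'o" where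
  "TC M X \<equiv> Car (free_monoid M X)"

text \<open>The inclusion \<open>X \<cong> 1 \<otimes> X = X\<^sup>1 \<rightarrow> T\<^sub>M(X)\<close> of generators.\<close>

definition tgen :: "('o, 'a, 'm) moncat_scheme \<Rightarrow> 'o \<Rightarrow> 'a" where
  "tgen M X = tinj M X 1 \<cdot>\<^bsub>M\<^esub> arr_inv M (lun M X)"

text \<open>The monoid map \<open>T\<^sub>M(X) \<rightarrow> A\<close> extending \<open>f : X \<rightarrow> Car A\<close>.\<close>

definition free_ext :: "('o, 'a, 'm) smcat_scheme \<Rightarrow> ('o, 'a) mnd \<Rightarrow> 'a \<Rightarrow> ('o, 'a) mnd_arr" where
  "free_ext M A f = (THE h. h \<in> hom (Mon M) (free_monoid M (Dom M f)) A \<and>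
     und h \<cdot>\<^bsub>M\<^esub> tgen M (Dom M f) = f)"

definition Tmap :: "('o, 'a, 'm) smcat_scheme \<Rightarrow> 'a \<Rightarrow> ('o, 'a) mnd_arr" where
  "Tmap M f = free_ext M (free_monoid M (Cod M f)) (tgen M (Cod M f) \<cdot>\<^bsub>M\<^esub> f)"

definition product_map :: "('o, 'a, 'm) smcat_scheme \<Rightarrow> ('o, 'a) mnd \<Rightarrow> ('o, 'a) mnd_arr" where
  "product_map M x = free_ext M x (Ide M (Car x))"

text \<open>The permutation of factors \<open>(A \<otimes> B)\<^sup>n \<rightarrow> A\<^sup>n \<otimes> B\<^sup>n\<close>.\<close>

fun tpow_shuffle :: "('o, 'a, 'm) smcat_scheme \<Rightarrow> 'o \<Rightarrow> 'o \<Rightarrow> nat \<Rightarrow> 'a" where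
  "tpow_shuffle M A B 0 = arr_inv M (lun M \<one>\<^bsub>M\<^esub>)"
| "tpow_shuffle M A B (Suc n) =
     interchange M (tpow M A n) (tpow M B n) A B \<cdot>\<^bsub>M\<^esub>
       (tpow_shuffle M A B n \<otimes>\<^sub>a\<^bsub>M\<^esub> Ide M (A \<otimes>\<^bsub>M\<^esub> B))"

definition \<theta> :: "('o, 'a, 'm) smcat_scheme \<Rightarrow> 'o \<Rightarrow> 'o \<Rightarrow> ('o, 'a) mnd_arr" where
  "\<theta> M A B = (THE h.
     h \<in> hom (Mon M) (free_monoid M (A \<otimes>\<^bsub>M\<^esub> B)) (free_monoid M A \<otimes>\<^bsub>Mon M\<^esub> free_monoid M B) \<and>
     (\<forall>n. und h \<cdot>\<^bsub>M\<^esub> tinj M (A \<otimes>\<^bsub>M\<^esub> B) n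
        = (tinj M A n \<otimes>\<^sub>a\<^bsub>M\<^esub> tinj M B n) \<cdot>\<^bsub>M\<^esub> tpow_shuffle M A B n))"


section \<open>Good monoidal categories\<close>

definition tensor_left_ftr :: "('o, 'a, 'm) moncat_scheme \<Rightarrow> 'o \<Rightarrow> ('o, 'a, 'o, 'a) ftr" where
  "tensor_left_ftr M a = \<lparr>fob = (\<lambda>x. a \<otimes>\<^bsub>M\<^esub> x), far = (\<lambda>f. Ide M a \<otimes>\<^sub>a\<^bsub>M\<^esub> f)\<rparr>"

definition tensor_right_ftr :: "('o, 'a, 'm) moncat_scheme \<Rightarrow> 'o \<Rightarrow> ('o, 'a, 'o, 'a) ftr" where
  "tensor_right_ftr M a = \<lparr>fob = (\<lambda>x. x \<otimes>\<^bsub>M\<^esub> a), far = (\<lambda>f. f \<otimes>\<^sub>a\<^bsub>M\<^esub> Ide M a)\<rparr>"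

text \<open>The countable coproducts required are those entering the free monoids.  The existence of
  the coequalizers of monoids, which depend on the adjunction, is not part of this locale.\<close>

locale good_monoidal_category = symmetric_monoidal_category M
  for M :: "('o, 'a, 'm) smcat_scheme" +
  assumes finite_colimits: "\<lbrakk>finite_shape J; cat_functor J M F\<rbrakk> \<Longrightarrow> \<exists>P \<iota>. colimit_cocone J M F P \<iota>"
    and power_coproducts: "X \<in> Obj M \<Longrightarrow> \<exists>P \<iota>. is_coproduct M (tpow M X) P \<iota>"
    and tensor_finite_colimits: "\<lbrakk>finite_shape J; cat_functor J M F; a \<in> Obj M\<rbrakk>
      \<Longrightarrow> preserves_colimits J M M (tensor_left_ftr M a) F \<and>
          preserves_colimits J M M (tensor_right_ftr M a) F"
    and tensor_power_coproducts: "\<lbrakk>X \<in> Obj M; a \<in> Obj M\<rbrakk>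
      \<Longrightarrow> preserves_colimits nat_discrete M M (tensor_left_ftr M a) (sequence_diagram M (tpow M X)) \<and>
          preserves_colimits nat_discrete M M (tensor_right_ftr M a) (sequence_diagram M (tpow M X))"


section \<open>The functor on monoids induced by the right adjoint\<close>

definition Rmon_ob :: "('o, 'a, 'm) smcat_scheme \<Rightarrow> ('p, 'b, 'o, 'a) ftr
    \<Rightarrow> ('p \<Rightarrow> 'p \<Rightarrow> 'a) \<Rightarrow> 'a \<Rightarrow> ('p, 'b) mnd \<Rightarrow> ('o, 'a) mnd" where
  "Rmon_ob C R \<phi> \<phi>\<^sub>0 x = \<lparr>Car = fob R (Car x),
     Mul = far R (Mul x) \<cdot>\<^bsub>C\<^esub> \<phi> (Car x) (Car x),
     Unt = far R (Unt x) \<cdot>\<^bsub>C\<^esub> \<phi>\<^sub>0\<rparr>"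

definition Rmon :: "('o, 'a, 'm) smcat_scheme \<Rightarrow> ('p, 'b, 'o, 'a) ftr
    \<Rightarrow> ('p \<Rightarrow> 'p \<Rightarrow> 'a) \<Rightarrow> 'a
    \<Rightarrow> (('p, 'b) mnd, ('p, 'b) mnd_arr, ('o, 'a) mnd, ('o, 'a) mnd_arr) ftr" where
  "Rmon C R \<phi> \<phi>\<^sub>0 = \<lparr>fob = Rmon_ob C R \<phi> \<phi>\<^sub>0,
     far = (\<lambda>(x, f, y). (Rmon_ob C R \<phi> \<phi>\<^sub>0 x, far R f, Rmon_ob C R \<phi> \<phi>\<^sub>0 y))\<rparr>"

definition \<phi>_mon :: "('o, 'a, 'm) smcat_scheme \<Rightarrow> ('p, 'b, 'n) smcat_scheme
    \<Rightarrow> ('p, 'b, 'o, 'a) ftr \<Rightarrow> ('p \<Rightarrow> 'p \<Rightarrow> 'a) \<Rightarrow> 'a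
    \<Rightarrow> ('p, 'b) mnd \<Rightarrow> ('p, 'b) mnd \<Rightarrow> ('o, 'a) mnd_arr" where
  "\<phi>_mon C D R \<phi> \<phi>\<^sub>0 x y =
     (Rmon_ob C R \<phi> \<phi>\<^sub>0 x \<otimes>\<^bsub>Mon C\<^esub> Rmon_ob C R \<phi> \<phi>\<^sub>0 y, \<phi> (Car x) (Car y),
      Rmon_ob C R \<phi> \<phi>\<^sub>0 (x \<otimes>\<^bsub>Mon D\<^esub> y))"

definition \<phi>_mon_unit :: "('o, 'a, 'm) smcat_scheme \<Rightarrow> ('p, 'b, 'n) smcat_scheme
    \<Rightarrow> ('p, 'b, 'o, 'a) ftr \<Rightarrow> ('p \<Rightarrow> 'p \<Rightarrow> 'a) \<Rightarrow> 'a \<Rightarrow> ('o, 'a) mnd_arr" where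
  "\<phi>_mon_unit C D R \<phi> \<phi>\<^sub>0 = (\<one>\<^bsub>Mon C\<^esub>, \<phi>\<^sub>0, Rmon_ob C R \<phi> \<phi>\<^sub>0 \<one>\<^bsub>Mon D\<^esub>)"


section \<open>The functor on monoids induced by the left adjoint\<close>

text \<open>Throughout, \<open>(c, e)\<close> is a colax-monoidal structure on \<open>L : C \<rightarrow> D\<close>.
  The iterated map \<open>L(X\<^sup>n) \<rightarrow> L(X)\<^sup>n\<close>:\<close>

fun colax_iter :: "('o, 'a, 'm) moncat_scheme \<Rightarrow> ('p, 'b, 'n) moncat_scheme
    \<Rightarrow> ('o, 'a, 'p, 'b) ftr \<Rightarrow> ('o \<Rightarrow> 'o \<Rightarrow> 'b) \<Rightarrow> 'b \<Rightarrow> 'o \<Rightarrow> nat \<Rightarrow> 'b" where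
  "colax_iter C D L c e X 0 = e"
| "colax_iter C D L c e X (Suc n) =
     (colax_iter C D L c e X n \<otimes>\<^sub>a\<^bsub>D\<^esub> Ide D (fob L X)) \<cdot>\<^bsub>D\<^esub> c (tpow C X n) X"

definition \<D>\<^sub>1 :: "('o, 'a, 'm) smcat_scheme \<Rightarrow> ('p, 'b, 'n) smcat_scheme
    \<Rightarrow> ('o, 'a, 'p, 'b) ftr \<Rightarrow> ('o, 'a) mnd \<Rightarrow> ('p, 'b) mnd" where
  "\<D>\<^sub>1 C D L x = free_monoid D (fob L (TC C (Car x)))"

definition \<D>\<^sub>2 :: "('p, 'b, 'n) smcat_scheme
    \<Rightarrow> ('o, 'a, 'p, 'b) ftr \<Rightarrow> ('o, 'a) mnd \<Rightarrow> ('p, 'b) mnd" where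
  "\<D>\<^sub>2 D L x = free_monoid D (fob L (Car x))"

definition \<alpha> :: "('o, 'a, 'm) smcat_scheme \<Rightarrow> ('p, 'b, 'n) smcat_scheme
    \<Rightarrow> ('o, 'a, 'p, 'b) ftr \<Rightarrow> ('o, 'a) mnd \<Rightarrow> ('p, 'b) mnd_arr" where
  "\<alpha> C D L x = Tmap D (far L (und (product_map C x)))"

text \<open>\<open>L(T\<^sub>C X)\<close> is the coproduct of the \<open>L(X\<^sup>n)\<close>, as \<open>L\<close> is a left adjoint.\<close>

definition \<beta>_gen :: "('o, 'a, 'm) smcat_scheme \<Rightarrow> ('p, 'b, 'n) smcat_scheme
    \<Rightarrow> ('o, 'a, 'p, 'b) ftr \<Rightarrow> ('o \<Rightarrow> 'o \<Rightarrow> 'b) \<Rightarrow> 'b \<Rightarrow> 'o \<Rightarrow> 'b" where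
  "\<beta>_gen C D L c e X = (THE b. b \<in> hom D (fob L (TC C X)) (TC D (fob L X)) \<and>
     (\<forall>n. b \<cdot>\<^bsub>D\<^esub> far L (tinj C X n) = tinj D (fob L X) n \<cdot>\<^bsub>D\<^esub> colax_iter C D L c e X n))"

definition \<beta> :: "('o, 'a, 'm) smcat_scheme \<Rightarrow> ('p, 'b, 'n) smcat_scheme
    \<Rightarrow> ('o, 'a, 'p, 'b) ftr \<Rightarrow> ('o \<Rightarrow> 'o \<Rightarrow> 'b) \<Rightarrow> 'b \<Rightarrow> ('o, 'a) mnd \<Rightarrow> ('p, 'b) mnd_arr" where
  "\<beta> C D L c e x = free_ext D (\<D>\<^sub>2 D L x) (\<beta>_gen C D L c e (Car x))"

text \<open>The universal map \<open>\<D>\<^sub>2(X) \<rightarrow> colim \<D>(X) = L\<^sup>m\<^sup>o\<^sup>n(X)\<close>.\<close>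

definition Lmon_proj :: "('o, 'a, 'm) smcat_scheme \<Rightarrow> ('p, 'b, 'n) smcat_scheme
    \<Rightarrow> ('o, 'a, 'p, 'b) ftr \<Rightarrow> ('o \<Rightarrow> 'o \<Rightarrow> 'b) \<Rightarrow> 'b \<Rightarrow> ('o, 'a) mnd \<Rightarrow> ('p, 'b) mnd_arr" where
  "Lmon_proj C D L c e x = coeq (Mon D) (\<alpha> C D L x) (\<beta> C D L c e x)"

definition Lmon :: "('o, 'a, 'm) smcat_scheme \<Rightarrow> ('p, 'b, 'n) smcat_scheme
    \<Rightarrow> ('o, 'a, 'p, 'b) ftr \<Rightarrow> ('o \<Rightarrow> 'o \<Rightarrow> 'b) \<Rightarrow> 'b
    \<Rightarrow> (('o, 'a) mnd, ('o, 'a) mnd_arr, ('p, 'b) mnd, ('p, 'b) mnd_arr) ftr" where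
  "Lmon C D L c e = \<lparr>
     fob = (\<lambda>x. Cod (Mon D) (Lmon_proj C D L c e x)),
     far = (\<lambda>(x, f, y). coeq_map (Mon D)
       (\<alpha> C D L x) (\<beta> C D L c e x) (\<alpha> C D L y) (\<beta> C D L c e y)
       (Tmap D (far L (und (Tmap C f)))) (Tmap D (far L f)))\<rparr>"

text \<open>Under the adjunction between \<open>L\<^sup>m\<^sup>o\<^sup>n\<close> and \<open>R\<^sup>m\<^sup>o\<^sup>n\<close>, a monoid map \<open>L\<^sup>m\<^sup>o\<^sup>n X \<rightarrow> A\<close>
  corresponds to the adjunct \<open>X \<rightarrow> R A\<close> of its restriction to the generators \<open>L X\<close>.
  Its unit and counit:\<close>

definition \<eta>_mon :: "('o, 'a, 'm) smcat_scheme \<Rightarrow> ('p, 'b, 'n) smcat_scheme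
    \<Rightarrow> ('o, 'a, 'p, 'b) ftr \<Rightarrow> ('p, 'b, 'o, 'a) ftr \<Rightarrow> ('o \<Rightarrow> 'a)
    \<Rightarrow> ('p \<Rightarrow> 'p \<Rightarrow> 'a) \<Rightarrow> 'a \<Rightarrow> ('o \<Rightarrow> 'o \<Rightarrow> 'b) \<Rightarrow> 'b \<Rightarrow> ('o, 'a) mnd \<Rightarrow> ('o, 'a) mnd_arr" where
  "\<eta>_mon C D L R \<eta> \<phi> \<phi>\<^sub>0 c e x =
     (x,
      far R (und (Lmon_proj C D L c e x) \<cdot>\<^bsub>D\<^esub> tgen D (fob L (Car x))) \<cdot>\<^bsub>C\<^esub> \<eta> (Car x),
      Rmon_ob C R \<phi> \<phi>\<^sub>0 (fob (Lmon C D L c e) x))"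

definition \<epsilon>_mon :: "('o, 'a, 'm) smcat_scheme \<Rightarrow> ('p, 'b, 'n) smcat_scheme
    \<Rightarrow> ('o, 'a, 'p, 'b) ftr \<Rightarrow> ('p, 'b, 'o, 'a) ftr \<Rightarrow> ('p \<Rightarrow> 'b)
    \<Rightarrow> ('p \<Rightarrow> 'p \<Rightarrow> 'a) \<Rightarrow> 'a \<Rightarrow> ('o \<Rightarrow> 'o \<Rightarrow> 'b) \<Rightarrow> 'b \<Rightarrow> ('p, 'b) mnd \<Rightarrow> ('p, 'b) mnd_arr" where
  "\<epsilon>_mon C D L R \<epsilon> \<phi> \<phi>\<^sub>0 c e y = (let x = Rmon_ob C R \<phi> \<phi>\<^sub>0 y in
     coeq_desc (Mon D) (\<alpha> C D L x) (\<beta> C D L c e x)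
       (free_ext D y (\<epsilon> (Car y)) \<cdot>\<^bsub>Mon D\<^esub> \<alpha> C D L x)
       (free_ext D y (\<epsilon> (Car y))))"


section \<open>The colax structure on the induced left adjoint\<close>

definition \<Psi>' :: "('o, 'a, 'm) smcat_scheme \<Rightarrow> ('p, 'b, 'n) smcat_scheme
    \<Rightarrow> ('o, 'a, 'p, 'b) ftr \<Rightarrow> ('o \<Rightarrow> 'o \<Rightarrow> 'b)
    \<Rightarrow> ('o, 'a) mnd \<Rightarrow> ('o, 'a) mnd \<Rightarrow> ('p, 'b) mnd_arr" where
  "\<Psi>' C D L c x y =
     \<theta> D (fob L (TC C (Car x))) (fob L (TC C (Car y))) \<cdot>\<^bsub>Mon D\<^esub>
     Tmap D (c (TC C (Car x)) (TC C (Car y))) \<cdot>\<^bsub>Mon D\<^esub>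
     Tmap D (far L (und (\<theta> C (Car x) (Car y))))"

definition \<Psi>'' :: "('p, 'b, 'n) smcat_scheme \<Rightarrow> ('o, 'a, 'p, 'b) ftr \<Rightarrow> ('o \<Rightarrow> 'o \<Rightarrow> 'b)
    \<Rightarrow> ('o, 'a) mnd \<Rightarrow> ('o, 'a) mnd \<Rightarrow> ('p, 'b) mnd_arr" where
  "\<Psi>'' D L c x y = \<theta> D (fob L (Car x)) (fob L (Car y)) \<cdot>\<^bsub>Mon D\<^esub> Tmap D (c (Car x) (Car y))"

definition \<alpha>\<alpha> :: "('o, 'a, 'm) smcat_scheme \<Rightarrow> ('p, 'b, 'n) smcat_scheme
    \<Rightarrow> ('o, 'a, 'p, 'b) ftr \<Rightarrow> ('o, 'a) mnd \<Rightarrow> ('o, 'a) mnd \<Rightarrow> ('p, 'b) mnd_arr" where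
  "\<alpha>\<alpha> C D L x y = \<alpha> C D L x \<otimes>\<^sub>a\<^bsub>Mon D\<^esub> \<alpha> C D L y"

definition \<beta>\<beta> :: "('o, 'a, 'm) smcat_scheme \<Rightarrow> ('p, 'b, 'n) smcat_scheme
    \<Rightarrow> ('o, 'a, 'p, 'b) ftr \<Rightarrow> ('o \<Rightarrow> 'o \<Rightarrow> 'b) \<Rightarrow> 'b
    \<Rightarrow> ('o, 'a) mnd \<Rightarrow> ('o, 'a) mnd \<Rightarrow> ('p, 'b) mnd_arr" where
  "\<beta>\<beta> C D L c e x y = \<beta> C D L c e x \<otimes>\<^sub>a\<^bsub>Mon D\<^esub> \<beta> C D L c e y"

definition \<Psi> :: "('o, 'a, 'm) smcat_scheme \<Rightarrow> ('p, 'b, 'n) smcat_scheme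
    \<Rightarrow> ('o, 'a, 'p, 'b) ftr \<Rightarrow> ('o \<Rightarrow> 'o \<Rightarrow> 'b) \<Rightarrow> 'b
    \<Rightarrow> ('o, 'a) mnd \<Rightarrow> ('o, 'a) mnd \<Rightarrow> ('p, 'b) mnd_arr" where
  "\<Psi> C D L c e x y = coeq_map (Mon D)
     (\<alpha> C D L (x \<otimes>\<^bsub>Mon C\<^esub> y)) (\<beta> C D L c e (x \<otimes>\<^bsub>Mon C\<^esub> y)) (\<alpha>\<alpha> C D L x y) (\<beta>\<beta> C D L c e x y)
     (\<Psi>' C D L c x y) (\<Psi>'' D L c x y)"

definition i_map :: "('o, 'a, 'm) smcat_scheme \<Rightarrow> ('p, 'b, 'n) smcat_scheme
    \<Rightarrow> ('o, 'a, 'p, 'b) ftr \<Rightarrow> ('o \<Rightarrow> 'o \<Rightarrow> 'b) \<Rightarrow> 'b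
    \<Rightarrow> ('o, 'a) mnd \<Rightarrow> ('o, 'a) mnd \<Rightarrow> ('p, 'b) mnd_arr" where
  "i_map C D L c e x y = coeq_desc (Mon D) (\<alpha>\<alpha> C D L x y) (\<beta>\<beta> C D L c e x y)
     ((Lmon_proj C D L c e x \<cdot>\<^bsub>Mon D\<^esub> \<alpha> C D L x) \<otimes>\<^sub>a\<^bsub>Mon D\<^esub> (Lmon_proj C D L c e y \<cdot>\<^bsub>Mon D\<^esub> \<alpha> C D L y))
     (Lmon_proj C D L c e x \<otimes>\<^sub>a\<^bsub>Mon D\<^esub> Lmon_proj C D L c e y)"

definition \<Theta> :: "('o, 'a, 'm) smcat_scheme \<Rightarrow> ('p, 'b, 'n) smcat_scheme
    \<Rightarrow> ('o, 'a, 'p, 'b) ftr \<Rightarrow> ('o \<Rightarrow> 'o \<Rightarrow> 'b) \<Rightarrow> 'b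
    \<Rightarrow> ('o, 'a) mnd \<Rightarrow> ('o, 'a) mnd \<Rightarrow> ('p, 'b) mnd_arr" where
  "\<Theta> C D L c e x y = i_map C D L c e x y \<cdot>\<^bsub>Mon D\<^esub> \<Psi> C D L c e x y"

end

theory Submission
  imports Defs
begin

text \<open>
  Write \<open>f\<^sup>\<flat> : L X \<rightarrow> A\<close> for the transpose of \<open>f : X \<rightarrow> R A\<close>.  The whole proof rests on one formula, \<open>flat_\<phi>\<close>: the
  transpose of \<open>\<phi> \<cdot> (f \<otimes> g)\<close> is \<open>(f\<^sup>\<flat> \<otimes> g\<^sup>\<flat>) \<cdot> c\<close>, with \<open>c\<close> the colax structure adjoint to \<open>\<phi>\<close>.

  It turns the axioms of \<open>\<phi>\<close> into those of \<open>c\<close> (\<open>colax_monoidal_left_adjoint\<close>), and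
  it turns quasi-symmetry of \<open>c\<close> into the statement that \<open>\<phi>\<close> commutes with the middle interchange
  (\<open>\<phi>_quasi_symmetric\<close>).  Together with its unit laws, the latter makes \<open>\<phi>\<close> a map of
  monoids \<open>R A \<otimes> R B \<rightarrow> R (A \<otimes> B)\<close>, so that the functor induced by \<open>R\<close> on monoids is lax monoidal (\<open>lax_monoidal_Rmon\<close>).

  A monoid map \<open>H : T (L X) \<rightarrow> A\<close> is given by its restriction \<open>g : L X \<rightarrow> A\<close> to generators.  It
  coequalizes \<open>\<alpha>\<close> and \<open>\<beta>\<close> iff, on every \<open>L (X\<^sup>n)\<close>, multiplying in \<open>X\<close> before applying \<open>g\<close> gives the same as
  splitting with \<open>c\<close>, applying \<open>g\<close> to each factor and multiplying in \<open>A\<close>.  By the formula above, the transpose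
  of this equation says that the transpose \<open>X \<rightarrow> R A\<close> of \<open>g\<close> commutes with \<open>n\<close>-fold products.  Hence \<open>H\<close>
  coequalizes \<open>\<alpha>\<close> and \<open>\<beta>\<close> iff that transpose is a map of monoids (\<open>coequalizes_iff\<close>): the coequalizer
  represents monoid maps \<open>X \<rightarrow> R A\<close>, which is the adjunction on monoids (\<open>adjunction_Mon\<close>).

  Consequently an arrow out of the coequalizer is determined by its composite with the map \<open>gen x\<close> from \<open>L X\<close>.
  For \<open>\<Theta>\<close> (\<open>\<Theta>_arr\<close>) and for the canonical structure this composite is the same, namely
  \<open>(gen x \<otimes> gen y) \<cdot> c\<close>.  So \<open>\<Theta>\<close> \<^emph>\<open>equals\<close> the canonical structure (\<open>\<Theta>_eq_adjoint\<close>), the isomorphism is the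
  identity, and the colax axioms for \<open>\<Theta>\<close> are those of an adjoint structure.  That \<open>\<Theta>\<close> makes sense at
  all, i.e. that \<open>(\<Psi>', \<Psi>'')\<close> is a map of diagrams, again comes down to \<open>\<phi>\<close> being a map of monoids
  (\<open>mprod_tensor_cL\<close>, \<open>\<beta>\<beta>_\<Psi>'\<close>).

  Two general facts enter.  Monoids in a symmetric monoidal category form a monoidal category; this is a matter of
  coherence laws for the interchange, derived by rewriting it in right-nested products.  The coproduct of the
  tensor powers is the free monoid; the arrows out of it are controlled by the iterated products \<open>mprod\<close>.
\<close>

section \<open>Calculating in a category\<close>

context category
begin

text \<open>Hom-set membership is unfolded into equations for source and target.  In this form the side conditions
  of the rules below are found by rewriting, with no search for the intermediate objects.\<close>

lemma in_hom [simp]: "f \<in> hom K a b \<longleftrightarrow> f \<in> Arr K \<and> Dom K f = a \<and> Cod K f = b"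
  by (simp add: hom_def)

declare Dom_Obj [simp] Cod_Obj [simp]

lemma Ide_arr [simp]:
  assumes "a \<in> Obj K"
  shows "Ide K a \<in> Arr K" "Dom K (Ide K a) = a" "Cod K (Ide K a) = a"
  using Ide_hom [OF assms] by simp_all

lemma Comp_arr [simp]:
  assumes "f \<in> Arr K" "g \<in> Arr K" "Cod K f = Dom K g"
  shows "g \<cdot> f \<in> Arr K" "Dom K (g \<cdot> f) = Dom K f" "Cod K (g \<cdot> f) = Cod K g"
  using Comp_hom [of f "Dom K f" "Dom K g" g "Cod K g"] assms by simp_all

lemma Comp_Ide [simp]:
  "\<lbrakk>f \<in> Arr K; Cod K f = b\<rbrakk> \<Longrightarrow> Ide K b \<cdot> f = f"
  "\<lbrakk>f \<in> Arr K; Dom K f = a\<rbrakk> \<Longrightarrow> f \<cdot> Ide K a = f"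
  using Comp_Ide_left [of f "Dom K f" b] Comp_Ide_right [of f a "Cod K f"] by simp_all

lemma Comp_assoc' [simp]:
  "\<lbrakk>f \<in> Arr K; g \<in> Arr K; h \<in> Arr K; Cod K f = Dom K g; Cod K g = Dom K h\<rbrakk>
    \<Longrightarrow> (h \<cdot> g) \<cdot> f = h \<cdot> (g \<cdot> f)"
  using Comp_assoc [of f "Dom K f" "Cod K f" g "Cod K g" h "Cod K h"] by simp

text \<open>Composites are kept bracketed to the right, so an equation \<open>g \<cdot> f = k\<close> is used on the first
  two factors of a longer composite in the following form.\<close>

lemma Comp_reduce:
  "\<lbrakk>g \<cdot> f = k; x \<in> Arr K; f \<in> Arr K; g \<in> Arr K; Cod K x = Dom K f; Cod K f = Dom K g\<rbrakk>
    \<Longrightarrow> g \<cdot> (f \<cdot> x) = k \<cdot> x"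
  using Comp_assoc' [of x f g] by simp

lemma inverse_arrows_unique:
  assumes "inverse_arrows K f g" "inverse_arrows K f h"
  shows "g = h"
proof -
  have *: "f \<in> Arr K" "g \<in> Arr K" "h \<in> Arr K" "Dom K g = Cod K f" "Cod K g = Dom K f"
      "Dom K h = Cod K f" "Cod K h = Dom K f"
      "g \<cdot> f = Ide K (Dom K f)" "f \<cdot> h = Ide K (Cod K f)"
    using assms by (simp_all add: inverse_arrows_def)
  then have "g = g \<cdot> (f \<cdot> h)" by simp
  also have "\<dots> = (g \<cdot> f) \<cdot> h" by (rule Comp_assoc' [symmetric]) (use * in simp_all)
  also have "\<dots> = h" using * by (simp del: Comp_assoc')
  finally show ?thesis .
qed

lemma arr_inv_eq: "inverse_arrows K f g \<Longrightarrow> arr_inv K f = g"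
  unfolding arr_inv_def using inverse_arrows_unique by blast

lemma inverse_arrows_arr_inv: "is_iso K f \<Longrightarrow> inverse_arrows K f (arr_inv K f)"
  unfolding is_iso_def using arr_inv_eq by blast

lemma arr_inv_arr [simp]:
  assumes "is_iso K f"
  shows "arr_inv K f \<in> Arr K" "Dom K (arr_inv K f) = Cod K f" "Cod K (arr_inv K f) = Dom K f"
    "arr_inv K f \<cdot> f = Ide K (Dom K f)" "f \<cdot> arr_inv K f = Ide K (Cod K f)"
  using inverse_arrows_arr_inv [OF assms] by (simp_all add: inverse_arrows_def)

lemma is_iso_Arr: "is_iso K f \<Longrightarrow> f \<in> Arr K"
  by (auto simp: is_iso_def inverse_arrows_def)

lemma arr_inv_cancel [simp]:
  "\<lbrakk>is_iso K f; x \<in> Arr K; Cod K x = Dom K f\<rbrakk> \<Longrightarrow> arr_inv K f \<cdot> (f \<cdot> x) = x"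
  "\<lbrakk>is_iso K f; x \<in> Arr K; Cod K x = Cod K f\<rbrakk> \<Longrightarrow> f \<cdot> (arr_inv K f \<cdot> x) = x"
  by (subst Comp_reduce [where f = f and g = "arr_inv K f" and k = "Ide K (Dom K f)"];
      simp add: is_iso_Arr)
    (subst Comp_reduce [where f = "arr_inv K f" and g = f and k = "Ide K (Cod K f)"];
      simp add: is_iso_Arr)

lemma is_isoI:
  "\<lbrakk>f \<in> Arr K; g \<in> Arr K; Dom K g = Cod K f; Cod K g = Dom K f;
    g \<cdot> f = Ide K (Dom K f); f \<cdot> g = Ide K (Cod K f)\<rbrakk> \<Longrightarrow> is_iso K f"
  by (auto simp: is_iso_def inverse_arrows_def)

lemma is_iso_Ide: "a \<in> Obj K \<Longrightarrow> is_iso K (Ide K a)"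
  by (rule is_isoI [of _ "Ide K a"]) simp_all

lemma iso_mono:
  assumes "is_iso K h" "f \<in> Arr K" "g \<in> Arr K" "Cod K f = Dom K h" "Cod K g = Dom K h" "h \<cdot> f = h \<cdot> g"
  shows "f = g"
  using arr_inv_cancel(1) [of h f] arr_inv_cancel(1) [of h g] assms by metis

lemma iso_epi:
  assumes "is_iso K h" "f \<in> Arr K" "g \<in> Arr K" "Dom K f = Cod K h" "Dom K g = Cod K h" "f \<cdot> h = g \<cdot> h"
  shows "f = g"
proof -
  have "h \<in> Arr K" using assms(1) by (rule is_iso_Arr)
  then have "(f \<cdot> h) \<cdot> arr_inv K h = f" "(g \<cdot> h) \<cdot> arr_inv K h = g"
    using assms(1-5) by simp_all
  then show ?thesis using assms(6) by metis
qed

end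

section \<open>Coherence of the unit isomorphisms\<close>

context monoidal_category
begin

declare uno_Obj [simp] tob_Obj [simp] asc_iso [simp] lun_iso [simp] run_iso [simp]

lemma tar_arr [simp]:
  assumes "f \<in> Arr M" "g \<in> Arr M"
  shows "f \<otimes>\<^sub>a g \<in> Arr M" "Dom M (f \<otimes>\<^sub>a g) = Dom M f \<otimes> Dom M g" "Cod M (f \<otimes>\<^sub>a g) = Cod M f \<otimes> Cod M g"
  using tar_hom [of f "Dom M f" "Cod M f" g "Dom M g" "Cod M g"] assms by simp_all

declare tar_Ide [simp]

lemma tar_Comp' [simp]:
  "\<lbrakk>f \<in> Arr M; f' \<in> Arr M; g \<in> Arr M; g' \<in> Arr M; Cod M f = Dom M f'; Cod M g = Dom M g'\<rbrakk>
    \<Longrightarrow> (f' \<otimes>\<^sub>a g') \<cdot> (f \<otimes>\<^sub>a g) = (f' \<cdot> f) \<otimes>\<^sub>a (g' \<cdot> g)"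
  using tar_Comp [of f "Dom M f" "Dom M f'" f' "Cod M f'" g "Dom M g" "Dom M g'" g' "Cod M g'"]
  by simp

lemma tar_Comp_Comp [simp]:
  "\<lbrakk>f \<in> Arr M; f' \<in> Arr M; g \<in> Arr M; g' \<in> Arr M; Cod M f = Dom M f'; Cod M g = Dom M g';
    x \<in> Arr M; Cod M x = Dom M f \<otimes> Dom M g\<rbrakk>
    \<Longrightarrow> (f' \<otimes>\<^sub>a g') \<cdot> ((f \<otimes>\<^sub>a g) \<cdot> x) = ((f' \<cdot> f) \<otimes>\<^sub>a (g' \<cdot> g)) \<cdot> x"
  by (rule Comp_reduce [OF tar_Comp']) simp_all

lemmas asc_arr [simp] = asc_hom [unfolded in_hom]
  and lun_arr [simp] = lun_hom [unfolded in_hom]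
  and run_arr [simp] = run_hom [unfolded in_hom]

lemma lun_nat: "\<lbrakk>f \<in> Arr M; Dom M f = X; Cod M f = X'\<rbrakk> \<Longrightarrow> lun M X' \<cdot> (Ide M \<one> \<otimes>\<^sub>a f) = f \<cdot> lun M X"
  using lun_natural [of f X X'] by simp

lemma run_nat: "\<lbrakk>f \<in> Arr M; Dom M f = X; Cod M f = X'\<rbrakk> \<Longrightarrow> run M X' \<cdot> (f \<otimes>\<^sub>a Ide M \<one>) = f \<cdot> run M X"
  using run_natural [of f X X'] by simp

text \<open>Associators are moved to the right, past tensor products of arrows.\<close>

lemma asc_nat:
  "\<lbrakk>f \<in> Arr M; g \<in> Arr M; h \<in> Arr M; Cod M f = X'; Cod M g = Y'; Cod M h = Z'\<rbrakk>
    \<Longrightarrow> asc M X' Y' Z' \<cdot> ((f \<otimes>\<^sub>a g) \<otimes>\<^sub>a h) = (f \<otimes>\<^sub>a (g \<otimes>\<^sub>a h)) \<cdot> asc M (Dom M f) (Dom M g) (Dom M h)"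
  using asc_natural [of f "Dom M f" X' g "Dom M g" Y' h "Dom M h" Z'] by simp

lemma asc_nat_Ide:
  "\<lbrakk>h \<in> Arr M; Cod M h = Z'; X \<in> Obj M; Y \<in> Obj M\<rbrakk>
    \<Longrightarrow> asc M X Y Z' \<cdot> (Ide M (X \<otimes> Y) \<otimes>\<^sub>a h) = (Ide M X \<otimes>\<^sub>a (Ide M Y \<otimes>\<^sub>a h)) \<cdot> asc M X Y (Dom M h)"
  using asc_nat [of "Ide M X" "Ide M Y" h X Y Z'] by simp

lemma asc_nat_Comp:
  "\<lbrakk>f \<in> Arr M; g \<in> Arr M; h \<in> Arr M; Cod M f = X'; Cod M g = Y'; Cod M h = Z';
    x \<in> Arr M; Cod M x = (Dom M f \<otimes> Dom M g) \<otimes> Dom M h\<rbrakk>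
    \<Longrightarrow> asc M X' Y' Z' \<cdot> (((f \<otimes>\<^sub>a g) \<otimes>\<^sub>a h) \<cdot> x)
      = (f \<otimes>\<^sub>a (g \<otimes>\<^sub>a h)) \<cdot> (asc M (Dom M f) (Dom M g) (Dom M h) \<cdot> x)"
  using Comp_reduce [OF asc_nat [of f g h X' Y' Z'], of x] by force

lemma asc_nat_Ide_Comp:
  "\<lbrakk>h \<in> Arr M; Cod M h = Z'; X \<in> Obj M; Y \<in> Obj M; x \<in> Arr M; Cod M x = (X \<otimes> Y) \<otimes> Dom M h\<rbrakk>
    \<Longrightarrow> asc M X Y Z' \<cdot> ((Ide M (X \<otimes> Y) \<otimes>\<^sub>a h) \<cdot> x)
      = (Ide M X \<otimes>\<^sub>a (Ide M Y \<otimes>\<^sub>a h)) \<cdot> (asc M X Y (Dom M h) \<cdot> x)"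
  using Comp_reduce [OF asc_nat_Ide [of h Z' X Y], of x] by force

lemmas asc_nats = asc_nat asc_nat_Ide asc_nat_Comp asc_nat_Ide_Comp

lemma pentagon_Comp:
  assumes "W \<in> Obj M" "X \<in> Obj M" "Y \<in> Obj M" "Z \<in> Obj M"
    and "f \<in> Arr M" "Cod M f = ((W \<otimes> X) \<otimes> Y) \<otimes> Z"
  shows "asc M W X (Y \<otimes> Z) \<cdot> (asc M (W \<otimes> X) Y Z \<cdot> f)
    = (Ide M W \<otimes>\<^sub>a asc M X Y Z) \<cdot> (asc M W (X \<otimes> Y) Z \<cdot> ((asc M W X Y \<otimes>\<^sub>a Ide M Z) \<cdot> f))"
  using Comp_reduce [OF pentagon [symmetric, of W X Y Z], of f] assms by simp

lemma triangle_Comp: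
  "\<lbrakk>X \<in> Obj M; Y \<in> Obj M; f \<in> Arr M; Cod M f = (X \<otimes> \<one>) \<otimes> Y\<rbrakk>
    \<Longrightarrow> (Ide M X \<otimes>\<^sub>a lun M Y) \<cdot> (asc M X \<one> Y \<cdot> f) = (run M X \<otimes>\<^sub>a Ide M Y) \<cdot> f"
  by (rule Comp_reduce [OF triangle]) simp_all

lemma is_iso_tar [simp]:
  assumes "is_iso M f" "is_iso M g"
  shows "is_iso M (f \<otimes>\<^sub>a g)"
  using assms is_iso_Arr [of f] is_iso_Arr [of g]
  by (intro is_isoI [of _ "arr_inv M f \<otimes>\<^sub>a arr_inv M g"]) simp_all

declare is_iso_Ide [simp]

lemma tar_unit_cancel_left:
  assumes "f \<in> Arr M" "g \<in> Arr M" "Dom M f = Dom M g" "Cod M f = Cod M g"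
    and "Ide M \<one> \<otimes>\<^sub>a f = Ide M \<one> \<otimes>\<^sub>a g"
  shows "f = g"
proof (rule iso_epi [of "lun M (Dom M f)"])
  show "f \<cdot> lun M (Dom M f) = g \<cdot> lun M (Dom M f)"
    using lun_nat [of f "Dom M f" "Cod M f"] lun_nat [of g "Dom M g" "Cod M g"] assms by simp
qed (use assms in simp_all)

lemma tar_unit_cancel_right:
  assumes "f \<in> Arr M" "g \<in> Arr M" "Dom M f = Dom M g" "Cod M f = Cod M g"
    and "f \<otimes>\<^sub>a Ide M \<one> = g \<otimes>\<^sub>a Ide M \<one>"
  shows "f = g"
proof (rule iso_epi [of "run M (Dom M f)"])
  show "f \<cdot> run M (Dom M f) = g \<cdot> run M (Dom M f)"
    using run_nat [of f "Dom M f" "Cod M f"] run_nat [of g "Dom M g" "Cod M g"] assms by simp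
qed (use assms in simp_all)

text \<open>Tensoring with the unit object is faithful; after it, the claim follows from the pentagon for
  \<open>1, 1, X, Y\<close> and two triangles.\<close>

lemma lun_tob:
  assumes [simp]: "X \<in> Obj M" "Y \<in> Obj M"
  shows "lun M (X \<otimes> Y) \<cdot> asc M \<one> X Y = lun M X \<otimes>\<^sub>a Ide M Y" (is "?lhs = ?rhs")
proof (rule tar_unit_cancel_left)
  show "Ide M \<one> \<otimes>\<^sub>a ?lhs = Ide M \<one> \<otimes>\<^sub>a ?rhs" (is "?l1 = ?r1")
  proof (rule iso_epi [of "asc M \<one> (\<one> \<otimes> X) Y"])
    show "?l1 \<cdot> asc M \<one> (\<one> \<otimes> X) Y
      = ?r1 \<cdot> asc M \<one> (\<one> \<otimes> X) Y" (is "?l2 = ?r2")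
    proof (rule iso_epi [of "asc M \<one> \<one> X \<otimes>\<^sub>a Ide M Y"])
      have "?l1 \<cdot> (asc M \<one> (\<one> \<otimes> X) Y \<cdot> (asc M \<one> \<one> X \<otimes>\<^sub>a Ide M Y))
        = (Ide M \<one> \<otimes>\<^sub>a lun M (X \<otimes> Y)) \<cdot> ((Ide M \<one> \<otimes>\<^sub>a asc M \<one> X Y) \<cdot> (asc M \<one> (\<one> \<otimes> X) Y \<cdot> (asc M \<one> \<one> X \<otimes>\<^sub>a Ide M Y)))"
        by simp
      also have "\<dots> = (Ide M \<one> \<otimes>\<^sub>a lun M (X \<otimes> Y)) \<cdot> (asc M \<one> \<one> (X \<otimes> Y) \<cdot> asc M (\<one> \<otimes> \<one>) X Y)"
        by (simp only: pentagon uno_Obj assms)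
      also have "\<dots> = (run M \<one> \<otimes>\<^sub>a Ide M (X \<otimes> Y)) \<cdot> asc M (\<one> \<otimes> \<one>) X Y"
        by (simp add: triangle_Comp)
      also have "\<dots> = asc M \<one> X Y \<cdot> ((run M \<one> \<otimes>\<^sub>a Ide M X) \<otimes>\<^sub>a Ide M Y)"
        by (simp add: asc_nats)
      also have "\<dots> = asc M \<one> X Y \<cdot> (((Ide M \<one> \<otimes>\<^sub>a lun M X) \<otimes>\<^sub>a Ide M Y) \<cdot> (asc M \<one> \<one> X \<otimes>\<^sub>a Ide M Y))"
        by (simp add: triangle)
      also have "\<dots> = ?r1 \<cdot> (asc M \<one> (\<one> \<otimes> X) Y \<cdot> (asc M \<one> \<one> X \<otimes>\<^sub>a Ide M Y))"
        by (simp add: asc_nats del: tar_Comp' tar_Comp_Comp)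
      finally show "?l2 \<cdot> (asc M \<one> \<one> X \<otimes>\<^sub>a Ide M Y)
        = ?r2 \<cdot> (asc M \<one> \<one> X \<otimes>\<^sub>a Ide M Y)"
        by simp
    qed simp_all
  qed simp_all
qed simp_all

text \<open>The mirror image, from the pentagon for \<open>X, Y, 1, 1\<close>.\<close>

lemma run_tob:
  assumes [simp]: "X \<in> Obj M" "Y \<in> Obj M"
  shows "(Ide M X \<otimes>\<^sub>a run M Y) \<cdot> asc M X Y \<one> = run M (X \<otimes> Y)" (is "?lhs = _")
proof (rule tar_unit_cancel_right)
  show "?lhs \<otimes>\<^sub>a Ide M \<one> = run M (X \<otimes> Y) \<otimes>\<^sub>a Ide M \<one>" (is "?l1 = ?r1")
  proof (rule iso_mono [of "asc M X Y \<one>"])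
    have "asc M X Y \<one> \<cdot> ?l1
      = asc M X Y \<one> \<cdot> (((Ide M X \<otimes>\<^sub>a run M Y) \<otimes>\<^sub>a Ide M \<one>) \<cdot> (asc M X Y \<one> \<otimes>\<^sub>a Ide M \<one>))"
      by simp
    also have "\<dots> = (Ide M X \<otimes>\<^sub>a (run M Y \<otimes>\<^sub>a Ide M \<one>)) \<cdot> (asc M X (Y \<otimes> \<one>) \<one> \<cdot> (asc M X Y \<one> \<otimes>\<^sub>a Ide M \<one>))"
      by (simp add: asc_nats del: tar_Comp' tar_Comp_Comp)
    also have "\<dots> = (Ide M X \<otimes>\<^sub>a (Ide M Y \<otimes>\<^sub>a lun M \<one>)) \<cdot>
        ((Ide M X \<otimes>\<^sub>a asc M Y \<one> \<one>) \<cdot> (asc M X (Y \<otimes> \<one>) \<one> \<cdot> (asc M X Y \<one> \<otimes>\<^sub>a Ide M \<one>)))"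
      by (simp add: triangle)
    also have "\<dots> = (Ide M X \<otimes>\<^sub>a (Ide M Y \<otimes>\<^sub>a lun M \<one>)) \<cdot> (asc M X Y (\<one> \<otimes> \<one>) \<cdot> asc M (X \<otimes> Y) \<one> \<one>)"
      by (simp only: pentagon uno_Obj assms)
    also have "\<dots> = asc M X Y \<one> \<cdot> ((Ide M (X \<otimes> Y) \<otimes>\<^sub>a lun M \<one>) \<cdot> asc M (X \<otimes> Y) \<one> \<one>)"
      by (simp add: asc_nats)
    also have "\<dots> = asc M X Y \<one> \<cdot> ?r1"
      by (simp add: triangle)
    finally show "asc M X Y \<one> \<cdot> ?l1
      = asc M X Y \<one> \<cdot> ?r1" .
  qed simp_all
qed simp_all

text \<open>Naturality of \<open>lun\<close> along \<open>lun \<one>\<close> gives \<open>lun (\<one> \<otimes> \<one>) = Ide \<one> \<otimes> lun \<one>\<close>, and then \<open>lun_tob\<close> and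
  the triangle express \<open>lun \<one> \<otimes> Ide \<one>\<close> and \<open>run \<one> \<otimes> Ide \<one>\<close> by the same arrow.\<close>

lemma lun_uno: "lun M \<one> = run M \<one>"
proof (rule tar_unit_cancel_right)
  have *: "lun M (\<one> \<otimes> \<one>) = Ide M \<one> \<otimes>\<^sub>a lun M \<one>"
    by (rule iso_mono [of "lun M \<one>"]) (simp_all add: lun_nat)
  have "lun M \<one> \<otimes>\<^sub>a Ide M \<one> = lun M (\<one> \<otimes> \<one>) \<cdot> asc M \<one> \<one> \<one>"
    by (simp add: lun_tob)
  also have "\<dots> = run M \<one> \<otimes>\<^sub>a Ide M \<one>"
    by (simp add: * triangle)
  finally show "lun M \<one> \<otimes>\<^sub>a Ide M \<one> = run M \<one> \<otimes>\<^sub>a Ide M \<one>" .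
qed simp_all

end

section \<open>Coherence of the middle interchange\<close>

text \<open>The symmetry in a right-nested product: \<open>B \<otimes> (C \<otimes> D) \<rightarrow> C \<otimes> (B \<otimes> D)\<close>.  The interchange is this arrow
  conjugated by associators, and for right-nested products the coherence laws reduce to exchanges of neighbours.\<close>

definition past :: "('o, 'a, 'm) smcat_scheme \<Rightarrow> 'o \<Rightarrow> 'o \<Rightarrow> 'o \<Rightarrow> 'a" where
  "past M B C D =
     asc M C B D \<cdot>\<^bsub>M\<^esub> ((brd M B C \<otimes>\<^sub>a\<^bsub>M\<^esub> Ide M D) \<cdot>\<^bsub>M\<^esub> arr_inv M (asc M B C D))"

context symmetric_monoidal_category
begin

lemmas brd_arr [simp] = brd_hom [unfolded in_hom]

lemma brd_iso [simp]: "\<lbrakk>X \<in> Obj M; Y \<in> Obj M\<rbrakk> \<Longrightarrow> is_iso M (brd M X Y)"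
  by (rule is_isoI [of _ "brd M Y X"]) (simp_all add: brd_symmetric)

lemma brd_nat:
  "\<lbrakk>f \<in> Arr M; g \<in> Arr M; Cod M f = X'; Cod M g = Y'\<rbrakk>
    \<Longrightarrow> brd M X' Y' \<cdot> (f \<otimes>\<^sub>a g) = (g \<otimes>\<^sub>a f) \<cdot> brd M (Dom M f) (Dom M g)"
  using brd_natural [of f "Dom M f" X' g "Dom M g" Y'] by simp

text \<open>The hexagon with one of the two swapped factors the unit; tensoring with \<open>1\<close> is
  faithful.\<close>

lemma lun_brd:
  assumes [simp]: "X \<in> Obj M"
  shows "lun M X \<cdot> brd M X \<one> = run M X" (is "?lhs = _")
proof (rule tar_unit_cancel_right)
  show "?lhs \<otimes>\<^sub>a Ide M \<one> = run M X \<otimes>\<^sub>a Ide M \<one>" (is "?l1 = ?r1")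
  proof (rule iso_mono [of "brd M X \<one>"])
    have "brd M X \<one> \<cdot> ?l1
      = brd M X \<one> \<cdot> ((lun M X \<otimes>\<^sub>a Ide M \<one>) \<cdot> (brd M X \<one> \<otimes>\<^sub>a Ide M \<one>))"
      by simp
    also have "\<dots> = brd M X \<one> \<cdot> (lun M (X \<otimes> \<one>) \<cdot> (asc M \<one> X \<one> \<cdot> (brd M X \<one> \<otimes>\<^sub>a Ide M \<one>)))"
      by (simp add: lun_tob Comp_reduce [OF lun_tob] del: tar_Comp' tar_Comp_Comp)
    also have "\<dots> = lun M (\<one> \<otimes> X) \<cdot> ((Ide M \<one> \<otimes>\<^sub>a brd M X \<one>) \<cdot> (asc M \<one> X \<one> \<cdot> (brd M X \<one> \<otimes>\<^sub>a Ide M \<one>)))"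
      by (simp add: lun_nat Comp_reduce [OF lun_nat])
    also have "\<dots> = lun M (\<one> \<otimes> X) \<cdot> (asc M \<one> \<one> X \<cdot> (brd M X (\<one> \<otimes> \<one>) \<cdot> asc M X \<one> \<one>))"
      by (simp add: hexagon)
    also have "\<dots> = (lun M \<one> \<otimes>\<^sub>a Ide M X) \<cdot> (brd M X (\<one> \<otimes> \<one>) \<cdot> asc M X \<one> \<one>)"
      by (simp add: Comp_reduce [OF lun_tob])
    also have "\<dots> = brd M X \<one> \<cdot> ((Ide M X \<otimes>\<^sub>a lun M \<one>) \<cdot> asc M X \<one> \<one>)"
      by (simp add: brd_nat Comp_reduce [OF brd_nat])
    also have "\<dots> = brd M X \<one> \<cdot> ?r1"
      by (simp add: triangle)
    finally show "brd M X \<one> \<cdot> ?l1 = brd M X \<one> \<cdot> ?r1" .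
  qed simp_all
qed simp_all

lemma run_brd:
  assumes [simp]: "X \<in> Obj M"
  shows "run M X \<cdot> brd M \<one> X = lun M X"
proof -
  have "run M X \<cdot> brd M \<one> X = lun M X \<cdot> (brd M X \<one> \<cdot> brd M \<one> X)"
    by (simp add: Comp_reduce [OF lun_brd])
  then show ?thesis by (simp add: brd_symmetric)
qed

lemma past_arr [unfolded in_hom, simp]:
  "\<lbrakk>B \<in> Obj M; C \<in> Obj M; D \<in> Obj M\<rbrakk> \<Longrightarrow> past M B C D \<in> hom M (B \<otimes> (C \<otimes> D)) (C \<otimes> (B \<otimes> D))"
  by (simp add: past_def)

lemma past_asc:
  assumes "B \<in> Obj M" "C \<in> Obj M" "D \<in> Obj M"
  shows "past M B C D \<cdot> asc M B C D = asc M C B D \<cdot> (brd M B C \<otimes>\<^sub>a Ide M D)"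
  using assms by (simp add: past_def)

lemma past_nat:
  assumes [simp]: "f \<in> Arr M" "g \<in> Arr M" "h \<in> Arr M"
    and "Cod M f = B'" "Cod M g = C'" "Cod M h = D'"
  shows "past M B' C' D' \<cdot> (f \<otimes>\<^sub>a (g \<otimes>\<^sub>a h)) = (g \<otimes>\<^sub>a (f \<otimes>\<^sub>a h)) \<cdot> past M (Dom M f) (Dom M g) (Dom M h)" (is "?lhs = ?rhs")
proof (rule iso_epi [of "asc M (Dom M f) (Dom M g) (Dom M h)"])
  have [simp]: "B' = Cod M f" "C' = Cod M g" "D' = Cod M h" using assms by simp_all
  have "past M B' C' D' \<cdot> ((f \<otimes>\<^sub>a (g \<otimes>\<^sub>a h)) \<cdot> asc M (Dom M f) (Dom M g) (Dom M h))
    = past M B' C' D' \<cdot> (asc M B' C' D' \<cdot> ((f \<otimes>\<^sub>a g) \<otimes>\<^sub>a h))"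
    by (simp add: asc_nats)
  also have "\<dots> = asc M C' B' D' \<cdot> ((brd M B' C' \<cdot> (f \<otimes>\<^sub>a g)) \<otimes>\<^sub>a h)"
    by (simp add: Comp_reduce [OF past_asc])
  also have "\<dots> = asc M C' B' D' \<cdot> (((g \<otimes>\<^sub>a f) \<otimes>\<^sub>a h) \<cdot> (brd M (Dom M f) (Dom M g) \<otimes>\<^sub>a Ide M (Dom M h)))"
    by (simp add: brd_nat)
  also have "\<dots> = (g \<otimes>\<^sub>a (f \<otimes>\<^sub>a h)) \<cdot> (past M (Dom M f) (Dom M g) (Dom M h) \<cdot> asc M (Dom M f) (Dom M g) (Dom M h))"
    by (simp add: past_asc asc_nats del: tar_Comp' tar_Comp_Comp)
  finally show "?lhs \<cdot> asc M (Dom M f) (Dom M g) (Dom M h)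
    = ?rhs \<cdot> asc M (Dom M f) (Dom M g) (Dom M h)"
    by simp
qed (use assms in auto)

lemma past_past:
  assumes [simp]: "B \<in> Obj M" "C \<in> Obj M" "D \<in> Obj M"
  shows "past M C B D \<cdot> past M B C D = Ide M (B \<otimes> (C \<otimes> D))"
  by (simp add: past_def brd_symmetric)

text \<open>The hexagon: moving \<open>B\<close> past \<open>C \<otimes> E\<close> is moving it past \<open>C\<close> and then past \<open>E\<close>.\<close>

lemma past_tob_right:
  assumes [simp]: "B \<in> Obj M" "C \<in> Obj M" "E \<in> Obj M" "Z \<in> Obj M"
  shows "asc M C E (B \<otimes> Z) \<cdot> past M B (C \<otimes> E) Z
    = (Ide M C \<otimes>\<^sub>a past M B E Z) \<cdot> (past M B C (E \<otimes> Z) \<cdot> (Ide M B \<otimes>\<^sub>a asc M C E Z))" (is "?lhs = ?rhs")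
proof (rule iso_epi [of "asc M B (C \<otimes> E) Z"])
  show "?lhs \<cdot> asc M B (C \<otimes> E) Z
    = ?rhs \<cdot> asc M B (C \<otimes> E) Z" (is "?l1 = ?r1")
  proof (rule iso_epi [of "asc M B C E \<otimes>\<^sub>a Ide M Z"])
    have "asc M C E (B \<otimes> Z) \<cdot> (past M B (C \<otimes> E) Z \<cdot> (asc M B (C \<otimes> E) Z \<cdot> (asc M B C E \<otimes>\<^sub>a Ide M Z)))
      = asc M C E (B \<otimes> Z) \<cdot> (asc M (C \<otimes> E) B Z \<cdot> ((brd M B (C \<otimes> E) \<cdot> asc M B C E) \<otimes>\<^sub>a Ide M Z))"
      by (simp add: Comp_reduce [OF past_asc])
    also have "\<dots> = (Ide M C \<otimes>\<^sub>a asc M E B Z) \<cdot> (asc M C (E \<otimes> B) Z \<cdot>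
        ((asc M C E B \<cdot> (brd M B (C \<otimes> E) \<cdot> asc M B C E)) \<otimes>\<^sub>a Ide M Z))"
      by (simp add: pentagon_Comp)
    also have "\<dots> = (Ide M C \<otimes>\<^sub>a asc M E B Z) \<cdot> (asc M C (E \<otimes> B) Z \<cdot>
        (((Ide M C \<otimes>\<^sub>a brd M B E) \<otimes>\<^sub>a Ide M Z) \<cdot> ((asc M C B E \<cdot> (brd M B C \<otimes>\<^sub>a Ide M E)) \<otimes>\<^sub>a Ide M Z)))"
      by (simp add: hexagon)
    also have "\<dots> = (Ide M C \<otimes>\<^sub>a (asc M E B Z \<cdot> (brd M B E \<otimes>\<^sub>a Ide M Z))) \<cdot>
        (asc M C (B \<otimes> E) Z \<cdot> ((asc M C B E \<otimes>\<^sub>a Ide M Z) \<cdot> ((brd M B C \<otimes>\<^sub>a Ide M E) \<otimes>\<^sub>a Ide M Z)))"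
      by (subst asc_nat_Comp) simp_all
    also have "\<dots> = (Ide M C \<otimes>\<^sub>a past M B E Z) \<cdot> ((Ide M C \<otimes>\<^sub>a asc M B E Z) \<cdot>
        (asc M C (B \<otimes> E) Z \<cdot> ((asc M C B E \<otimes>\<^sub>a Ide M Z) \<cdot> ((brd M B C \<otimes>\<^sub>a Ide M E) \<otimes>\<^sub>a Ide M Z))))"
      by (simp add: past_asc)
    also have "\<dots> = (Ide M C \<otimes>\<^sub>a past M B E Z) \<cdot> (asc M C B (E \<otimes> Z) \<cdot> (asc M (C \<otimes> B) E Z \<cdot>
        ((brd M B C \<otimes>\<^sub>a Ide M E) \<otimes>\<^sub>a Ide M Z)))"
      by (subst pentagon_Comp) simp_all
    also have "\<dots> = (Ide M C \<otimes>\<^sub>a past M B E Z) \<cdot> (past M B C (E \<otimes> Z) \<cdot>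
        (asc M B C (E \<otimes> Z) \<cdot> asc M (B \<otimes> C) E Z))"
      by (simp add: asc_nats Comp_reduce [OF past_asc])
    also have "\<dots> = (Ide M C \<otimes>\<^sub>a past M B E Z) \<cdot> (past M B C (E \<otimes> Z) \<cdot>
        ((Ide M B \<otimes>\<^sub>a asc M C E Z) \<cdot> (asc M B (C \<otimes> E) Z \<cdot> (asc M B C E \<otimes>\<^sub>a Ide M Z))))"
      by (simp only: pentagon assms)
    finally show "?l1 \<cdot> (asc M B C E \<otimes>\<^sub>a Ide M Z)
      = ?r1 \<cdot> (asc M B C E \<otimes>\<^sub>a Ide M Z)"
      by simp
  qed simp_all
qed simp_all

lemma past_iso [simp]:
  "\<lbrakk>B \<in> Obj M; C \<in> Obj M; D \<in> Obj M\<rbrakk> \<Longrightarrow> is_iso M (past M B C D)"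
  by (rule is_isoI [of _ "past M C B D"]) (simp_all add: past_past)

text \<open>Since \<open>past\<close> is its own inverse, this is \<open>past_tob_right\<close> read backwards.\<close>

lemma past_tob_left:
  assumes [simp]: "B \<in> Obj M" "D \<in> Obj M" "E \<in> Obj M" "Z \<in> Obj M"
  shows "(Ide M E \<otimes>\<^sub>a asc M B D Z) \<cdot> past M (B \<otimes> D) E Z
    = past M B E (D \<otimes> Z) \<cdot> ((Ide M B \<otimes>\<^sub>a past M D E Z) \<cdot> asc M B D (E \<otimes> Z))" (is "?lhs = ?rhs")
proof (rule iso_epi [of "past M E (B \<otimes> D) Z"])
  have "past M B E (D \<otimes> Z) \<cdot> ((Ide M B \<otimes>\<^sub>a past M D E Z) \<cdot> (asc M B D (E \<otimes> Z) \<cdot> past M E (B \<otimes> D) Z))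
    = past M B E (D \<otimes> Z) \<cdot> ((Ide M B \<otimes>\<^sub>a (past M D E Z \<cdot> past M E D Z)) \<cdot>
        (past M E B (D \<otimes> Z) \<cdot> (Ide M E \<otimes>\<^sub>a asc M B D Z)))"
    by (simp add: past_tob_right)
  also have "\<dots> = Ide M E \<otimes>\<^sub>a asc M B D Z"
    by (simp add: past_past Comp_reduce [OF past_past])
  finally show "?lhs \<cdot> past M E (B \<otimes> D) Z
    = ?rhs \<cdot> past M E (B \<otimes> D) Z"
    by (simp add: past_past)
qed simp_all

text \<open>Moving \<open>B\<close> past \<open>C\<close> does not touch what stands to the right of them, so it may be bracketed in two
  ways; the two are compared by the pentagon.\<close>

lemma past_tar_Ide:
  assumes [simp]: "B \<in> Obj M" "C \<in> Obj M" "D \<in> Obj M" "F \<in> Obj M"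
  shows "past M B C (D \<otimes> F) \<cdot> ((Ide M B \<otimes>\<^sub>a asc M C D F) \<cdot> asc M B (C \<otimes> D) F)
    = (Ide M C \<otimes>\<^sub>a asc M B D F) \<cdot> (asc M C (B \<otimes> D) F \<cdot> (past M B C D \<otimes>\<^sub>a Ide M F))" (is "?lhs = ?rhs")
proof (rule iso_epi [of "asc M B C D \<otimes>\<^sub>a Ide M F"])
  have "past M B C (D \<otimes> F) \<cdot> ((Ide M B \<otimes>\<^sub>a asc M C D F) \<cdot> (asc M B (C \<otimes> D) F \<cdot> (asc M B C D \<otimes>\<^sub>a Ide M F)))
    = past M B C (D \<otimes> F) \<cdot> (asc M B C (D \<otimes> F) \<cdot> asc M (B \<otimes> C) D F)"
    by (simp add: pentagon)
  also have "\<dots> = asc M C B (D \<otimes> F) \<cdot> (asc M (C \<otimes> B) D F \<cdot> ((brd M B C \<otimes>\<^sub>a Ide M D) \<otimes>\<^sub>a Ide M F))"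
    by (simp add: asc_nats Comp_reduce [OF past_asc])
  also have "\<dots> = (Ide M C \<otimes>\<^sub>a asc M B D F) \<cdot> (asc M C (B \<otimes> D) F \<cdot> ((asc M C B D \<cdot> (brd M B C \<otimes>\<^sub>a Ide M D)) \<otimes>\<^sub>a Ide M F))"
    by (simp add: pentagon_Comp)
  also have "\<dots> = (Ide M C \<otimes>\<^sub>a asc M B D F) \<cdot> (asc M C (B \<otimes> D) F \<cdot> ((past M B C D \<cdot> asc M B C D) \<otimes>\<^sub>a Ide M F))"
    by (simp add: past_asc)
  finally show "?lhs \<cdot> (asc M B C D \<otimes>\<^sub>a Ide M F)
    = ?rhs \<cdot> (asc M B C D \<otimes>\<^sub>a Ide M F)"
    by simp
qed simp_all

lemma interchange_past:
  "interchange M A B C D = arr_inv M (asc M A C (B \<otimes> D)) \<cdot> ((Ide M A \<otimes>\<^sub>a past M B C D) \<cdot> asc M A B (C \<otimes> D))"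
  by (simp add: interchange_def past_def)

lemma interchange_arr [unfolded in_hom, simp]:
  "\<lbrakk>A \<in> Obj M; B \<in> Obj M; C \<in> Obj M; D \<in> Obj M\<rbrakk>
    \<Longrightarrow> interchange M A B C D \<in> hom M ((A \<otimes> B) \<otimes> (C \<otimes> D)) ((A \<otimes> C) \<otimes> (B \<otimes> D))"
  by (simp add: interchange_past)

lemma asc_interchange:
  assumes "A \<in> Obj M" "B \<in> Obj M" "C \<in> Obj M" "D \<in> Obj M"
  shows "asc M A C (B \<otimes> D) \<cdot> interchange M A B C D = (Ide M A \<otimes>\<^sub>a past M B C D) \<cdot> asc M A B (C \<otimes> D)"
  using assms by (simp add: interchange_past)

lemma interchange_nat:
  assumes [simp]: "f \<in> Arr M" "g \<in> Arr M" "h \<in> Arr M" "k \<in> Arr M"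
    and "Cod M f = A'" "Cod M g = B'" "Cod M h = C'" "Cod M k = D'"
  shows "interchange M A' B' C' D' \<cdot> ((f \<otimes>\<^sub>a g) \<otimes>\<^sub>a (h \<otimes>\<^sub>a k))
    = ((f \<otimes>\<^sub>a h) \<otimes>\<^sub>a (g \<otimes>\<^sub>a k)) \<cdot> interchange M (Dom M f) (Dom M g) (Dom M h) (Dom M k)" (is "?lhs = ?rhs")
proof (rule iso_mono [of "asc M (Cod M f) (Cod M h) (Cod M g \<otimes> Cod M k)"])
  have [simp]: "A' = Cod M f" "B' = Cod M g" "C' = Cod M h" "D' = Cod M k" using assms by simp_all
  have "asc M A' C' (B' \<otimes> D') \<cdot> ?lhs
    = (Ide M A' \<otimes>\<^sub>a past M B' C' D') \<cdot> ((f \<otimes>\<^sub>a (g \<otimes>\<^sub>a (h \<otimes>\<^sub>a k))) \<cdot> asc M (Dom M f) (Dom M g) (Dom M h \<otimes> Dom M k))"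
    by (simp add: Comp_reduce [OF asc_interchange] asc_nats)
  also have "\<dots> = (f \<otimes>\<^sub>a (h \<otimes>\<^sub>a (g \<otimes>\<^sub>a k))) \<cdot> ((Ide M (Dom M f) \<otimes>\<^sub>a past M (Dom M g) (Dom M h) (Dom M k)) \<cdot>
      asc M (Dom M f) (Dom M g) (Dom M h \<otimes> Dom M k))"
    by (simp add: past_nat)
  also have "\<dots> = asc M A' C' (B' \<otimes> D') \<cdot> ?rhs"
    by (simp only: asc_interchange [symmetric] assms Dom_Obj) (simp add: asc_nats)
  finally show "asc M (Cod M f) (Cod M h) (Cod M g \<otimes> Cod M k) \<cdot> ?lhs
    = asc M (Cod M f) (Cod M h) (Cod M g \<otimes> Cod M k) \<cdot> ?rhs"
    by simp
qed (use assms in auto)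

lemma interchange_interchange:
  assumes [simp]: "A \<in> Obj M" "B \<in> Obj M" "C \<in> Obj M" "D \<in> Obj M"
  shows "interchange M A C B D \<cdot> interchange M A B C D = Ide M ((A \<otimes> B) \<otimes> (C \<otimes> D))"
  by (simp add: interchange_past past_past)

lemma interchange_iso [simp]:
  "\<lbrakk>A \<in> Obj M; B \<in> Obj M; C \<in> Obj M; D \<in> Obj M\<rbrakk> \<Longrightarrow> is_iso M (interchange M A B C D)"
  by (rule is_isoI [of _ "interchange M A C B D"]) (simp_all add: interchange_interchange)

text \<open>Both sides rearrange \<open>A B C D E F\<close> into \<open>A C E B D F\<close>: on the left \<open>B\<close> passes \<open>C\<close>, then \<open>B D\<close> passes \<open>E\<close>;
  on the right \<open>D\<close> passes \<open>E\<close>, then \<open>B\<close> passes \<open>C E\<close>.  In the right-nested product this is the same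
  product of exchanges of neighbours, as \<open>B\<close> past \<open>C\<close> and \<open>D\<close> past \<open>E\<close> commute.\<close>

lemma interchange_assoc:
  assumes [simp]: "A \<in> Obj M" "B \<in> Obj M" "C \<in> Obj M" "D \<in> Obj M" "E \<in> Obj M" "F \<in> Obj M"
  shows "(asc M A C E \<otimes>\<^sub>a asc M B D F) \<cdot>
      (interchange M (A \<otimes> C) (B \<otimes> D) E F \<cdot> (interchange M A B C D \<otimes>\<^sub>a Ide M (E \<otimes> F)))
    = interchange M A B (C \<otimes> E) (D \<otimes> F) \<cdot>
      ((Ide M (A \<otimes> B) \<otimes>\<^sub>a interchange M C D E F) \<cdot> asc M (A \<otimes> B) (C \<otimes> D) (E \<otimes> F))"
    (is "?lhs = ?rhs")
proof -
  define G where "G = E \<otimes> F"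
  have [simp]: "G \<in> Obj M" by (simp add: G_def)
  \<comment> \<open>\<open>r\<close> brackets the common target to the right; \<open>k\<close> moves \<open>B D\<close> past \<open>E\<close>.\<close>
  define r where "r = (Ide M A \<otimes>\<^sub>a asc M C E (B \<otimes> (D \<otimes> F))) \<cdot> asc M A (C \<otimes> E) (B \<otimes> (D \<otimes> F))"
  define k where "k = past M B E (D \<otimes> F) \<cdot> (Ide M B \<otimes>\<^sub>a past M D E F)"
  have [simp]: "k \<in> Arr M" "Dom M k = B \<otimes> (D \<otimes> G)" "Cod M k = E \<otimes> (B \<otimes> (D \<otimes> F))"
    by (simp_all add: k_def G_def)
  have [simp]: "r \<in> Arr M" "Dom M r = (A \<otimes> (C \<otimes> E)) \<otimes> (B \<otimes> (D \<otimes> F))"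
      "Cod M r = A \<otimes> (C \<otimes> (E \<otimes> (B \<otimes> (D \<otimes> F))))" "is_iso M r"
    by (simp_all add: r_def)
       (intro is_isoI [of _ "arr_inv M (asc M A (C \<otimes> E) (B \<otimes> (D \<otimes> F))) \<cdot> (Ide M A \<otimes>\<^sub>a arr_inv M (asc M C E (B \<otimes> (D \<otimes> F))))"]; simp)
  have "r \<cdot> ?rhs = (Ide M A \<otimes>\<^sub>a asc M C E (B \<otimes> (D \<otimes> F))) \<cdot> ((Ide M A \<otimes>\<^sub>a past M B (C \<otimes> E) (D \<otimes> F)) \<cdot>
      (asc M A B ((C \<otimes> E) \<otimes> (D \<otimes> F)) \<cdot>
      ((Ide M (A \<otimes> B) \<otimes>\<^sub>a interchange M C D E F) \<cdot> asc M (A \<otimes> B) (C \<otimes> D) G)))"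
    by (simp add: r_def G_def Comp_reduce [OF asc_interchange])
  also have "\<dots> = (Ide M A \<otimes>\<^sub>a ((Ide M C \<otimes>\<^sub>a past M B E (D \<otimes> F)) \<cdot> (past M B C (E \<otimes> (D \<otimes> F)) \<cdot>
      (Ide M B \<otimes>\<^sub>a (asc M C E (D \<otimes> F) \<cdot> interchange M C D E F))))) \<cdot>
      (asc M A B ((C \<otimes> D) \<otimes> G) \<cdot> asc M (A \<otimes> B) (C \<otimes> D) G)"
    by (simp add: Comp_reduce [OF past_tob_right] asc_nats G_def)
  also have "\<dots> = (Ide M A \<otimes>\<^sub>a ((Ide M C \<otimes>\<^sub>a past M B E (D \<otimes> F)) \<cdot> (past M B C (E \<otimes> (D \<otimes> F)) \<cdot>
      ((Ide M B \<otimes>\<^sub>a (Ide M C \<otimes>\<^sub>a past M D E F)) \<cdot> (Ide M B \<otimes>\<^sub>a asc M C D G))))) \<cdot>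
      (asc M A B ((C \<otimes> D) \<otimes> G) \<cdot> asc M (A \<otimes> B) (C \<otimes> D) G)"
    by (simp add: asc_interchange G_def)
  also have "\<dots> = (Ide M A \<otimes>\<^sub>a ((Ide M C \<otimes>\<^sub>a k) \<cdot> (past M B C (D \<otimes> G) \<cdot> (Ide M B \<otimes>\<^sub>a asc M C D G)))) \<cdot>
      (asc M A B ((C \<otimes> D) \<otimes> G) \<cdot> asc M (A \<otimes> B) (C \<otimes> D) G)"
    by (subst Comp_reduce [OF past_nat]) (simp_all add: k_def G_def)
  finally have R: "r \<cdot> ?rhs = (Ide M A \<otimes>\<^sub>a ((Ide M C \<otimes>\<^sub>a k) \<cdot> (past M B C (D \<otimes> G) \<cdot> (Ide M B \<otimes>\<^sub>a asc M C D G)))) \<cdot>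
      (asc M A B ((C \<otimes> D) \<otimes> G) \<cdot> asc M (A \<otimes> B) (C \<otimes> D) G)" .
  have "r \<cdot> ?lhs = (Ide M A \<otimes>\<^sub>a (Ide M C \<otimes>\<^sub>a (Ide M E \<otimes>\<^sub>a asc M B D F))) \<cdot>
      ((Ide M A \<otimes>\<^sub>a asc M C E ((B \<otimes> D) \<otimes> F)) \<cdot> (asc M A (C \<otimes> E) ((B \<otimes> D) \<otimes> F) \<cdot>
      ((asc M A C E \<otimes>\<^sub>a Ide M ((B \<otimes> D) \<otimes> F)) \<cdot>
      (interchange M (A \<otimes> C) (B \<otimes> D) E F \<cdot> (interchange M A B C D \<otimes>\<^sub>a Ide M G)))))"
  proof -
    have "asc M A C E \<otimes>\<^sub>a asc M B D F = ((Ide M A \<otimes>\<^sub>a (Ide M C \<otimes>\<^sub>a Ide M E)) \<otimes>\<^sub>a asc M B D F) \<cdot> (asc M A C E \<otimes>\<^sub>a Ide M ((B \<otimes> D) \<otimes> F))"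
      by simp
    then show ?thesis
      by (simp add: r_def G_def asc_nats del: tar_Comp' tar_Comp_Comp) (simp add: asc_nats)
  qed
  also have "\<dots> = (Ide M A \<otimes>\<^sub>a (Ide M C \<otimes>\<^sub>a (Ide M E \<otimes>\<^sub>a asc M B D F))) \<cdot>
      (asc M A C (E \<otimes> ((B \<otimes> D) \<otimes> F)) \<cdot> (asc M (A \<otimes> C) E ((B \<otimes> D) \<otimes> F) \<cdot>
      (interchange M (A \<otimes> C) (B \<otimes> D) E F \<cdot> (interchange M A B C D \<otimes>\<^sub>a Ide M G))))"
    by (subst pentagon_Comp) (simp_all add: G_def)
  also have "\<dots> = (Ide M A \<otimes>\<^sub>a (Ide M C \<otimes>\<^sub>a ((Ide M E \<otimes>\<^sub>a asc M B D F) \<cdot> past M (B \<otimes> D) E F))) \<cdot>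
      (asc M A C ((B \<otimes> D) \<otimes> G) \<cdot> (asc M (A \<otimes> C) (B \<otimes> D) G \<cdot> (interchange M A B C D \<otimes>\<^sub>a Ide M G)))"
    by (simp add: G_def Comp_reduce [OF asc_interchange] asc_nats)
  also have "\<dots> = (Ide M A \<otimes>\<^sub>a ((Ide M C \<otimes>\<^sub>a k) \<cdot> (Ide M C \<otimes>\<^sub>a asc M B D G))) \<cdot>
      ((Ide M A \<otimes>\<^sub>a asc M C (B \<otimes> D) G) \<cdot> (asc M A (C \<otimes> (B \<otimes> D)) G \<cdot>
      ((asc M A C (B \<otimes> D) \<cdot> interchange M A B C D) \<otimes>\<^sub>a Ide M G)))"
    by (simp add: past_tob_left pentagon_Comp G_def k_def)
  also have "\<dots> = (Ide M A \<otimes>\<^sub>a ((Ide M C \<otimes>\<^sub>a k) \<cdot> (Ide M C \<otimes>\<^sub>a asc M B D G))) \<cdot>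
      ((Ide M A \<otimes>\<^sub>a asc M C (B \<otimes> D) G) \<cdot> (asc M A (C \<otimes> (B \<otimes> D)) G \<cdot>
      (((Ide M A \<otimes>\<^sub>a past M B C D) \<otimes>\<^sub>a Ide M G) \<cdot> (asc M A B (C \<otimes> D) \<otimes>\<^sub>a Ide M G))))"
    by (simp add: asc_interchange)
  also have "\<dots> = (Ide M A \<otimes>\<^sub>a ((Ide M C \<otimes>\<^sub>a k) \<cdot> ((Ide M C \<otimes>\<^sub>a asc M B D G) \<cdot> (asc M C (B \<otimes> D) G \<cdot> (past M B C D \<otimes>\<^sub>a Ide M G))))) \<cdot>
      (asc M A (B \<otimes> (C \<otimes> D)) G \<cdot> (asc M A B (C \<otimes> D) \<otimes>\<^sub>a Ide M G))"
    by (subst asc_nat_Comp) simp_all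
  also have "\<dots> = (Ide M A \<otimes>\<^sub>a ((Ide M C \<otimes>\<^sub>a k) \<cdot> (past M B C (D \<otimes> G) \<cdot> (Ide M B \<otimes>\<^sub>a asc M C D G)))) \<cdot>
      ((Ide M A \<otimes>\<^sub>a asc M B (C \<otimes> D) G) \<cdot> (asc M A (B \<otimes> (C \<otimes> D)) G \<cdot> (asc M A B (C \<otimes> D) \<otimes>\<^sub>a Ide M G)))"
    by (simp add: past_tar_Ide [symmetric])
  also have "\<dots> = r \<cdot> ?rhs"
    unfolding R by (simp add: pentagon)
  finally have "r \<cdot> ?lhs = r \<cdot> ?rhs" .
  then show ?thesis
    by (rule iso_mono [of r, rotated 5]) simp_all
qed

text \<open>The unit laws corresponding to \<open>interchange_assoc\<close>: together they make the tensor product of two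
  monoids a monoid.\<close>

lemma lun_interchange:
  assumes [simp]: "A \<in> Obj M" "B \<in> Obj M"
  shows "(lun M A \<otimes>\<^sub>a lun M B) \<cdot> interchange M \<one> \<one> A B = lun M (A \<otimes> B) \<cdot> (lun M \<one> \<otimes>\<^sub>a Ide M (A \<otimes> B))"
proof -
  have *: "(Ide M A \<otimes>\<^sub>a lun M B) \<cdot> past M \<one> A B = lun M (A \<otimes> B)"
  proof (rule iso_epi [of "asc M \<one> A B"])
    have "(Ide M A \<otimes>\<^sub>a lun M B) \<cdot> (past M \<one> A B \<cdot> asc M \<one> A B)
      = (run M A \<otimes>\<^sub>a Ide M B) \<cdot> (brd M \<one> A \<otimes>\<^sub>a Ide M B)"
      by (simp add: past_asc triangle_Comp del: tar_Comp' tar_Comp_Comp)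
    then show "((Ide M A \<otimes>\<^sub>a lun M B) \<cdot> past M \<one> A B) \<cdot> asc M \<one> A B = lun M (A \<otimes> B) \<cdot> asc M \<one> A B"
      by (simp add: run_brd lun_tob)
  qed simp_all
  have "(lun M A \<otimes>\<^sub>a lun M B) \<cdot> interchange M \<one> \<one> A B
    = (lun M A \<otimes>\<^sub>a Ide M B) \<cdot> ((Ide M (\<one> \<otimes> A) \<otimes>\<^sub>a lun M B) \<cdot> interchange M \<one> \<one> A B)"
    by simp
  also have "\<dots> = lun M (A \<otimes> B) \<cdot> (asc M \<one> A B \<cdot> ((Ide M (\<one> \<otimes> A) \<otimes>\<^sub>a lun M B) \<cdot> interchange M \<one> \<one> A B))"
    by (simp only: lun_tob [symmetric] assms) simp
  also have "\<dots> = lun M (A \<otimes> B) \<cdot> ((Ide M \<one> \<otimes>\<^sub>a ((Ide M A \<otimes>\<^sub>a lun M B) \<cdot> past M \<one> A B)) \<cdot> asc M \<one> \<one> (A \<otimes> B))"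
    by (simp add: asc_nats asc_interchange)
  also have "\<dots> = lun M (A \<otimes> B) \<cdot> (lun M \<one> \<otimes>\<^sub>a Ide M (A \<otimes> B))"
    by (simp add: * triangle lun_uno)
  finally show ?thesis .
qed

lemma run_interchange:
  assumes [simp]: "A \<in> Obj M" "B \<in> Obj M"
  shows "(run M A \<otimes>\<^sub>a run M B) \<cdot> interchange M A B \<one> \<one> = run M (A \<otimes> B) \<cdot> (Ide M (A \<otimes> B) \<otimes>\<^sub>a lun M \<one>)"
proof -
  have *: "lun M (B \<otimes> \<one>) \<cdot> past M B \<one> \<one> = Ide M B \<otimes>\<^sub>a lun M \<one>"
  proof (rule iso_epi [of "asc M B \<one> \<one>"])
    have "lun M (B \<otimes> \<one>) \<cdot> (past M B \<one> \<one> \<cdot> asc M B \<one> \<one>) = (lun M B \<otimes>\<^sub>a Ide M \<one>) \<cdot> (brd M B \<one> \<otimes>\<^sub>a Ide M \<one>)"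
      by (simp add: past_asc Comp_reduce [OF lun_tob] del: tar_Comp' tar_Comp_Comp)
    then show "(lun M (B \<otimes> \<one>) \<cdot> past M B \<one> \<one>) \<cdot> asc M B \<one> \<one> = (Ide M B \<otimes>\<^sub>a lun M \<one>) \<cdot> asc M B \<one> \<one>"
      by (simp add: lun_brd triangle)
  qed simp_all
  have "(run M A \<otimes>\<^sub>a run M B) \<cdot> interchange M A B \<one> \<one>
    = (Ide M A \<otimes>\<^sub>a run M B) \<cdot> ((run M A \<otimes>\<^sub>a Ide M (B \<otimes> \<one>)) \<cdot> interchange M A B \<one> \<one>)"
    by simp
  also have "\<dots> = (Ide M A \<otimes>\<^sub>a run M B) \<cdot> ((Ide M A \<otimes>\<^sub>a lun M (B \<otimes> \<one>)) \<cdot> (asc M A \<one> (B \<otimes> \<one>) \<cdot> interchange M A B \<one> \<one>))"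
    by (subst triangle_Comp) simp_all
  also have "\<dots> = (Ide M A \<otimes>\<^sub>a (run M B \<cdot> (Ide M B \<otimes>\<^sub>a lun M \<one>))) \<cdot> asc M A B (\<one> \<otimes> \<one>)"
    by (simp add: asc_interchange *)
  also have "\<dots> = (Ide M A \<otimes>\<^sub>a run M B) \<cdot> (asc M A B \<one> \<cdot> (Ide M (A \<otimes> B) \<otimes>\<^sub>a lun M \<one>))"
    by (simp add: asc_nats)
  also have "\<dots> = run M (A \<otimes> B) \<cdot> (Ide M (A \<otimes> B) \<otimes>\<^sub>a lun M \<one>)"
    by (simp add: Comp_reduce [OF run_tob])
  finally show ?thesis .
qed

end

section \<open>The monoidal category of monoids\<close>

text \<open>The monoidal structure on monoids lies over that of the underlying category.  What has to be shown is that the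
  structure arrows are maps of monoids; the equations between them are inherited.\<close>

lemma Mon_simps [simp]:
  "Obj (Mon M) = {x. is_monoid M x}"
  "(x, f, y) \<in> Arr (Mon M) \<longleftrightarrow> is_monoid M x \<and> is_monoid M y \<and> is_monoid_map M x f y"
  "Dom (Mon M) (x, f, y) = x" "Cod (Mon M) (x, f, y) = y"
  "Ide (Mon M) x = (x, Ide M (Car x), x)"
  "Comp (Mon M) (y', g, z) (x, f, y) = (x, g \<cdot>\<^bsub>M\<^esub> f, z)"
  "tob (Mon M) x x' = tensor_mnd M x x'"
  "tar (Mon M) (x, f, y) (x', f', y') = (tensor_mnd M x x', f \<otimes>\<^sub>a\<^bsub>M\<^esub> f', tensor_mnd M y y')"
  "uno (Mon M) = unit_mnd M"
  "asc (Mon M) x y z = (tensor_mnd M (tensor_mnd M x y) z, asc M (Car x) (Car y) (Car z),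
     tensor_mnd M x (tensor_mnd M y z))"
  "lun (Mon M) x = (tensor_mnd M (unit_mnd M) x, lun M (Car x), x)"
  "run (Mon M) x = (tensor_mnd M x (unit_mnd M), run M (Car x), x)"
  by (simp_all add: Mon_def)

lemma Mon_ArrE:
  assumes "F \<in> Arr (Mon M)"
  obtains x f y where "F = (x, f, y)" "is_monoid M x" "is_monoid M y" "is_monoid_map M x f y"
  using assms by (auto simp: Mon_def)

lemma und_simps [simp]: "und (x, f, y) = f"
  by (simp add: und_def)

lemma tensor_mnd_simps [simp]:
  "Car (tensor_mnd M x y) = Car x \<otimes>\<^bsub>M\<^esub> Car y"
  "Mul (tensor_mnd M x y) = (Mul x \<otimes>\<^sub>a\<^bsub>M\<^esub> Mul y) \<cdot>\<^bsub>M\<^esub> interchange M (Car x) (Car y) (Car x) (Car y)"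
  "Unt (tensor_mnd M x y) = (Unt x \<otimes>\<^sub>a\<^bsub>M\<^esub> Unt y) \<cdot>\<^bsub>M\<^esub> arr_inv M (lun M \<one>\<^bsub>M\<^esub>)"
  by (simp_all add: tensor_mnd_def)

lemma unit_mnd_simps [simp]:
  "Car (unit_mnd M) = \<one>\<^bsub>M\<^esub>" "Mul (unit_mnd M) = lun M \<one>\<^bsub>M\<^esub>" "Unt (unit_mnd M) = Ide M \<one>\<^bsub>M\<^esub>"
  by (simp_all add: unit_mnd_def)

context monoidal_category
begin

lemma is_monoid_arr [simp]:
  assumes "is_monoid M x"
  shows "Car x \<in> Obj M" "Mul x \<in> Arr M" "Dom M (Mul x) = Car x \<otimes> Car x" "Cod M (Mul x) = Car x"
    "Unt x \<in> Arr M" "Dom M (Unt x) = \<one>" "Cod M (Unt x) = Car x"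
  using assms by (simp_all add: is_monoid_def)

lemma Mul_assoc:
  "is_monoid M x \<Longrightarrow> Mul x \<cdot> (Mul x \<otimes>\<^sub>a Ide M (Car x))
    = Mul x \<cdot> ((Ide M (Car x) \<otimes>\<^sub>a Mul x) \<cdot> asc M (Car x) (Car x) (Car x))"
  and Mul_unit_left: "is_monoid M x \<Longrightarrow> Mul x \<cdot> (Unt x \<otimes>\<^sub>a Ide M (Car x)) = lun M (Car x)"
  and Mul_unit_right: "is_monoid M x \<Longrightarrow> Mul x \<cdot> (Ide M (Car x) \<otimes>\<^sub>a Unt x) = run M (Car x)"
  unfolding is_monoid_def by blast+

lemma is_monoid_map_arr:
  assumes "is_monoid_map M x f y"
  shows "f \<in> Arr M" "Dom M f = Car x" "Cod M f = Car y"
  using assms by (simp_all add: is_monoid_map_def)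

lemma is_monoid_map_Mul: "is_monoid_map M x f y \<Longrightarrow> f \<cdot> Mul x = Mul y \<cdot> (f \<otimes>\<^sub>a f)"
  and is_monoid_map_Unt: "is_monoid_map M x f y \<Longrightarrow> f \<cdot> Unt x = Unt y"
  unfolding is_monoid_map_def by blast+

lemma is_monoid_mapI:
  "\<lbrakk>f \<in> Arr M; Dom M f = Car x; Cod M f = Car y; f \<cdot> Mul x = Mul y \<cdot> (f \<otimes>\<^sub>a f); f \<cdot> Unt x = Unt y\<rbrakk>
    \<Longrightarrow> is_monoid_map M x f y"
  unfolding is_monoid_map_def in_hom by blast

lemma is_monoid_map_Ide: "is_monoid M x \<Longrightarrow> is_monoid_map M x (Ide M (Car x)) x"
  by (rule is_monoid_mapI) simp_all

lemma is_monoid_map_Comp: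
  assumes x: "is_monoid M x" and y: "is_monoid M y" and z: "is_monoid M z"
    and f: "is_monoid_map M x f y" and g: "is_monoid_map M y g z"
  shows "is_monoid_map M x (g \<cdot> f) z"
proof (rule is_monoid_mapI)
  note [simp] = x y z is_monoid_map_arr [OF f] is_monoid_map_arr [OF g]
  show "(g \<cdot> f) \<cdot> Mul x = Mul z \<cdot> ((g \<cdot> f) \<otimes>\<^sub>a (g \<cdot> f))"
    by (simp add: is_monoid_map_Mul [OF f] Comp_reduce [OF is_monoid_map_Mul [OF g]])
  show "(g \<cdot> f) \<cdot> Unt x = Unt z"
    by (simp add: is_monoid_map_Unt [OF f] is_monoid_map_Unt [OF g])
qed (use x y z is_monoid_map_arr [OF f] is_monoid_map_arr [OF g] in simp_all)

lemma is_monoid_map_arr_inv: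
  assumes x: "is_monoid M x" and y: "is_monoid M y"
    and f: "is_monoid_map M x f y" and iso: "is_iso M f"
  shows "is_monoid_map M y (arr_inv M f) x"
proof (rule is_monoid_mapI)
  note [simp] = x y iso is_monoid_map_arr [OF f]
  have "arr_inv M f \<cdot> Mul y = arr_inv M f \<cdot> (Mul y \<cdot> ((f \<otimes>\<^sub>a f) \<cdot> (arr_inv M f \<otimes>\<^sub>a arr_inv M f)))"
    by simp
  also have "\<dots> = arr_inv M f \<cdot> (f \<cdot> (Mul x \<cdot> (arr_inv M f \<otimes>\<^sub>a arr_inv M f)))"
    by (subst Comp_reduce [OF is_monoid_map_Mul [OF f]]) simp_all
  finally show "arr_inv M f \<cdot> Mul y = Mul x \<cdot> (arr_inv M f \<otimes>\<^sub>a arr_inv M f)"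
    by simp
  show "arr_inv M f \<cdot> Unt y = Unt x"
    by (simp add: is_monoid_map_Unt [OF f, symmetric])
qed (use x y iso is_monoid_map_arr [OF f] in simp_all)

end

context symmetric_monoidal_category
begin

text \<open>Associativity is \<open>interchange_assoc\<close>, after naturality of the interchange has brought the two
  multiplications to one side; the unit laws are \<open>lun_interchange\<close> and \<open>run_interchange\<close>.\<close>

lemma is_monoid_tensor_mnd [simp]:
  assumes [simp]: "is_monoid M x" "is_monoid M y"
  shows "is_monoid M (tensor_mnd M x y)"
proof -
  define a b where "a = Car x" and "b = Car y"
  have [simp]: "a \<in> Obj M" "b \<in> Obj M" by (simp_all add: a_def b_def)
  let ?t = "tensor_mnd M x y"
  note [simp] = a_def [symmetric] b_def [symmetric]
  have "Mul ?t \<cdot> (Mul ?t \<otimes>\<^sub>a Ide M (Car ?t))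
    = (Mul x \<otimes>\<^sub>a Mul y) \<cdot> (interchange M a b a b \<cdot> (((Mul x \<otimes>\<^sub>a Mul y) \<otimes>\<^sub>a (Ide M a \<otimes>\<^sub>a Ide M b)) \<cdot>
        (interchange M a b a b \<otimes>\<^sub>a Ide M (a \<otimes> b))))"
    by simp
  also have "\<dots> = ((Mul x \<cdot> (Mul x \<otimes>\<^sub>a Ide M a)) \<otimes>\<^sub>a (Mul y \<cdot> (Mul y \<otimes>\<^sub>a Ide M b))) \<cdot>
      (interchange M (a \<otimes> a) (b \<otimes> b) a b \<cdot> (interchange M a b a b \<otimes>\<^sub>a Ide M (a \<otimes> b)))"
    by (subst Comp_reduce [OF interchange_nat]) simp_all
  also have "\<dots> = ((Mul x \<cdot> (Ide M a \<otimes>\<^sub>a Mul x)) \<otimes>\<^sub>a (Mul y \<cdot> (Ide M b \<otimes>\<^sub>a Mul y))) \<cdot>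
      ((asc M a a a \<otimes>\<^sub>a asc M b b b) \<cdot>
      (interchange M (a \<otimes> a) (b \<otimes> b) a b \<cdot> (interchange M a b a b \<otimes>\<^sub>a Ide M (a \<otimes> b))))"
    by (simp add: Mul_assoc [of x, simplified] Mul_assoc [of y, simplified])
  also have "\<dots> = (Mul x \<otimes>\<^sub>a Mul y) \<cdot> (((Ide M a \<otimes>\<^sub>a Mul x) \<otimes>\<^sub>a (Ide M b \<otimes>\<^sub>a Mul y)) \<cdot>
      (interchange M a b (a \<otimes> a) (b \<otimes> b) \<cdot> ((Ide M (a \<otimes> b) \<otimes>\<^sub>a interchange M a b a b) \<cdot> asc M (a \<otimes> b) (a \<otimes> b) (a \<otimes> b))))"
    by (subst interchange_assoc) simp_all
  also have "\<dots> = (Mul x \<otimes>\<^sub>a Mul y) \<cdot> (interchange M a b a b \<cdot> (((Ide M a \<otimes>\<^sub>a Ide M b) \<otimes>\<^sub>a (Mul x \<otimes>\<^sub>a Mul y)) \<cdot>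
      ((Ide M (a \<otimes> b) \<otimes>\<^sub>a interchange M a b a b) \<cdot> asc M (a \<otimes> b) (a \<otimes> b) (a \<otimes> b))))"
    by (subst Comp_reduce [OF interchange_nat]) simp_all
  finally have assoc: "Mul ?t \<cdot> (Mul ?t \<otimes>\<^sub>a Ide M (Car ?t))
    = Mul ?t \<cdot> ((Ide M (Car ?t) \<otimes>\<^sub>a Mul ?t) \<cdot> asc M (Car ?t) (Car ?t) (Car ?t))"
    by simp
  have "Mul ?t \<cdot> (Unt ?t \<otimes>\<^sub>a Ide M (Car ?t))
    = (Mul x \<otimes>\<^sub>a Mul y) \<cdot> (interchange M a b a b \<cdot> (((Unt x \<otimes>\<^sub>a Unt y) \<otimes>\<^sub>a (Ide M a \<otimes>\<^sub>a Ide M b)) \<cdot>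
        (arr_inv M (lun M \<one>) \<otimes>\<^sub>a Ide M (a \<otimes> b))))"
    by simp
  also have "\<dots> = ((Mul x \<cdot> (Unt x \<otimes>\<^sub>a Ide M a)) \<otimes>\<^sub>a (Mul y \<cdot> (Unt y \<otimes>\<^sub>a Ide M b))) \<cdot>
        (interchange M \<one> \<one> a b \<cdot> (arr_inv M (lun M \<one>) \<otimes>\<^sub>a Ide M (a \<otimes> b)))"
    by (subst Comp_reduce [OF interchange_nat]) simp_all
  also have "\<dots> = lun M (a \<otimes> b) \<cdot> ((lun M \<one> \<otimes>\<^sub>a Ide M (a \<otimes> b)) \<cdot> (arr_inv M (lun M \<one>) \<otimes>\<^sub>a Ide M (a \<otimes> b)))"
    by (simp add: Mul_unit_left [of x, simplified] Mul_unit_left [of y, simplified]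
        Comp_reduce [OF lun_interchange] del: tar_Comp' tar_Comp_Comp)
  finally have left: "Mul ?t \<cdot> (Unt ?t \<otimes>\<^sub>a Ide M (Car ?t)) = lun M (Car ?t)"
    by simp
  have "Mul ?t \<cdot> (Ide M (Car ?t) \<otimes>\<^sub>a Unt ?t)
    = (Mul x \<otimes>\<^sub>a Mul y) \<cdot> (interchange M a b a b \<cdot> (((Ide M a \<otimes>\<^sub>a Ide M b) \<otimes>\<^sub>a (Unt x \<otimes>\<^sub>a Unt y)) \<cdot>
        (Ide M (a \<otimes> b) \<otimes>\<^sub>a arr_inv M (lun M \<one>))))"
    by simp
  also have "\<dots> = ((Mul x \<cdot> (Ide M a \<otimes>\<^sub>a Unt x)) \<otimes>\<^sub>a (Mul y \<cdot> (Ide M b \<otimes>\<^sub>a Unt y))) \<cdot>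
        (interchange M a b \<one> \<one> \<cdot> (Ide M (a \<otimes> b) \<otimes>\<^sub>a arr_inv M (lun M \<one>)))"
    by (subst Comp_reduce [OF interchange_nat]) simp_all
  also have "\<dots> = run M (a \<otimes> b) \<cdot> ((Ide M (a \<otimes> b) \<otimes>\<^sub>a lun M \<one>) \<cdot> (Ide M (a \<otimes> b) \<otimes>\<^sub>a arr_inv M (lun M \<one>)))"
    by (simp add: Mul_unit_right [of x, simplified] Mul_unit_right [of y, simplified]
        Comp_reduce [OF run_interchange] del: tar_Comp' tar_Comp_Comp)
  finally have right: "Mul ?t \<cdot> (Ide M (Car ?t) \<otimes>\<^sub>a Unt ?t) = run M (Car ?t)"
    by simp
  show ?thesis
    unfolding is_monoid_def by (intro conjI assoc left right) simp_all
qed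

lemma is_monoid_unit_mnd [simp]: "is_monoid M (unit_mnd M)"
proof -
  have "lun M \<one> \<cdot> (lun M \<one> \<otimes>\<^sub>a Ide M \<one>) = lun M \<one> \<cdot> ((Ide M \<one> \<otimes>\<^sub>a lun M \<one>) \<cdot> asc M \<one> \<one> \<one>)"
    by (simp add: triangle) (simp add: lun_uno)
  then show ?thesis
    unfolding is_monoid_def by (simp add: lun_uno [symmetric])
qed

lemma is_monoid_map_tar:
  assumes [simp]: "is_monoid M x" "is_monoid M y" "is_monoid M x'" "is_monoid M y'"
    and f: "is_monoid_map M x f x'" and g: "is_monoid_map M y g y'"
  shows "is_monoid_map M (tensor_mnd M x y) (f \<otimes>\<^sub>a g) (tensor_mnd M x' y')"
proof (rule is_monoid_mapI)
  note [simp] = is_monoid_map_arr [OF f] is_monoid_map_arr [OF g]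
  have "(f \<otimes>\<^sub>a g) \<cdot> Mul (tensor_mnd M x y)
    = (Mul x' \<otimes>\<^sub>a Mul y') \<cdot> (((f \<otimes>\<^sub>a f) \<otimes>\<^sub>a (g \<otimes>\<^sub>a g)) \<cdot> interchange M (Car x) (Car y) (Car x) (Car y))"
    by (simp add: is_monoid_map_Mul [OF f] is_monoid_map_Mul [OF g])
  also have "\<dots> = Mul (tensor_mnd M x' y') \<cdot> ((f \<otimes>\<^sub>a g) \<otimes>\<^sub>a (f \<otimes>\<^sub>a g))"
    by (simp add: interchange_nat)
  finally show "(f \<otimes>\<^sub>a g) \<cdot> Mul (tensor_mnd M x y) = Mul (tensor_mnd M x' y') \<cdot> ((f \<otimes>\<^sub>a g) \<otimes>\<^sub>a (f \<otimes>\<^sub>a g))" .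
  show "(f \<otimes>\<^sub>a g) \<cdot> Unt (tensor_mnd M x y) = Unt (tensor_mnd M x' y')"
    by (simp add: is_monoid_map_Unt [OF f] is_monoid_map_Unt [OF g])
qed (use is_monoid_map_arr [OF f] is_monoid_map_arr [OF g] in simp_all)

text \<open>As interchanges are their own inverses, this is \<open>interchange_assoc\<close> with the interchanges moved to
  the other side.  In this form it says that associators are maps of monoids.\<close>

lemma asc_interchange_interchange:
  assumes [simp]: "a \<in> Obj M" "b \<in> Obj M" "c \<in> Obj M" "a' \<in> Obj M" "b' \<in> Obj M" "c' \<in> Obj M"
  shows "asc M (a \<otimes> a') (b \<otimes> b') (c \<otimes> c') \<cdot>
      ((interchange M a b a' b' \<otimes>\<^sub>a Ide M (c \<otimes> c')) \<cdot> interchange M (a \<otimes> b) c (a' \<otimes> b') c')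
    = (Ide M (a \<otimes> a') \<otimes>\<^sub>a interchange M b c b' c') \<cdot>
      (interchange M a (b \<otimes> c) a' (b' \<otimes> c') \<cdot> (asc M a b c \<otimes>\<^sub>a asc M a' b' c'))" (is "?lhs = ?rhs")
proof (rule iso_mono [of "interchange M a a' (b \<otimes> c) (b' \<otimes> c') \<cdot> (Ide M (a \<otimes> a') \<otimes>\<^sub>a interchange M b b' c c')"])
  show "is_iso M (interchange M a a' (b \<otimes> c) (b' \<otimes> c') \<cdot> (Ide M (a \<otimes> a') \<otimes>\<^sub>a interchange M b b' c c'))"
    by (rule is_isoI [of _ "(Ide M (a \<otimes> a') \<otimes>\<^sub>a interchange M b c b' c') \<cdot> interchange M a (b \<otimes> c) a' (b' \<otimes> c')"])
      (simp_all add: interchange_interchange Comp_reduce [OF interchange_interchange])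
  have "interchange M a a' (b \<otimes> c) (b' \<otimes> c') \<cdot> ((Ide M (a \<otimes> a') \<otimes>\<^sub>a interchange M b b' c c') \<cdot>
      ?lhs)
    = (interchange M a a' (b \<otimes> c) (b' \<otimes> c') \<cdot> ((Ide M (a \<otimes> a') \<otimes>\<^sub>a interchange M b b' c c') \<cdot>
      asc M (a \<otimes> a') (b \<otimes> b') (c \<otimes> c'))) \<cdot>
      ((interchange M a b a' b' \<otimes>\<^sub>a Ide M (c \<otimes> c')) \<cdot> interchange M (a \<otimes> b) c (a' \<otimes> b') c')"
    by simp
  also have "\<dots> = ((asc M a b c \<otimes>\<^sub>a asc M a' b' c') \<cdot>
      (interchange M (a \<otimes> b) (a' \<otimes> b') c c' \<cdot> (interchange M a a' b b' \<otimes>\<^sub>a Ide M (c \<otimes> c')))) \<cdot>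
      ((interchange M a b a' b' \<otimes>\<^sub>a Ide M (c \<otimes> c')) \<cdot> interchange M (a \<otimes> b) c (a' \<otimes> b') c')"
    by (simp only: interchange_assoc assms)
  also have "\<dots> = asc M a b c \<otimes>\<^sub>a asc M a' b' c'"
    by (simp add: interchange_interchange)
  also have "\<dots> = interchange M a a' (b \<otimes> c) (b' \<otimes> c') \<cdot> ((Ide M (a \<otimes> a') \<otimes>\<^sub>a (interchange M b b' c c' \<cdot> interchange M b c b' c')) \<cdot>
      (interchange M a (b \<otimes> c) a' (b' \<otimes> c') \<cdot> (asc M a b c \<otimes>\<^sub>a asc M a' b' c')))"
    by (simp add: interchange_interchange Comp_reduce [OF interchange_interchange])
  finally show "(interchange M a a' (b \<otimes> c) (b' \<otimes> c') \<cdot> (Ide M (a \<otimes> a') \<otimes>\<^sub>a interchange M b b' c c')) \<cdot>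
      ?lhs
    = (interchange M a a' (b \<otimes> c) (b' \<otimes> c') \<cdot> (Ide M (a \<otimes> a') \<otimes>\<^sub>a interchange M b b' c c')) \<cdot>
      ?rhs"
    by simp
qed simp_all

lemma is_monoid_map_asc:
  assumes [simp]: "is_monoid M x" "is_monoid M y" "is_monoid M z"
  shows "is_monoid_map M (tensor_mnd M (tensor_mnd M x y) z) (asc M (Car x) (Car y) (Car z))
    (tensor_mnd M x (tensor_mnd M y z))"
proof (rule is_monoid_mapI)
  let ?s = "tensor_mnd M (tensor_mnd M x y) z" and ?t = "tensor_mnd M x (tensor_mnd M y z)"
  define a b c where "a = Car x" and "b = Car y" and "c = Car z"
  have [simp]: "a \<in> Obj M" "b \<in> Obj M" "c \<in> Obj M" by (simp_all add: a_def b_def c_def)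
  note [simp] = a_def [symmetric] b_def [symmetric] c_def [symmetric]
  have "asc M a b c \<cdot> Mul ?s = asc M a b c \<cdot> (((Mul x \<otimes>\<^sub>a Mul y) \<otimes>\<^sub>a Mul z) \<cdot>
      ((interchange M a b a b \<otimes>\<^sub>a Ide M (c \<otimes> c)) \<cdot> interchange M (a \<otimes> b) c (a \<otimes> b) c))"
    by simp
  also have "\<dots> = (Mul x \<otimes>\<^sub>a (Mul y \<otimes>\<^sub>a Mul z)) \<cdot> (asc M (a \<otimes> a) (b \<otimes> b) (c \<otimes> c) \<cdot>
      ((interchange M a b a b \<otimes>\<^sub>a Ide M (c \<otimes> c)) \<cdot> interchange M (a \<otimes> b) c (a \<otimes> b) c))"
    by (subst asc_nat_Comp) simp_all
  also have "\<dots> = (Mul x \<otimes>\<^sub>a (Mul y \<otimes>\<^sub>a Mul z)) \<cdot> ((Ide M (a \<otimes> a) \<otimes>\<^sub>a interchange M b c b c) \<cdot>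
      (interchange M a (b \<otimes> c) a (b \<otimes> c) \<cdot> (asc M a b c \<otimes>\<^sub>a asc M a b c)))"
    by (subst asc_interchange_interchange) simp_all
  finally show "asc M (Car x) (Car y) (Car z) \<cdot> Mul ?s
      = Mul ?t \<cdot> (asc M (Car x) (Car y) (Car z) \<otimes>\<^sub>a asc M (Car x) (Car y) (Car z))"
    by simp
  have *: "asc M \<one> \<one> \<one> \<cdot> (arr_inv M (lun M \<one>) \<otimes>\<^sub>a Ide M \<one>) = Ide M \<one> \<otimes>\<^sub>a arr_inv M (lun M \<one>)"
    by (rule iso_mono [of "Ide M \<one> \<otimes>\<^sub>a lun M \<one>"]) (simp_all add: triangle_Comp lun_uno [symmetric])
  have "asc M a b c \<cdot> Unt ?s = asc M a b c \<cdot> (((Unt x \<otimes>\<^sub>a Unt y) \<otimes>\<^sub>a Unt z) \<cdot> ((arr_inv M (lun M \<one>) \<otimes>\<^sub>a Ide M \<one>) \<cdot> arr_inv M (lun M \<one>)))"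
    by simp
  also have "\<dots> = (Unt x \<otimes>\<^sub>a (Unt y \<otimes>\<^sub>a Unt z)) \<cdot> (asc M \<one> \<one> \<one> \<cdot> ((arr_inv M (lun M \<one>) \<otimes>\<^sub>a Ide M \<one>) \<cdot> arr_inv M (lun M \<one>)))"
    by (subst asc_nat_Comp) simp_all
  also have "\<dots> = (Unt x \<otimes>\<^sub>a (Unt y \<otimes>\<^sub>a Unt z)) \<cdot> ((Ide M \<one> \<otimes>\<^sub>a arr_inv M (lun M \<one>)) \<cdot> arr_inv M (lun M \<one>))"
    by (subst Comp_reduce [OF *]) simp_all
  finally show "asc M (Car x) (Car y) (Car z) \<cdot> Unt ?s = Unt ?t"
    by simp
qed simp_all

text \<open>The unit laws of the interchange, with the interchange moved to the other side, say in the same way that the unit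
  isomorphisms are maps of monoids.\<close>

lemma is_monoid_map_lun:
  assumes [simp]: "is_monoid M x"
  shows "is_monoid_map M (tensor_mnd M (unit_mnd M) x) (lun M (Car x)) x"
proof (rule is_monoid_mapI)
  define a where "a = Car x"
  have [simp]: "a \<in> Obj M" by (simp add: a_def)
  note [simp] = a_def [symmetric]
  have "lun M a \<otimes>\<^sub>a lun M a = (lun M a \<otimes>\<^sub>a lun M a) \<cdot> (interchange M \<one> \<one> a a \<cdot> interchange M \<one> a \<one> a)"
    by (simp add: interchange_interchange)
  also have "\<dots> = lun M (a \<otimes> a) \<cdot> ((lun M \<one> \<otimes>\<^sub>a Ide M (a \<otimes> a)) \<cdot> interchange M \<one> a \<one> a)"
    by (subst Comp_reduce [OF lun_interchange]) simp_all
  finally have *: "lun M a \<otimes>\<^sub>a lun M a = \<dots>" .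
  have "lun M a \<cdot> Mul (tensor_mnd M (unit_mnd M) x)
    = lun M a \<cdot> ((Ide M \<one> \<otimes>\<^sub>a Mul x) \<cdot> ((lun M \<one> \<otimes>\<^sub>a Ide M (a \<otimes> a)) \<cdot> interchange M \<one> a \<one> a))"
    by simp
  also have "\<dots> = Mul x \<cdot> (lun M a \<otimes>\<^sub>a lun M a)"
    unfolding * by (subst Comp_reduce [OF lun_nat [OF _ refl]]) simp_all
  finally show "lun M (Car x) \<cdot> Mul (tensor_mnd M (unit_mnd M) x) = Mul x \<cdot> (lun M (Car x) \<otimes>\<^sub>a lun M (Car x))"
    by simp
  show "lun M (Car x) \<cdot> Unt (tensor_mnd M (unit_mnd M) x) = Unt x"
    by (simp add: Comp_reduce [OF lun_nat])
qed simp_all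

lemma is_monoid_map_run:
  assumes [simp]: "is_monoid M x"
  shows "is_monoid_map M (tensor_mnd M x (unit_mnd M)) (run M (Car x)) x"
proof (rule is_monoid_mapI)
  define a where "a = Car x"
  have [simp]: "a \<in> Obj M" by (simp add: a_def)
  note [simp] = a_def [symmetric]
  have "run M a \<otimes>\<^sub>a run M a = (run M a \<otimes>\<^sub>a run M a) \<cdot> (interchange M a a \<one> \<one> \<cdot> interchange M a \<one> a \<one>)"
    by (simp add: interchange_interchange)
  also have "\<dots> = run M (a \<otimes> a) \<cdot> ((Ide M (a \<otimes> a) \<otimes>\<^sub>a lun M \<one>) \<cdot> interchange M a \<one> a \<one>)"
    by (subst Comp_reduce [OF run_interchange]) simp_all
  finally have *: "run M a \<otimes>\<^sub>a run M a = \<dots>" .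
  have "run M a \<cdot> Mul (tensor_mnd M x (unit_mnd M))
    = run M a \<cdot> ((Mul x \<otimes>\<^sub>a Ide M \<one>) \<cdot> ((Ide M (a \<otimes> a) \<otimes>\<^sub>a lun M \<one>) \<cdot> interchange M a \<one> a \<one>))"
    by simp
  also have "\<dots> = Mul x \<cdot> (run M a \<otimes>\<^sub>a run M a)"
    unfolding * by (subst Comp_reduce [OF run_nat [OF _ refl]]) simp_all
  finally show "run M (Car x) \<cdot> Mul (tensor_mnd M x (unit_mnd M)) = Mul x \<cdot> (run M (Car x) \<otimes>\<^sub>a run M (Car x))"
    by simp
  show "run M (Car x) \<cdot> Unt (tensor_mnd M x (unit_mnd M)) = Unt x"
    by (simp add: Comp_reduce [OF run_nat] lun_uno)
qed simp_all

lemma category_Mon: "category (Mon M)"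
  by unfold_locales
    (auto simp: hom_def is_monoid_map_Ide is_monoid_map_Comp is_monoid_map_arr elim!: Mon_ArrE)

end

sublocale symmetric_monoidal_category \<subseteq> Mon: category "Mon M"
  by (rule category_Mon)

context symmetric_monoidal_category
begin

lemma is_iso_Mon:
  assumes [simp]: "is_monoid M x" "is_monoid M y" and f: "is_monoid_map M x f y" and [simp]: "is_iso M f"
  shows "is_iso (Mon M) (x, f, y)"
  using is_monoid_map_arr_inv [OF assms] f
  by (intro Mon.is_isoI [of _ "(y, arr_inv M f, x)"]) (simp_all add: is_monoid_map_arr [OF f])

lemma monoidal_category_Mon: "monoidal_category (Mon M)"
  by unfold_locales
    (auto simp: is_monoid_map_tar is_monoid_map_arr is_monoid_map_asc is_monoid_map_lun is_monoid_map_run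
      is_iso_Mon asc_nat lun_nat run_nat pentagon triangle elim!: Mon_ArrE)

end

sublocale symmetric_monoidal_category \<subseteq> Mon: monoidal_category "Mon M"
  by (rule monoidal_category_Mon)

section \<open>Tensor powers and iterated products\<close>

text \<open>The product in the monoid \<open>x\<close> of \<open>n\<close> copies of \<open>f\<close>, an arrow out of \<open>X\<^sup>n\<close>.  Tensor power of \<open>f\<close> and iterated
  multiplication are interleaved in one recursion, parallel to those of \<open>tpow\<close>, \<open>colax_iter\<close> and
  \<open>tpow_shuffle\<close>, so that comparisons with them are inductions of one step each.\<close>

fun mprod :: "('o, 'a, 'm) moncat_scheme \<Rightarrow> ('o, 'a) mnd \<Rightarrow> 'a \<Rightarrow> nat \<Rightarrow> 'a" where
  "mprod M x f 0 = Unt x"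
| "mprod M x f (Suc n) = Mul x \<cdot>\<^bsub>M\<^esub> (mprod M x f n \<otimes>\<^sub>a\<^bsub>M\<^esub> f)"

context monoidal_category
begin

lemma tpow_Obj [simp]: "X \<in> Obj M \<Longrightarrow> tpow M X n \<in> Obj M"
  by (induction n) simp_all

lemma tpow_concat_arr [unfolded in_hom, simp]:
  "X \<in> Obj M \<Longrightarrow> tpow_concat M X m n \<in> hom M (tpow M X m \<otimes> tpow M X n) (tpow M X (m + n))"
  by (induction n) simp_all

lemma asc_inv_nat:
  assumes [simp]: "f \<in> Arr M" "g \<in> Arr M" "h \<in> Arr M"
    and "Cod M f = X'" "Cod M g = Y'" "Cod M h = Z'"
  shows "arr_inv M (asc M X' Y' Z') \<cdot> (f \<otimes>\<^sub>a (g \<otimes>\<^sub>a h))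
    = ((f \<otimes>\<^sub>a g) \<otimes>\<^sub>a h) \<cdot> arr_inv M (asc M (Dom M f) (Dom M g) (Dom M h))" (is "?lhs = ?rhs")
proof (rule iso_epi [of "asc M (Dom M f) (Dom M g) (Dom M h)"])
  have [simp]: "X' = Cod M f" "Y' = Cod M g" "Z' = Cod M h" using assms by simp_all
  have "arr_inv M (asc M X' Y' Z') \<cdot> ((f \<otimes>\<^sub>a (g \<otimes>\<^sub>a h)) \<cdot> asc M (Dom M f) (Dom M g) (Dom M h))
    = arr_inv M (asc M X' Y' Z') \<cdot> (asc M X' Y' Z' \<cdot> ((f \<otimes>\<^sub>a g) \<otimes>\<^sub>a h))"
    by (simp only: asc_nat assms)
  then show "?lhs \<cdot> asc M (Dom M f) (Dom M g) (Dom M h)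
    = ?rhs \<cdot> asc M (Dom M f) (Dom M g) (Dom M h)"
    by simp
qed (use assms in auto)

lemma asc_inv_nat_Ide:
  "\<lbrakk>f \<in> Arr M; Cod M f = X'; Y \<in> Obj M; Z \<in> Obj M\<rbrakk>
    \<Longrightarrow> arr_inv M (asc M X' Y Z) \<cdot> (f \<otimes>\<^sub>a Ide M (Y \<otimes> Z))
      = ((f \<otimes>\<^sub>a Ide M Y) \<otimes>\<^sub>a Ide M Z) \<cdot> arr_inv M (asc M (Dom M f) Y Z)"
  using asc_inv_nat [of f "Ide M Y" "Ide M Z" X' Y Z] by simp

lemma pentagon_inv:
  assumes [simp]: "W \<in> Obj M" "X \<in> Obj M" "Y \<in> Obj M" "Z \<in> Obj M"
  shows "(asc M W X Y \<otimes>\<^sub>a Ide M Z) \<cdot> arr_inv M (asc M (W \<otimes> X) Y Z)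
    = arr_inv M (asc M W (X \<otimes> Y) Z) \<cdot> ((Ide M W \<otimes>\<^sub>a arr_inv M (asc M X Y Z)) \<cdot> asc M W X (Y \<otimes> Z))" (is "?lhs = ?rhs")
proof (rule iso_epi [of "asc M (W \<otimes> X) Y Z"])
  have "arr_inv M (asc M W (X \<otimes> Y) Z) \<cdot> ((Ide M W \<otimes>\<^sub>a arr_inv M (asc M X Y Z)) \<cdot> (asc M W X (Y \<otimes> Z) \<cdot> asc M (W \<otimes> X) Y Z))
    = arr_inv M (asc M W (X \<otimes> Y) Z) \<cdot> ((Ide M W \<otimes>\<^sub>a arr_inv M (asc M X Y Z)) \<cdot>
      ((Ide M W \<otimes>\<^sub>a asc M X Y Z) \<cdot> (asc M W (X \<otimes> Y) Z \<cdot> (asc M W X Y \<otimes>\<^sub>a Ide M Z))))"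
    by (simp only: pentagon assms)
  also have "\<dots> = asc M W X Y \<otimes>\<^sub>a Ide M Z"
    by simp
  finally show "?lhs \<cdot> asc M (W \<otimes> X) Y Z
    = ?rhs \<cdot> asc M (W \<otimes> X) Y Z"
    by simp
qed simp_all

lemma tpow_concat_0_left:
  assumes [simp]: "X \<in> Obj M"
  shows "tpow_concat M X 0 n = lun M (tpow M X n)"
proof (induction n)
  case 0
  then show ?case by (simp add: lun_uno)
next
  case (Suc n)
  have "tpow_concat M X 0 (Suc n)
    = (lun M (tpow M X n \<otimes> X) \<cdot> asc M \<one> (tpow M X n) X) \<cdot> arr_inv M (asc M \<one> (tpow M X n) X)"
    by (simp only: lun_tob assms tpow_Obj) (simp add: Suc)
  then show ?case by simp
qed

text \<open>Induction on the last exponent, with the pentagon in the induction step.\<close>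

lemma tpow_concat_assoc:
  assumes [simp]: "X \<in> Obj M"
  shows "tpow_concat M X (m + n) k \<cdot> (tpow_concat M X m n \<otimes>\<^sub>a Ide M (tpow M X k))
    = tpow_concat M X m (n + k) \<cdot> ((Ide M (tpow M X m) \<otimes>\<^sub>a tpow_concat M X n k) \<cdot>
      asc M (tpow M X m) (tpow M X n) (tpow M X k))"
proof (induction k)
  case 0
  then show ?case by (simp add: run_nat run_tob)
next
  case (Suc k)
  define A B D where "A = tpow M X m" and "B = tpow M X n" and "D = tpow M X k"
  have [simp]: "A \<in> Obj M" "B \<in> Obj M" "D \<in> Obj M" by (simp_all add: A_def B_def D_def)
  have [simp]: "tpow M X m = A" "tpow M X n = B" "tpow M X k = D"
    by (simp_all add: A_def B_def D_def)
  have "tpow_concat M X (m + n) (Suc k) \<cdot> (tpow_concat M X m n \<otimes>\<^sub>a Ide M (tpow M X (Suc k)))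
    = ((tpow_concat M X (m + n) k \<cdot> (tpow_concat M X m n \<otimes>\<^sub>a Ide M D)) \<otimes>\<^sub>a Ide M X) \<cdot> arr_inv M (asc M (A \<otimes> B) D X)"
    by (simp add: asc_inv_nat_Ide)
  also have "\<dots> = ((tpow_concat M X m (n + k) \<cdot> (Ide M A \<otimes>\<^sub>a tpow_concat M X n k)) \<otimes>\<^sub>a Ide M X) \<cdot>
      ((asc M A B D \<otimes>\<^sub>a Ide M X) \<cdot> arr_inv M (asc M (A \<otimes> B) D X))"
    using Suc by simp
  also have "\<dots> = (tpow_concat M X m (n + k) \<otimes>\<^sub>a Ide M X) \<cdot> (((Ide M A \<otimes>\<^sub>a tpow_concat M X n k) \<otimes>\<^sub>a Ide M X) \<cdot>
      (arr_inv M (asc M A (B \<otimes> D) X) \<cdot> ((Ide M A \<otimes>\<^sub>a arr_inv M (asc M B D X)) \<cdot> asc M A B (D \<otimes> X))))"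
    by (simp add: pentagon_inv)
  also have "\<dots> = (tpow_concat M X m (n + k) \<otimes>\<^sub>a Ide M X) \<cdot> (arr_inv M (asc M A (tpow M X (n + k)) X) \<cdot>
      ((Ide M A \<otimes>\<^sub>a (tpow_concat M X n k \<otimes>\<^sub>a Ide M X)) \<cdot> ((Ide M A \<otimes>\<^sub>a arr_inv M (asc M B D X)) \<cdot> asc M A B (D \<otimes> X))))"
    by (subst Comp_reduce [OF asc_inv_nat, of "Ide M A" "tpow_concat M X n k" "Ide M X"]) simp_all
  finally show ?case by simp
qed

lemma mprod_arr [unfolded in_hom, simp]:
  "\<lbrakk>is_monoid M x; f \<in> Arr M; Cod M f = Car x\<rbrakk> \<Longrightarrow> mprod M x f n \<in> hom M (tpow M (Dom M f) n) (Car x)"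
  by (induction n) simp_all

lemma mprod_map:
  assumes [simp]: "is_monoid M x" "is_monoid M y" and h: "is_monoid_map M x h y"
    and [simp]: "f \<in> Arr M" and f: "Cod M f = Car x"
  shows "h \<cdot> mprod M x f n = mprod M y (h \<cdot> f) n"
proof -
  note [simp] = is_monoid_map_arr [OF h] f
  show ?thesis
    by (induction n) (simp_all add: is_monoid_map_Unt [OF h] Comp_reduce [OF is_monoid_map_Mul [OF h]])
qed

text \<open>Associativity of the monoid, iterated: a product of \<open>m + n\<close> factors may be bracketed into one of \<open>m\<close> and one
  of \<open>n\<close>.\<close>

lemma mprod_concat:
  assumes [simp]: "is_monoid M x" "f \<in> Arr M" and f: "Cod M f = Car x"
  shows "Mul x \<cdot> (mprod M x f m \<otimes>\<^sub>a mprod M x f n) = mprod M x f (m + n) \<cdot> tpow_concat M (Dom M f) m n"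
proof (induction n)
  note [simp] = f
  case 0
  have "Mul x \<cdot> (mprod M x f m \<otimes>\<^sub>a mprod M x f 0)
    = Mul x \<cdot> ((Ide M (Car x) \<otimes>\<^sub>a Unt x) \<cdot> (mprod M x f m \<otimes>\<^sub>a Ide M \<one>))"
    by simp
  also have "\<dots> = run M (Car x) \<cdot> (mprod M x f m \<otimes>\<^sub>a Ide M \<one>)"
    by (subst Comp_reduce [OF Mul_unit_right]) simp_all
  finally show ?case by (simp add: run_nat)
next
  note [simp] = f
  case (Suc n)
  let ?X = "Dom M f" and ?a = "Car x"
  have "Mul x \<cdot> (mprod M x f m \<otimes>\<^sub>a mprod M x f (Suc n))
    = (Mul x \<cdot> ((Ide M ?a \<otimes>\<^sub>a Mul x) \<cdot> asc M ?a ?a ?a)) \<cdot>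
      (arr_inv M (asc M ?a ?a ?a) \<cdot> (mprod M x f m \<otimes>\<^sub>a (mprod M x f n \<otimes>\<^sub>a f)))"
    by simp
  also have "\<dots> = (Mul x \<cdot> (Mul x \<otimes>\<^sub>a Ide M ?a)) \<cdot>
      (((mprod M x f m \<otimes>\<^sub>a mprod M x f n) \<otimes>\<^sub>a f) \<cdot> arr_inv M (asc M (tpow M ?X m) (tpow M ?X n) ?X))"
    by (simp only: Mul_assoc asc_inv_nat assms mprod_arr)
  also have "\<dots> = Mul x \<cdot> (((Mul x \<cdot> (mprod M x f m \<otimes>\<^sub>a mprod M x f n)) \<otimes>\<^sub>a f) \<cdot>
      arr_inv M (asc M (tpow M ?X m) (tpow M ?X n) ?X))"
    by simp
  also have "\<dots> = mprod M x f (m + Suc n) \<cdot> tpow_concat M ?X m (Suc n)"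
    unfolding Suc by simp
  finally show ?case .
qed

end

context symmetric_monoidal_category
begin

lemma tpow_shuffle_arr [unfolded in_hom, simp]:
  "\<lbrakk>A \<in> Obj M; B \<in> Obj M\<rbrakk> \<Longrightarrow> tpow_shuffle M A B n \<in> hom M (tpow M (A \<otimes> B) n) (tpow M A n \<otimes> tpow M B n)"
  by (induction n) simp_all

text \<open>The multiplication of a tensor product of monoids starts with an interchange, and the shuffle is made
  of the same interchanges.\<close>

lemma mprod_tensor:
  assumes [simp]: "is_monoid M x" "is_monoid M y" "f \<in> Arr M" "g \<in> Arr M"
    and f: "Cod M f = Car x" and g: "Cod M g = Car y"
  shows "mprod M (tensor_mnd M x y) (f \<otimes>\<^sub>a g) n
    = (mprod M x f n \<otimes>\<^sub>a mprod M y g n) \<cdot> tpow_shuffle M (Dom M f) (Dom M g) n"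
proof (induction n)
  note [simp] = f g
  case 0
  then show ?case by simp
next
  note [simp] = f g
  case (Suc n)
  let ?s = "tpow_shuffle M (Dom M f) (Dom M g) n"
  have "mprod M (tensor_mnd M x y) (f \<otimes>\<^sub>a g) (Suc n)
    = (Mul x \<otimes>\<^sub>a Mul y) \<cdot> (interchange M (Car x) (Car y) (Car x) (Car y) \<cdot>
      (((mprod M x f n \<otimes>\<^sub>a mprod M y g n) \<otimes>\<^sub>a (f \<otimes>\<^sub>a g)) \<cdot> (?s \<otimes>\<^sub>a Ide M (Dom M f \<otimes> Dom M g))))"
    by (simp add: Suc)
  also have "\<dots> = (mprod M x f (Suc n) \<otimes>\<^sub>a mprod M y g (Suc n)) \<cdot> tpow_shuffle M (Dom M f) (Dom M g) (Suc n)"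
    by (subst Comp_reduce [OF interchange_nat]) simp_all
  finally show ?case .
qed

end

section \<open>Free monoids\<close>

context category
begin

lemma coproduct_sequence:
  assumes "\<And>n. X n \<in> Obj K"
  shows "is_coproduct K X P \<iota> \<longleftrightarrow> P \<in> Obj K \<and>
    (\<forall>n. \<iota> n \<in> Arr K \<and> Dom K (\<iota> n) = X n \<and> Cod K (\<iota> n) = P) \<and>
    (\<forall>Q \<kappa>. Q \<in> Obj K \<and> (\<forall>n. \<kappa> n \<in> Arr K \<and> Dom K (\<kappa> n) = X n \<and> Cod K (\<kappa> n) = Q) \<longrightarrow>
      (\<exists>!h. h \<in> hom K P Q \<and> (\<forall>n. h \<cdot> \<iota> n = \<kappa> n)))"
proof -
  have c: "cocone nat_discrete K (sequence_diagram K X) Q \<kappa> \<longleftrightarrow>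
      Q \<in> Obj K \<and> (\<forall>n. \<kappa> n \<in> Arr K \<and> Dom K (\<kappa> n) = X n \<and> Cod K (\<kappa> n) = Q)" for Q \<kappa>
    unfolding cocone_def by (auto simp: nat_discrete_def sequence_diagram_def)
  have [simp]: "Obj nat_discrete = UNIV" by (simp add: nat_discrete_def)
  show ?thesis
    unfolding colimit_cocone_def c by simp
qed

lemma coproduct_ex1:
  assumes "is_coproduct K X P \<iota>" "\<And>n. X n \<in> Obj K" "Q \<in> Obj K"
    and "\<And>n. \<kappa> n \<in> Arr K" "\<And>n. Dom K (\<kappa> n) = X n" "\<And>n. Cod K (\<kappa> n) = Q"
  shows "\<exists>!h. h \<in> hom K P Q \<and> (\<forall>n. h \<cdot> \<iota> n = \<kappa> n)"
proof -
  have "\<forall>Q \<kappa>. Q \<in> Obj K \<and> (\<forall>n. \<kappa> n \<in> Arr K \<and> Dom K (\<kappa> n) = X n \<and> Cod K (\<kappa> n) = Q) \<longrightarrow>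
      (\<exists>!h. h \<in> hom K P Q \<and> (\<forall>n. h \<cdot> \<iota> n = \<kappa> n))"
    using coproduct_sequence [where X = X, OF assms(2), THEN iffD1, OF assms(1)] by (elim conjE)
  then show ?thesis
    using assms(3-6) by (elim allE impE) (intro conjI allI; assumption)
qed

lemma coproduct_desc:
  assumes "is_coproduct K X P \<iota>" "\<And>n. X n \<in> Obj K" "Q \<in> Obj K"
    and "\<And>n. \<kappa> n \<in> Arr K" "\<And>n. Dom K (\<kappa> n) = X n" "\<And>n. Cod K (\<kappa> n) = Q"
  obtains h where "h \<in> Arr K" "Dom K h = P" "Cod K h = Q" "\<And>n. h \<cdot> \<iota> n = \<kappa> n"
  using coproduct_ex1 [OF assms] by (metis in_hom)

lemma coproduct_ext:
  assumes "is_coproduct K X P \<iota>" "\<And>n. X n \<in> Obj K"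
    and *: "f \<in> Arr K" "g \<in> Arr K" "Dom K f = P" "Dom K g = P" "Cod K f = Cod K g"
    and "\<And>n. f \<cdot> \<iota> n = g \<cdot> \<iota> n"
  shows "f = g"
proof -
  have \<iota>: "\<iota> n \<in> Arr K" "Dom K (\<iota> n) = X n" "Cod K (\<iota> n) = P" for n
    using coproduct_sequence [where X = X, OF assms(2), THEN iffD1, OF assms(1)] by (elim conjE; simp)+
  have "\<exists>!h. h \<in> hom K P (Cod K g) \<and> (\<forall>n. h \<cdot> \<iota> n = g \<cdot> \<iota> n)"
    by (rule coproduct_ex1 [OF assms(1,2)]) (simp_all add: \<iota> *)
  moreover have "f \<in> hom K P (Cod K g) \<and> (\<forall>n. f \<cdot> \<iota> n = g \<cdot> \<iota> n)"
    and "g \<in> hom K P (Cod K g) \<and> (\<forall>n. g \<cdot> \<iota> n = g \<cdot> \<iota> n)"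
    using * assms(8) by simp_all
  ultimately show ?thesis by blast
qed

end

locale free_monoids = symmetric_monoidal_category M
  for M :: "('o, 'a, 'm) smcat_scheme" (structure) +
  assumes power_coproducts: "X \<in> Obj M \<Longrightarrow> \<exists>P \<iota>. is_coproduct M (tpow M X) P \<iota>"
    and tensor_power_coproducts: "\<lbrakk>X \<in> Obj M; a \<in> Obj M\<rbrakk>
      \<Longrightarrow> preserves_colimits nat_discrete M M (tensor_left_ftr M a) (sequence_diagram M (tpow M X)) \<and>
          preserves_colimits nat_discrete M M (tensor_right_ftr M a) (sequence_diagram M (tpow M X))"
begin

lemma TC_coproduct:
  assumes "X \<in> Obj M"
  shows "is_coproduct M (tpow M X) (TC M X) (tinj M X)"
proof -
  obtain p where "case p of (P, \<iota>) \<Rightarrow> is_coproduct M (tpow M X) P \<iota>"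
    using power_coproducts [OF assms] by auto
  then have "case power_coproduct M X of (P, \<iota>) \<Rightarrow> is_coproduct M (tpow M X) P \<iota>"
    unfolding power_coproduct_def by (rule someI)
  then show ?thesis
    by (simp add: tinj_def free_monoid_def Let_def case_prod_unfold)
qed

lemma TC_tensor_coproduct:
  assumes [simp]: "X \<in> Obj M" "a \<in> Obj M"
  shows "is_coproduct M (\<lambda>n. a \<otimes> tpow M X n) (a \<otimes> TC M X) (\<lambda>n. Ide M a \<otimes>\<^sub>a tinj M X n)"
    and "is_coproduct M (\<lambda>n. tpow M X n \<otimes> a) (TC M X \<otimes> a) (\<lambda>n. tinj M X n \<otimes>\<^sub>a Ide M a)"
proof -
  have "comp_ftr (tensor_left_ftr M a) (sequence_diagram M (tpow M X)) = sequence_diagram M (\<lambda>n. a \<otimes> tpow M X n)"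
    "comp_ftr (tensor_right_ftr M a) (sequence_diagram M (tpow M X)) = sequence_diagram M (\<lambda>n. tpow M X n \<otimes> a)"
    by (simp_all add: comp_ftr_def tensor_left_ftr_def tensor_right_ftr_def sequence_diagram_def)
  then show "is_coproduct M (\<lambda>n. a \<otimes> tpow M X n) (a \<otimes> TC M X) (\<lambda>n. Ide M a \<otimes>\<^sub>a tinj M X n)"
    and "is_coproduct M (\<lambda>n. tpow M X n \<otimes> a) (TC M X \<otimes> a) (\<lambda>n. tinj M X n \<otimes>\<^sub>a Ide M a)"
    using tensor_power_coproducts [OF assms] TC_coproduct [OF assms(1)]
    unfolding preserves_colimits_def
    by (auto simp: tensor_left_ftr_def tensor_right_ftr_def)
qed

lemma tinj_arr [simp]:
  assumes [simp]: "X \<in> Obj M"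
  shows "TC M X \<in> Obj M" "tinj M X n \<in> Arr M" "Dom M (tinj M X n) = tpow M X n" "Cod M (tinj M X n) = TC M X"
  using TC_coproduct [OF assms] by (simp_all add: coproduct_sequence)

lemmas TC_desc = coproduct_desc [OF TC_coproduct]
  and TC_tensor_left_desc = coproduct_desc [OF TC_tensor_coproduct(1)]
  and TC_tensor_right_desc = coproduct_desc [OF TC_tensor_coproduct(2)]
  and TC_ext = coproduct_ext [OF TC_coproduct]
  and TC_tensor_left_ext = coproduct_ext [OF TC_tensor_coproduct(1)]
  and TC_tensor_right_ext = coproduct_ext [OF TC_tensor_coproduct(2)]

text \<open>Applied in one variable after the other, preservation of coproducts shows that arrows out of \<open>T X \<otimes> T Y\<close>, and
  likewise out of a threefold product, are determined on tensor powers.\<close>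

lemma TC_TC_ext:
  assumes [simp]: "X \<in> Obj M" "Y \<in> Obj M" "f \<in> Arr M" "g \<in> Arr M"
    and [simp]: "Dom M f = TC M X \<otimes> TC M Y" "Dom M g = TC M X \<otimes> TC M Y" and c: "Cod M f = Cod M g"
    and eq: "\<And>m n. f \<cdot> (tinj M X m \<otimes>\<^sub>a tinj M Y n) = g \<cdot> (tinj M X m \<otimes>\<^sub>a tinj M Y n)"
  shows "f = g"
proof (rule TC_tensor_left_ext [of Y "TC M X" f g])
  fix n
  show "f \<cdot> (Ide M (TC M X) \<otimes>\<^sub>a tinj M Y n) = g \<cdot> (Ide M (TC M X) \<otimes>\<^sub>a tinj M Y n)" (is "?lhs = ?rhs")
  proof (rule TC_tensor_right_ext [of X "tpow M Y n"])
    fix m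
    show "?lhs \<cdot> (tinj M X m \<otimes>\<^sub>a Ide M (tpow M Y n))
      = ?rhs \<cdot> (tinj M X m \<otimes>\<^sub>a Ide M (tpow M Y n))"
      by (simp add: eq)
  qed (simp_all add: c)
qed (simp_all add: c)

lemma TC_tensor_tensor_ext:
  assumes [simp]: "X \<in> Obj M" "a \<in> Obj M" "b \<in> Obj M" "f \<in> Arr M" "g \<in> Arr M"
    and [simp]: "Dom M f = (TC M X \<otimes> a) \<otimes> b" "Dom M g = (TC M X \<otimes> a) \<otimes> b" and c: "Cod M f = Cod M g"
    and eq: "\<And>n. f \<cdot> ((tinj M X n \<otimes>\<^sub>a Ide M a) \<otimes>\<^sub>a Ide M b) = g \<cdot> ((tinj M X n \<otimes>\<^sub>a Ide M a) \<otimes>\<^sub>a Ide M b)"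
  shows "f = g"
proof (rule iso_epi [of "arr_inv M (asc M (TC M X) a b)"])
  show "is_iso M (arr_inv M (asc M (TC M X) a b))"
    by (rule is_isoI [of _ "asc M (TC M X) a b"]) simp_all
  show "f \<cdot> arr_inv M (asc M (TC M X) a b) = g \<cdot> arr_inv M (asc M (TC M X) a b)" (is "?lhs = ?rhs")
  proof (rule TC_tensor_right_ext [of X "a \<otimes> b"])
    fix n
    have *: "h \<cdot> (arr_inv M (asc M (TC M X) a b) \<cdot> (tinj M X n \<otimes>\<^sub>a Ide M (a \<otimes> b)))
      = (h \<cdot> ((tinj M X n \<otimes>\<^sub>a Ide M a) \<otimes>\<^sub>a Ide M b)) \<cdot> arr_inv M (asc M (tpow M X n) a b)"
      if "h \<in> Arr M" "Dom M h = (TC M X \<otimes> a) \<otimes> b" for h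
      using that by (simp add: asc_inv_nat_Ide)
    show "?lhs \<cdot> (tinj M X n \<otimes>\<^sub>a Ide M (a \<otimes> b))
      = ?rhs \<cdot> (tinj M X n \<otimes>\<^sub>a Ide M (a \<otimes> b))"
      using * [of f] * [of g] eq [of n] by simp
  qed (simp_all add: c)
qed (simp_all add: c)

lemma TC_TC_TC_ext:
  assumes [simp]: "X \<in> Obj M" "Y \<in> Obj M" "Z \<in> Obj M" "f \<in> Arr M" "g \<in> Arr M"
    and [simp]: "Dom M f = (TC M X \<otimes> TC M Y) \<otimes> TC M Z" "Dom M g = (TC M X \<otimes> TC M Y) \<otimes> TC M Z"
    and c: "Cod M f = Cod M g"
    and eq: "\<And>m n k. f \<cdot> ((tinj M X m \<otimes>\<^sub>a tinj M Y n) \<otimes>\<^sub>a tinj M Z k)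
      = g \<cdot> ((tinj M X m \<otimes>\<^sub>a tinj M Y n) \<otimes>\<^sub>a tinj M Z k)"
  shows "f = g"
proof (rule TC_tensor_left_ext [of Z "TC M X \<otimes> TC M Y" f g])
  fix k
  let ?i = "Ide M (TC M X \<otimes> TC M Y) \<otimes>\<^sub>a tinj M Z k"
  show "f \<cdot> ?i = g \<cdot> ?i"
  proof (rule TC_tensor_tensor_ext [of X "TC M Y" "tpow M Z k"])
    fix m
    let ?j = "(tinj M X m \<otimes>\<^sub>a Ide M (TC M Y)) \<otimes>\<^sub>a Ide M (tpow M Z k)"
    show "(f \<cdot> ?i) \<cdot> ?j = (g \<cdot> ?i) \<cdot> ?j" (is "?lhs = ?rhs")
    \<comment> \<open>Preservation of coproducts concerns an outer factor, so the symmetry brings the middle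
      factor to the front.\<close>
    proof (rule iso_epi [of "brd M (TC M Y) (tpow M X m) \<otimes>\<^sub>a Ide M (tpow M Z k)"])
      show "?lhs \<cdot> (brd M (TC M Y) (tpow M X m) \<otimes>\<^sub>a Ide M (tpow M Z k))
        = ?rhs \<cdot> (brd M (TC M Y) (tpow M X m) \<otimes>\<^sub>a Ide M (tpow M Z k))" (is "?l1 = ?r1")
      proof (rule TC_tensor_tensor_ext [of Y "tpow M X m" "tpow M Z k"])
        fix n
        have *: "(((h \<cdot> ?i) \<cdot> ?j) \<cdot> (brd M (TC M Y) (tpow M X m) \<otimes>\<^sub>a Ide M (tpow M Z k))) \<cdot>
            ((tinj M Y n \<otimes>\<^sub>a Ide M (tpow M X m)) \<otimes>\<^sub>a Ide M (tpow M Z k))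
          = (h \<cdot> ((tinj M X m \<otimes>\<^sub>a tinj M Y n) \<otimes>\<^sub>a tinj M Z k)) \<cdot>
            (brd M (tpow M Y n) (tpow M X m) \<otimes>\<^sub>a Ide M (tpow M Z k))"
          if "h \<in> Arr M" "Dom M h = (TC M X \<otimes> TC M Y) \<otimes> TC M Z" for h
          using that by (simp add: brd_nat)
        show "?l1 \<cdot>
            ((tinj M Y n \<otimes>\<^sub>a Ide M (tpow M X m)) \<otimes>\<^sub>a Ide M (tpow M Z k))
          = ?r1 \<cdot>
            ((tinj M Y n \<otimes>\<^sub>a Ide M (tpow M X m)) \<otimes>\<^sub>a Ide M (tpow M Z k))"
          by (simp only: * assms eq)
      qed (simp_all add: c)
    qed (simp_all add: c)
  qed (simp_all add: c)
qed (simp_all add: c)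

text \<open>Concatenation \<open>X\<^sup>m \<otimes> X\<^sup>n \<rightarrow> X\<^sup>m\<^sup>+\<^sup>n\<close> extends to \<open>T X \<otimes> T X\<close>: first over all \<open>m\<close> for fixed \<open>n\<close>, then over all
  \<open>n\<close>.\<close>

lemma free_Mul:
  assumes [simp]: "X \<in> Obj M"
  shows "Mul (free_monoid M X) \<in> Arr M" "Dom M (Mul (free_monoid M X)) = TC M X \<otimes> TC M X"
    "Cod M (Mul (free_monoid M X)) = TC M X"
    "Mul (free_monoid M X) \<cdot> (tinj M X m \<otimes>\<^sub>a tinj M X n) = tinj M X (m + n) \<cdot> tpow_concat M X m n"
proof -
  define P where "P = (\<lambda>\<mu>. \<mu> \<in> hom M (TC M X \<otimes> TC M X) (TC M X) \<and>
    (\<forall>m n. \<mu> \<cdot> (tinj M X m \<otimes>\<^sub>a tinj M X n) = tinj M X (m + n) \<cdot> tpow_concat M X m n))"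
  have "\<exists>h. h \<in> Arr M \<and> Dom M h = TC M X \<otimes> tpow M X n \<and> Cod M h = TC M X \<and>
      (\<forall>m. h \<cdot> (tinj M X m \<otimes>\<^sub>a Ide M (tpow M X n)) = tinj M X (m + n) \<cdot> tpow_concat M X m n)" for n
    by (rule TC_tensor_right_desc [of X "tpow M X n" "TC M X" "\<lambda>m. tinj M X (m + n) \<cdot> tpow_concat M X m n"])
      (simp_all, blast)
  then obtain h where h: "\<And>n. h n \<in> Arr M" "\<And>n. Dom M (h n) = TC M X \<otimes> tpow M X n" "\<And>n. Cod M (h n) = TC M X"
    "\<And>m n. h n \<cdot> (tinj M X m \<otimes>\<^sub>a Ide M (tpow M X n)) = tinj M X (m + n) \<cdot> tpow_concat M X m n"
    by metis
  obtain \<mu> where \<mu>: "\<mu> \<in> Arr M" "Dom M \<mu> = TC M X \<otimes> TC M X" "Cod M \<mu> = TC M X"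
    "\<And>n. \<mu> \<cdot> (Ide M (TC M X) \<otimes>\<^sub>a tinj M X n) = h n"
    by (rule TC_tensor_left_desc [of X "TC M X" "TC M X" h]) (simp_all add: h)
  have "\<mu> \<cdot> (tinj M X m \<otimes>\<^sub>a tinj M X n) = tinj M X (m + n) \<cdot> tpow_concat M X m n" for m n
  proof -
    have "\<mu> \<cdot> (tinj M X m \<otimes>\<^sub>a tinj M X n)
      = \<mu> \<cdot> ((Ide M (TC M X) \<otimes>\<^sub>a tinj M X n) \<cdot> (tinj M X m \<otimes>\<^sub>a Ide M (tpow M X n)))"
      by simp
    also have "\<dots> = tinj M X (m + n) \<cdot> tpow_concat M X m n"
      by (subst Comp_reduce [OF \<mu>(4)]) (simp_all add: \<mu> h)
    finally show ?thesis .
  qed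
  then have "P \<mu>" by (simp add: P_def \<mu>)
  moreover have "\<nu> = \<mu>" if "P \<nu>" for \<nu>
    by (rule TC_TC_ext [of X X]) (use that \<open>P \<mu>\<close> in \<open>simp_all add: P_def\<close>)
  ultimately have "P (THE \<mu>. P \<mu>)"
    by (rule theI)
  moreover have "Mul (free_monoid M X) = (THE \<mu>. P \<mu>)"
    by (simp add: free_monoid_def Let_def P_def)
  ultimately have "P (Mul (free_monoid M X))" by simp
  then show "Mul (free_monoid M X) \<in> Arr M" "Dom M (Mul (free_monoid M X)) = TC M X \<otimes> TC M X"
    "Cod M (Mul (free_monoid M X)) = TC M X"
    "Mul (free_monoid M X) \<cdot> (tinj M X m \<otimes>\<^sub>a tinj M X n) = tinj M X (m + n) \<cdot> tpow_concat M X m n"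
    by (simp_all add: P_def)
qed

lemma free_Unt: "Unt (free_monoid M X) = tinj M X 0"
  by (simp add: free_monoid_def Let_def)

lemma is_monoid_free_monoid [simp]:
  assumes [simp]: "X \<in> Obj M"
  shows "is_monoid M (free_monoid M X)"
proof -
  let ?\<mu> = "Mul (free_monoid M X)" and ?T = "TC M X"
  note [simp] = free_Mul(1-3)
  note [simp del] = tar_Comp_Comp
  have "?\<mu> \<cdot> (?\<mu> \<otimes>\<^sub>a Ide M ?T) = ?\<mu> \<cdot> ((Ide M ?T \<otimes>\<^sub>a ?\<mu>) \<cdot> asc M ?T ?T ?T)"
  proof (rule TC_TC_TC_ext [of X X X])
    fix m n k
    let ?i = "tinj M X"
    have "(?\<mu> \<cdot> (?\<mu> \<otimes>\<^sub>a Ide M ?T)) \<cdot> ((?i m \<otimes>\<^sub>a ?i n) \<otimes>\<^sub>a ?i k)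
      = ?\<mu> \<cdot> ((?i (m + n) \<otimes>\<^sub>a ?i k) \<cdot> (tpow_concat M X m n \<otimes>\<^sub>a Ide M (tpow M X k)))"
      by (simp add: free_Mul)
    also have "\<dots> = ?i (m + n + k) \<cdot> (tpow_concat M X (m + n) k \<cdot> (tpow_concat M X m n \<otimes>\<^sub>a Ide M (tpow M X k)))"
      by (subst Comp_reduce [OF free_Mul(4)]) simp_all
    also have "\<dots> = ?i (m + (n + k)) \<cdot> (tpow_concat M X m (n + k) \<cdot> ((Ide M (tpow M X m) \<otimes>\<^sub>a tpow_concat M X n k) \<cdot>
        asc M (tpow M X m) (tpow M X n) (tpow M X k)))"
      by (simp only: tpow_concat_assoc assms add.assoc)
    also have "\<dots> = ?\<mu> \<cdot> ((?i m \<otimes>\<^sub>a ?i (n + k)) \<cdot> ((Ide M (tpow M X m) \<otimes>\<^sub>a tpow_concat M X n k) \<cdot>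
        asc M (tpow M X m) (tpow M X n) (tpow M X k)))"
      by (subst Comp_reduce [OF free_Mul(4)]) (simp_all add: add.assoc)
    also have "\<dots> = ?\<mu> \<cdot> ((?i m \<otimes>\<^sub>a (?i (n + k) \<cdot> tpow_concat M X n k)) \<cdot> asc M (tpow M X m) (tpow M X n) (tpow M X k))"
      by (simp add: tar_Comp_Comp)
    also have "\<dots> = ?\<mu> \<cdot> ((Ide M ?T \<otimes>\<^sub>a ?\<mu>) \<cdot> ((?i m \<otimes>\<^sub>a (?i n \<otimes>\<^sub>a ?i k)) \<cdot> asc M (tpow M X m) (tpow M X n) (tpow M X k)))"
      by (simp add: free_Mul tar_Comp_Comp)
    also have "\<dots> = (?\<mu> \<cdot> ((Ide M ?T \<otimes>\<^sub>a ?\<mu>) \<cdot> asc M ?T ?T ?T)) \<cdot> ((?i m \<otimes>\<^sub>a ?i n) \<otimes>\<^sub>a ?i k)"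
      by (simp add: asc_nats)
    finally show "(?\<mu> \<cdot> (?\<mu> \<otimes>\<^sub>a Ide M ?T)) \<cdot> ((?i m \<otimes>\<^sub>a ?i n) \<otimes>\<^sub>a ?i k)
      = (?\<mu> \<cdot> ((Ide M ?T \<otimes>\<^sub>a ?\<mu>) \<cdot> asc M ?T ?T ?T)) \<cdot> ((?i m \<otimes>\<^sub>a ?i n) \<otimes>\<^sub>a ?i k)" .
  qed simp_all
  moreover have "?\<mu> \<cdot> (tinj M X 0 \<otimes>\<^sub>a Ide M ?T) = lun M ?T"
  proof (rule TC_tensor_left_ext [of X \<one>])
    fix n
    have "(?\<mu> \<cdot> (tinj M X 0 \<otimes>\<^sub>a Ide M ?T)) \<cdot> (Ide M \<one> \<otimes>\<^sub>a tinj M X n) = ?\<mu> \<cdot> (tinj M X 0 \<otimes>\<^sub>a tinj M X n)"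
      by simp
    then show "(?\<mu> \<cdot> (tinj M X 0 \<otimes>\<^sub>a Ide M ?T)) \<cdot> (Ide M \<one> \<otimes>\<^sub>a tinj M X n) = lun M ?T \<cdot> (Ide M \<one> \<otimes>\<^sub>a tinj M X n)"
      by (simp add: free_Mul tpow_concat_0_left lun_nat)
  qed simp_all
  moreover have "?\<mu> \<cdot> (Ide M ?T \<otimes>\<^sub>a tinj M X 0) = run M ?T"
  proof (rule TC_tensor_right_ext [of X \<one>])
    fix n
    have "(?\<mu> \<cdot> (Ide M ?T \<otimes>\<^sub>a tinj M X 0)) \<cdot> (tinj M X n \<otimes>\<^sub>a Ide M \<one>) = ?\<mu> \<cdot> (tinj M X n \<otimes>\<^sub>a tinj M X 0)"
      by simp
    then show "(?\<mu> \<cdot> (Ide M ?T \<otimes>\<^sub>a tinj M X 0)) \<cdot> (tinj M X n \<otimes>\<^sub>a Ide M \<one>) = run M ?T \<cdot> (tinj M X n \<otimes>\<^sub>a Ide M \<one>)"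
      by (simp add: free_Mul run_nat)
  qed simp_all
  ultimately show ?thesis
    unfolding is_monoid_def free_Unt by (intro conjI) simp_all
qed

lemma tgen_arr [unfolded in_hom, simp]: "X \<in> Obj M \<Longrightarrow> tgen M X \<in> hom M X (TC M X)"
  by (simp add: tgen_def)

text \<open>The inclusion of \<open>X\<^sup>n\<close> is the \<open>n\<close>-fold product of the generators; therefore monoid maps out of
  \<open>T X\<close> are determined by their restriction to \<open>X\<close>, as \<open>free_map_tinj\<close> makes explicit.\<close>

lemma mprod_tgen:
  assumes [simp]: "X \<in> Obj M"
  shows "mprod M (free_monoid M X) (tgen M X) n = tinj M X n"
proof (induction n)
  case 0
  then show ?case by (simp add: free_Unt)
next
  case (Suc n)
  have c: "tpow_concat M X n 1 = Ide M (tpow M X n) \<otimes>\<^sub>a lun M X"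
    by (rule iso_epi [of "asc M (tpow M X n) \<one> X"]) (simp_all add: triangle)
  have "mprod M (free_monoid M X) (tgen M X) (Suc n)
    = Mul (free_monoid M X) \<cdot> ((tinj M X n \<otimes>\<^sub>a tinj M X 1) \<cdot> (Ide M (tpow M X n) \<otimes>\<^sub>a arr_inv M (lun M X)))"
    using Suc by (simp add: tgen_def)
  also have "\<dots> = tinj M X (n + 1) \<cdot> (tpow_concat M X n 1 \<cdot> (Ide M (tpow M X n) \<otimes>\<^sub>a arr_inv M (lun M X)))"
    by (subst Comp_reduce [OF free_Mul(4)]) simp_all
  also have "\<dots> = tinj M X (Suc n)"
    unfolding c by simp
  finally show ?case .
qed

lemma mprod_1:
  assumes [simp]: "is_monoid M A" "f \<in> Arr M" and f: "Cod M f = Car A"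
  shows "mprod M A f 1 = f \<cdot> lun M (Dom M f)"
proof -
  have "Mul A \<cdot> (Unt A \<otimes>\<^sub>a f) = Mul A \<cdot> ((Unt A \<otimes>\<^sub>a Ide M (Car A)) \<cdot> (Ide M \<one> \<otimes>\<^sub>a f))"
    using f by simp
  also have "\<dots> = lun M (Car A) \<cdot> (Ide M \<one> \<otimes>\<^sub>a f)"
    using f by (subst Comp_reduce [OF Mul_unit_left]) simp_all
  finally show ?thesis
    using f by (simp add: lun_nat)
qed

lemma free_map_tinj:
  assumes [simp]: "X \<in> Obj M" "is_monoid M A" and h: "is_monoid_map M (free_monoid M X) h A"
  shows "h \<cdot> tinj M X n = mprod M A (h \<cdot> tgen M X) n"
  using mprod_map [OF _ _ h, of "tgen M X" n] by (simp add: mprod_tgen)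

lemma free_map_eq:
  assumes [simp]: "X \<in> Obj M" "is_monoid M A"
    and h: "is_monoid_map M (free_monoid M X) h A" and k: "is_monoid_map M (free_monoid M X) k A"
    and "h \<cdot> tgen M X = k \<cdot> tgen M X"
  shows "h = k"
  by (rule TC_ext [of X])
    (use assms in \<open>simp_all add: is_monoid_map_arr [OF h] is_monoid_map_arr [OF k] free_map_tinj [OF _ _ h] free_map_tinj [OF _ _ k]\<close>)

text \<open>On \<open>X\<^sup>n\<close> the extension has to be the \<open>n\<close>-fold product of \<open>f\<close>, and \<open>mprod_concat\<close> says that this is
  multiplicative.\<close>

lemma free_ext_exists:
  assumes [simp]: "is_monoid M A" "f \<in> Arr M" and f: "Cod M f = Car A"
  shows "\<exists>h. is_monoid_map M (free_monoid M (Dom M f)) h A \<and> h \<cdot> tgen M (Dom M f) = f"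
proof -
  let ?X = "Dom M f"
  note [simp] = f
  obtain h where h [simp]: "h \<in> Arr M" "Dom M h = TC M ?X" "Cod M h = Car A" "\<And>n. h \<cdot> tinj M ?X n = mprod M A f n"
    by (rule TC_desc [of ?X "Car A" "mprod M A f"]) simp_all
  have "is_monoid_map M (free_monoid M ?X) h A"
  proof (rule is_monoid_mapI)
    show "h \<cdot> Mul (free_monoid M ?X) = Mul A \<cdot> (h \<otimes>\<^sub>a h)" (is "?lhs = ?rhs")
    proof (rule TC_TC_ext [of ?X ?X])
      fix m n
      have "?lhs \<cdot> (tinj M ?X m \<otimes>\<^sub>a tinj M ?X n) = h \<cdot> (tinj M ?X (m + n) \<cdot> tpow_concat M ?X m n)"
        by (simp add: free_Mul)
      also have "\<dots> = mprod M A f (m + n) \<cdot> tpow_concat M ?X m n"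
        by (subst Comp_reduce [OF h(4)]) simp_all
      also have "\<dots> = Mul A \<cdot> (mprod M A f m \<otimes>\<^sub>a mprod M A f n)"
        by (subst mprod_concat) simp_all
      finally show "?lhs \<cdot> (tinj M ?X m \<otimes>\<^sub>a tinj M ?X n) = ?rhs \<cdot> (tinj M ?X m \<otimes>\<^sub>a tinj M ?X n)"
        by simp
    qed simp_all
    show "h \<cdot> Unt (free_monoid M ?X) = Unt A"
      by (simp add: free_Unt)
  qed simp_all
  moreover have "h \<cdot> tgen M ?X = f"
    unfolding tgen_def by (subst Comp_reduce [OF h(4) [of 1, unfolded mprod_1 [OF assms]]]) simp_all
  ultimately show ?thesis by blast
qed

end

section \<open>Universal property of free monoids\<close>

context symmetric_monoidal_category
begin

lemma Mon_is_monoid [simp]: "F \<in> Arr (Mon M) \<Longrightarrow> is_monoid M (Dom (Mon M) F)"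
  "F \<in> Arr (Mon M) \<Longrightarrow> is_monoid M (Cod (Mon M) F)"
  by (auto elim: Mon_ArrE)

lemma Mon_is_monoid_map: "F \<in> Arr (Mon M) \<Longrightarrow> is_monoid_map M (Dom (Mon M) F) (und F) (Cod (Mon M) F)"
  by (auto elim: Mon_ArrE)

lemma und_arr [simp]:
  assumes "F \<in> Arr (Mon M)"
  shows "und F \<in> Arr M" "Dom M (und F) = Car (Dom (Mon M) F)" "Cod M (und F) = Car (Cod (Mon M) F)"
  using is_monoid_map_arr [OF Mon_is_monoid_map [OF assms]] by simp_all

lemma und_Comp [simp]: "und (G \<cdot>\<^bsub>Mon M\<^esub> F) = und G \<cdot> und F"
  and und_tar [simp]: "und (F \<otimes>\<^sub>a\<^bsub>Mon M\<^esub> G) = und F \<otimes>\<^sub>a und G"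
  by (cases F; cases G; simp)+

lemma Mon_eqI:
  assumes "F \<in> Arr (Mon M)" "G \<in> Arr (Mon M)"
    and "Dom (Mon M) F = Dom (Mon M) G" "Cod (Mon M) F = Cod (Mon M) G" "und F = und G"
  shows "F = G"
  using assms by (auto elim!: Mon_ArrE)

end

context free_monoids
begin

lemma free_Mon_eqI:
  assumes "X \<in> Obj M" "F \<in> Arr (Mon M)" "G \<in> Arr (Mon M)"
    and "Dom (Mon M) F = free_monoid M X" "Dom (Mon M) G = free_monoid M X" "Cod (Mon M) F = Cod (Mon M) G"
    and "und F \<cdot> tgen M X = und G \<cdot> tgen M X"
  shows "F = G"
proof (rule Mon_eqI)
  show "und F = und G"
    using Mon_is_monoid_map [OF assms(2), unfolded assms(4,6)] Mon_is_monoid_map [OF assms(3), unfolded assms(5)]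
    by (rule free_map_eq [OF assms(1) Mon_is_monoid(2) [OF assms(3)] _ _ assms(7)])
qed (use assms in simp_all)

lemma free_ext_arr [simp]:
  assumes [simp]: "is_monoid M A" "f \<in> Arr M" and f [simp]: "Cod M f = Car A"
  shows "free_ext M A f \<in> Arr (Mon M)" "Dom (Mon M) (free_ext M A f) = free_monoid M (Dom M f)"
    "Cod (Mon M) (free_ext M A f) = A" "und (free_ext M A f) \<cdot> tgen M (Dom M f) = f"
    "und (free_ext M A f) \<cdot> tinj M (Dom M f) n = mprod M A f n"
proof -
  let ?P = "\<lambda>h. h \<in> hom (Mon M) (free_monoid M (Dom M f)) A \<and> und h \<cdot> tgen M (Dom M f) = f"
  obtain h where h: "is_monoid_map M (free_monoid M (Dom M f)) h A" "h \<cdot> tgen M (Dom M f) = f"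
    using free_ext_exists [OF assms] by blast
  have "?P (free_monoid M (Dom M f), h, A)"
    by (simp add: h)
  moreover have "k = (free_monoid M (Dom M f), h, A)" if "?P k" for k
    using that h by (intro free_Mon_eqI [of "Dom M f"]) simp_all
  ultimately have P: "?P (free_ext M A f)"
    unfolding free_ext_def by (rule theI)
  then show *: "free_ext M A f \<in> Arr (Mon M)" "Dom (Mon M) (free_ext M A f) = free_monoid M (Dom M f)"
    "Cod (Mon M) (free_ext M A f) = A" "und (free_ext M A f) \<cdot> tgen M (Dom M f) = f"
    by simp_all
  show "und (free_ext M A f) \<cdot> tinj M (Dom M f) n = mprod M A f n"
    using free_map_tinj [OF _ _ Mon_is_monoid_map [OF *(1), unfolded *(2,3)], of n] *(4) by simp
qed

lemma Tmap_arr [simp]: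
  assumes [simp]: "f \<in> Arr M"
  shows "Tmap M f \<in> Arr (Mon M)" "Dom (Mon M) (Tmap M f) = free_monoid M (Dom M f)"
    "Cod (Mon M) (Tmap M f) = free_monoid M (Cod M f)"
    "und (Tmap M f) \<cdot> tgen M (Dom M f) = tgen M (Cod M f) \<cdot> f"
  using free_ext_arr(4) [of "free_monoid M (Cod M f)" "tgen M (Cod M f) \<cdot> f"]
  by (simp_all add: Tmap_def)

lemma product_map_arr [simp]:
  assumes [simp]: "is_monoid M x"
  shows "product_map M x \<in> Arr (Mon M)" "Dom (Mon M) (product_map M x) = free_monoid M (Car x)"
    "Cod (Mon M) (product_map M x) = x"
    "und (product_map M x) \<cdot> tgen M (Car x) = Ide M (Car x)"
    "und (product_map M x) \<cdot> tinj M (Car x) n = mprod M x (Ide M (Car x)) n"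
  using free_ext_arr(4,5) [of x "Ide M (Car x)"] by (simp_all add: product_map_def)

text \<open>The prescription defining \<open>\<theta>\<close> on tensor powers is the monoid map extending \<open>A \<otimes> B \<rightarrow> T A \<otimes> T B\<close>, by
  \<open>mprod_tensor\<close>.\<close>

lemma \<theta>_arr [simp]:
  assumes [simp]: "A \<in> Obj M" "B \<in> Obj M"
  shows "\<theta> M A B \<in> Arr (Mon M)" "Dom (Mon M) (\<theta> M A B) = free_monoid M (A \<otimes> B)"
    "Cod (Mon M) (\<theta> M A B) = tensor_mnd M (free_monoid M A) (free_monoid M B)"
    "und (\<theta> M A B) \<cdot> tinj M (A \<otimes> B) n = (tinj M A n \<otimes>\<^sub>a tinj M B n) \<cdot> tpow_shuffle M A B n"
    "und (\<theta> M A B) \<cdot> tgen M (A \<otimes> B) = tgen M A \<otimes>\<^sub>a tgen M B"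
proof -
  let ?t = "tensor_mnd M (free_monoid M A) (free_monoid M B)"
  let ?h = "free_ext M ?t (tgen M A \<otimes>\<^sub>a tgen M B)"
  let ?P = "\<lambda>h. h \<in> hom (Mon M) (free_monoid M (A \<otimes> B)) (free_monoid M A \<otimes>\<^bsub>Mon M\<^esub> free_monoid M B) \<and>
     (\<forall>n. und h \<cdot> tinj M (A \<otimes> B) n = (tinj M A n \<otimes>\<^sub>a tinj M B n) \<cdot> tpow_shuffle M A B n)"
  have h: "?P ?h"
    using free_ext_arr(5) [of ?t "tgen M A \<otimes>\<^sub>a tgen M B"] by (simp add: mprod_tensor mprod_tgen)
  moreover have "k = ?h" if "?P k" for k
  proof (rule Mon_eqI)
    show "und k = und ?h"
      by (rule TC_ext [of "A \<otimes> B"]) (use that h in simp_all)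
  qed (use that h in simp_all)
  ultimately have "\<theta> M A B = ?h"
    unfolding \<theta>_def by (rule the_equality)
  with h show "\<theta> M A B \<in> Arr (Mon M)" "Dom (Mon M) (\<theta> M A B) = free_monoid M (A \<otimes> B)"
    "Cod (Mon M) (\<theta> M A B) = tensor_mnd M (free_monoid M A) (free_monoid M B)"
    "und (\<theta> M A B) \<cdot> tinj M (A \<otimes> B) n = (tinj M A n \<otimes>\<^sub>a tinj M B n) \<cdot> tpow_shuffle M A B n"
    "und (\<theta> M A B) \<cdot> tgen M (A \<otimes> B) = tgen M A \<otimes>\<^sub>a tgen M B"
    using free_ext_arr(4) [of ?t "tgen M A \<otimes>\<^sub>a tgen M B"] by simp_all
qed

end

section \<open>Adjoint transposes and the colax-monoidal structure of a left adjoint\<close>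

context cat_functor
begin

declare fob_Obj [simp] far_Ide [simp]

lemma far_arr [simp]:
  assumes "f \<in> Arr A"
  shows "far F f \<in> Arr B" "Dom B (far F f) = fob F (Dom A f)" "Cod B (far F f) = fob F (Cod A f)"
  using far_hom [of f "Dom A f" "Cod A f"] assms by simp_all

lemma far_Comp' [simp]:
  "\<lbrakk>f \<in> Arr A; g \<in> Arr A; Cod A f = Dom A g\<rbrakk> \<Longrightarrow> far F (g \<cdot>\<^bsub>A\<^esub> f) = far F g \<cdot>\<^bsub>B\<^esub> far F f"
  using far_Comp [of f "Dom A f" "Cod A f" g "Cod A g"] by simp

end

context adjunction
begin

lemma unit_arr [unfolded L.A.in_hom, simp]: "X \<in> Obj C \<Longrightarrow> \<eta> X \<in> hom C X (fob R (fob L X))"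
  using unit_natural by (simp add: natural_def id_ftr_def comp_ftr_def)

lemma counit_arr [unfolded L.B.in_hom, simp]: "Y \<in> Obj D \<Longrightarrow> \<epsilon> Y \<in> hom D (fob L (fob R Y)) Y"
  using counit_natural by (simp add: natural_def id_ftr_def comp_ftr_def)

lemma unit_nat: "f \<in> Arr C \<Longrightarrow> \<eta> (Cod C f) \<cdot>\<^bsub>C\<^esub> f = far R (far L f) \<cdot>\<^bsub>C\<^esub> \<eta> (Dom C f)"
  using unit_natural by (simp add: natural_def id_ftr_def comp_ftr_def)

lemma counit_nat: "g \<in> Arr D \<Longrightarrow> \<epsilon> (Cod D g) \<cdot>\<^bsub>D\<^esub> far L (far R g) = g \<cdot>\<^bsub>D\<^esub> \<epsilon> (Dom D g)"
  using counit_natural by (simp add: natural_def id_ftr_def comp_ftr_def)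

text \<open>The two transpositions of the adjunction, \<open>(X \<rightarrow> R Y) \<rightarrow> (L X \<rightarrow> Y)\<close> and back.\<close>

definition flat :: "'p \<Rightarrow> 'a \<Rightarrow> 'b" where
  "flat Y f = \<epsilon> Y \<cdot>\<^bsub>D\<^esub> far L f"

definition sharp :: "'o \<Rightarrow> 'b \<Rightarrow> 'a" where
  "sharp X g = far R g \<cdot>\<^bsub>C\<^esub> \<eta> X"

lemma flat_arr [unfolded L.B.in_hom, simp]:
  "\<lbrakk>Y \<in> Obj D; f \<in> Arr C; Cod C f = fob R Y\<rbrakk> \<Longrightarrow> flat Y f \<in> hom D (fob L (Dom C f)) Y"
  by (simp add: flat_def)

lemma sharp_arr [unfolded L.A.in_hom, simp]:
  "\<lbrakk>X \<in> Obj C; g \<in> Arr D; Dom D g = fob L X\<rbrakk> \<Longrightarrow> sharp X g \<in> hom C X (fob R (Cod D g))"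
  by (simp add: sharp_def)

lemma flat_Comp:
  "\<lbrakk>Y \<in> Obj D; f \<in> Arr C; k \<in> Arr C; Cod C f = fob R Y; Cod C k = Dom C f\<rbrakk>
    \<Longrightarrow> flat Y (f \<cdot>\<^bsub>C\<^esub> k) = flat Y f \<cdot>\<^bsub>D\<^esub> far L k"
  by (simp add: flat_def)

lemma flat_far_Comp:
  "\<lbrakk>f \<in> Arr C; h \<in> Arr D; Cod C f = fob R (Dom D h); Y = Cod D h\<rbrakk>
    \<Longrightarrow> flat Y (far R h \<cdot>\<^bsub>C\<^esub> f) = h \<cdot>\<^bsub>D\<^esub> flat (Dom D h) f"
  by (simp add: flat_def counit_nat L.B.Comp_reduce [OF counit_nat])

lemma sharp_Comp:
  "\<lbrakk>X \<in> Obj C; g \<in> Arr D; h \<in> Arr D; Dom D g = fob L X; Cod D g = Dom D h\<rbrakk>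
    \<Longrightarrow> sharp X (h \<cdot>\<^bsub>D\<^esub> g) = far R h \<cdot>\<^bsub>C\<^esub> sharp X g"
  by (simp add: sharp_def)

lemma sharp_Comp_far:
  "\<lbrakk>k \<in> Arr C; g \<in> Arr D; Dom D g = fob L (Cod C k); X = Dom C k\<rbrakk>
    \<Longrightarrow> sharp X (g \<cdot>\<^bsub>D\<^esub> far L k) = sharp (Cod C k) g \<cdot>\<^bsub>C\<^esub> k"
  by (simp add: sharp_def unit_nat)

lemma flat_sharp [simp]:
  assumes "X \<in> Obj C" "g \<in> Arr D" "Dom D g = fob L X" "Cod D g = Y"
  shows "flat Y (sharp X g) = g"
proof -
  have "flat Y (sharp X g) = \<epsilon> (Cod D g) \<cdot>\<^bsub>D\<^esub> (far L (far R g) \<cdot>\<^bsub>D\<^esub> far L (\<eta> X))"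
    using assms by (auto simp: flat_def sharp_def)
  also have "\<dots> = (g \<cdot>\<^bsub>D\<^esub> \<epsilon> (Dom D g)) \<cdot>\<^bsub>D\<^esub> far L (\<eta> X)"
    using assms(1-3) by (intro L.B.Comp_reduce [OF counit_nat]) simp_all
  also have "\<dots> = g"
    using assms(1-3) by (simp add: triangle_left)
  finally show ?thesis .
qed

lemma sharp_flat [simp]:
  assumes "Y \<in> Obj D" "f \<in> Arr C" "Cod C f = fob R Y" "Dom C f = X"
  shows "sharp X (flat Y f) = f"
proof -
  have "sharp X (flat Y f) = far R (\<epsilon> Y) \<cdot>\<^bsub>C\<^esub> (\<eta> (Cod C f) \<cdot>\<^bsub>C\<^esub> f)"
    unfolding unit_nat [OF assms(2)] using assms by (auto simp: flat_def sharp_def)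
  also have "\<dots> = f"
    using assms(1-3) by (simp add: L.A.Comp_reduce [OF triangle_right])
  finally show ?thesis .
qed

lemma flat_unit: "X \<in> Obj C \<Longrightarrow> flat (fob L X) (\<eta> X) = Ide D (fob L X)"
  by (simp add: flat_def triangle_left)

lemma sharp_counit: "Y \<in> Obj D \<Longrightarrow> sharp (fob R Y) (\<epsilon> Y) = Ide C (fob R Y)"
  by (simp add: sharp_def triangle_right)

lemma flat_inject:
  assumes "Y \<in> Obj D" "f \<in> Arr C" "g \<in> Arr C" "Cod C f = fob R Y" "Cod C g = fob R Y" "Dom C f = Dom C g"
    "flat Y f = flat Y g"
  shows "f = g"
  using sharp_flat [OF assms(1,2,4) refl] sharp_flat [OF assms(1,3,5) refl] assms(6,7) by metis

lemma sharp_inject: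
  assumes "X \<in> Obj C" "f \<in> Arr D" "g \<in> Arr D" "Dom D f = fob L X" "Dom D g = fob L X" "Cod D f = Cod D g"
    "sharp X f = sharp X g"
  shows "f = g"
  using flat_sharp [OF assms(1,2,4) refl] flat_sharp [OF assms(1,3,5) refl] assms(6,7) by metis

end

context lax_monoidal
begin

lemmas \<phi>_arr [simp] = \<phi>_hom [unfolded B.in_hom]
  and \<phi>\<^sub>0_arr [simp] = \<phi>\<^sub>0_hom [unfolded B.in_hom]

lemma \<phi>_nat:
  "\<lbrakk>f \<in> Arr A; g \<in> Arr A; Cod A f = X'; Cod A g = Y'\<rbrakk>
    \<Longrightarrow> \<phi> X' Y' \<cdot>\<^bsub>B\<^esub> (far F f \<otimes>\<^sub>a\<^bsub>B\<^esub> far F g) = far F (f \<otimes>\<^sub>a\<^bsub>A\<^esub> g) \<cdot>\<^bsub>B\<^esub> \<phi> (Dom A f) (Dom A g)"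
  using \<phi>_natural [of f "Dom A f" X' g "Dom A g" Y'] by simp

lemma \<phi>_nat_Comp:
  "\<lbrakk>f \<in> Arr A; g \<in> Arr A; Cod A f = X'; Cod A g = Y'; h \<in> Arr B; k \<in> Arr B;
    Cod B h = fob F (Dom A f); Cod B k = fob F (Dom A g)\<rbrakk>
    \<Longrightarrow> \<phi> X' Y' \<cdot>\<^bsub>B\<^esub> ((far F f \<cdot>\<^bsub>B\<^esub> h) \<otimes>\<^sub>a\<^bsub>B\<^esub> (far F g \<cdot>\<^bsub>B\<^esub> k))
      = far F (f \<otimes>\<^sub>a\<^bsub>A\<^esub> g) \<cdot>\<^bsub>B\<^esub> (\<phi> (Dom A f) (Dom A g) \<cdot>\<^bsub>B\<^esub> (h \<otimes>\<^sub>a\<^bsub>B\<^esub> k))"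
  using B.Comp_reduce [OF \<phi>_nat [of f g X' Y'], of "h \<otimes>\<^sub>a\<^bsub>B\<^esub> k"] by force

end

locale lax_adjunction = adjunction C D L R \<eta> \<epsilon> + lax: lax_monoidal D C R \<phi> \<phi>\<^sub>0
  for C :: "('o, 'a, 'm) moncat_scheme" and D :: "('p, 'b, 'n) moncat_scheme"
    and L :: "('o, 'a, 'p, 'b) ftr" and R :: "('p, 'b, 'o, 'a) ftr"
    and \<eta> :: "'o \<Rightarrow> 'a" and \<epsilon> :: "'p \<Rightarrow> 'b"
    and \<phi> :: "'p \<Rightarrow> 'p \<Rightarrow> 'a" and \<phi>\<^sub>0 :: "'a"
begin

abbreviation compC (infixr "\<cdot>\<^sub>C" 55) where "g \<cdot>\<^sub>C f \<equiv> g \<cdot>\<^bsub>C\<^esub> f"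
abbreviation tobC (infixr "\<otimes>\<^sub>C" 70) where "X \<otimes>\<^sub>C Y \<equiv> X \<otimes>\<^bsub>C\<^esub> Y"
abbreviation tarC (infixr "\<otimes>\<^sub>a\<^sub>C" 70) where "f \<otimes>\<^sub>a\<^sub>C g \<equiv> f \<otimes>\<^sub>a\<^bsub>C\<^esub> g"
abbreviation compD (infixr "\<cdot>\<^sub>D" 55) where "g \<cdot>\<^sub>D f \<equiv> g \<cdot>\<^bsub>D\<^esub> f"
abbreviation tobD (infixr "\<otimes>\<^sub>D" 70) where "X \<otimes>\<^sub>D Y \<equiv> X \<otimes>\<^bsub>D\<^esub> Y"
abbreviation tarD (infixr "\<otimes>\<^sub>a\<^sub>D" 70) where "f \<otimes>\<^sub>a\<^sub>D g \<equiv> f \<otimes>\<^sub>a\<^bsub>D\<^esub> g"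

abbreviation cL :: "'o \<Rightarrow> 'o \<Rightarrow> 'b" where
  "cL \<equiv> adj_colax C D L \<eta> \<epsilon> \<phi>"

abbreviation eL :: "'b" where
  "eL \<equiv> adj_colax_unit D L \<epsilon> \<phi>\<^sub>0"

lemma cL_flat:
  "\<lbrakk>X \<in> Obj C; Y \<in> Obj C\<rbrakk>
    \<Longrightarrow> cL X Y = flat (fob L X \<otimes>\<^sub>D fob L Y) (\<phi> (fob L X) (fob L Y) \<cdot>\<^sub>C (\<eta> X \<otimes>\<^sub>a\<^sub>C \<eta> Y))"
  by (simp add: adj_colax_def flat_def)

lemma eL_flat: "eL = flat \<one>\<^bsub>D\<^esub> \<phi>\<^sub>0"
  by (simp add: adj_colax_unit_def flat_def)

lemma cL_arr [unfolded L.B.in_hom, simp]: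
  "\<lbrakk>X \<in> Obj C; Y \<in> Obj C\<rbrakk> \<Longrightarrow> cL X Y \<in> hom D (fob L (X \<otimes>\<^sub>C Y)) (fob L X \<otimes>\<^sub>D fob L Y)"
  by (simp add: cL_flat)

lemma eL_arr [unfolded L.B.in_hom, simp]: "eL \<in> hom D (fob L \<one>\<^bsub>C\<^esub>) \<one>\<^bsub>D\<^esub>"
  by (simp add: eL_flat)

text \<open>Write \<open>f\<close> and \<open>g\<close> as transposes; by naturality, \<open>\<phi>\<close> is then evaluated on units, where its transpose
  is \<open>c\<close> by definition.\<close>

lemma flat_\<phi>:
  assumes [simp]: "f \<in> Arr C" "g \<in> Arr C" "A \<in> Obj D" "B \<in> Obj D"
    and f [simp]: "Cod C f = fob R A" and g [simp]: "Cod C g = fob R B"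
  shows "flat (A \<otimes>\<^sub>D B) (\<phi> A B \<cdot>\<^sub>C (f \<otimes>\<^sub>a\<^sub>C g)) = (flat A f \<otimes>\<^sub>a\<^sub>D flat B g) \<cdot>\<^sub>D cL (Dom C f) (Dom C g)"
proof -
  have "\<phi> A B \<cdot>\<^sub>C (f \<otimes>\<^sub>a\<^sub>C g)
    = \<phi> A B \<cdot>\<^sub>C (sharp (Dom C f) (flat A f) \<otimes>\<^sub>a\<^sub>C sharp (Dom C g) (flat B g))"
    by simp
  also have "\<dots> = far R (flat A f \<otimes>\<^sub>a\<^sub>D flat B g) \<cdot>\<^sub>C (\<phi> (fob L (Dom C f)) (fob L (Dom C g)) \<cdot>\<^sub>C
      (\<eta> (Dom C f) \<otimes>\<^sub>a\<^sub>C \<eta> (Dom C g)))"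
    unfolding sharp_def by (subst lax.\<phi>_nat_Comp) simp_all
  finally show ?thesis
    by (simp add: flat_far_Comp cL_flat)
qed

text \<open>Each axiom for \<open>c\<close> compares the transposes of the two sides of the corresponding axiom for \<open>\<phi>\<close>,
  composed with units.\<close>

theorem colax_monoidal_left_adjoint: "colax_monoidal C D L cL eL"
proof
  fix X Y Z X' Y' f g
  { assume "X \<in> Obj C" "Y \<in> Obj C"
    then show "cL X Y \<in> hom D (fob L (X \<otimes>\<^sub>C Y)) (fob L X \<otimes>\<^sub>D fob L Y)" by simp }
  { assume "f \<in> hom C X X'" "g \<in> hom C Y Y'"
    then have [simp]: "f \<in> Arr C" "g \<in> Arr C" and d: "X = Dom C f" "Y = Dom C g" "X' = Cod C f" "Y' = Cod C g"
      by auto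
    have "cL (Cod C f) (Cod C g) \<cdot>\<^sub>D far L (f \<otimes>\<^sub>a\<^sub>C g)
      = flat (fob L (Cod C f) \<otimes>\<^sub>D fob L (Cod C g)) (\<phi> (fob L (Cod C f)) (fob L (Cod C g)) \<cdot>\<^sub>C
          ((\<eta> (Cod C f) \<cdot>\<^sub>C f) \<otimes>\<^sub>a\<^sub>C (\<eta> (Cod C g) \<cdot>\<^sub>C g)))"
      by (simp add: cL_flat flat_Comp [symmetric])
    also have "\<dots> = (flat (fob L (Cod C f)) (\<eta> (Cod C f) \<cdot>\<^sub>C f) \<otimes>\<^sub>a\<^sub>D flat (fob L (Cod C g)) (\<eta> (Cod C g) \<cdot>\<^sub>C g)) \<cdot>\<^sub>D
        cL (Dom C f) (Dom C g)"
      by (subst flat_\<phi>) simp_all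
    also have "\<dots> = (far L f \<otimes>\<^sub>a\<^sub>D far L g) \<cdot>\<^sub>D cL (Dom C f) (Dom C g)"
      by (simp add: flat_Comp flat_unit)
    finally show "cL X' Y' \<cdot>\<^sub>D far L (f \<otimes>\<^sub>a\<^sub>C g) = (far L f \<otimes>\<^sub>a\<^sub>D far L g) \<cdot>\<^sub>D cL X Y"
      by (simp only: d) }
  show "eL \<in> hom D (fob L \<one>\<^bsub>C\<^esub>) \<one>\<^bsub>D\<^esub>" by simp
  { assume [simp]: "X \<in> Obj C" "Y \<in> Obj C" "Z \<in> Obj C"
    let ?X = "fob L X" and ?Y = "fob L Y" and ?Z = "fob L Z"
    have "asc D ?X ?Y ?Z \<cdot>\<^sub>D ((cL X Y \<otimes>\<^sub>a\<^sub>D Ide D ?Z) \<cdot>\<^sub>D cL (X \<otimes>\<^sub>C Y) Z)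
      = asc D ?X ?Y ?Z \<cdot>\<^sub>D flat ((?X \<otimes>\<^sub>D ?Y) \<otimes>\<^sub>D ?Z)
          (\<phi> (?X \<otimes>\<^sub>D ?Y) ?Z \<cdot>\<^sub>C ((\<phi> ?X ?Y \<cdot>\<^sub>C (\<eta> X \<otimes>\<^sub>a\<^sub>C \<eta> Y)) \<otimes>\<^sub>a\<^sub>C \<eta> Z))"
      by (subst flat_\<phi>) (simp_all add: flat_unit cL_flat [of X Y])
    also have "\<dots> = flat (?X \<otimes>\<^sub>D (?Y \<otimes>\<^sub>D ?Z)) ((far R (asc D ?X ?Y ?Z) \<cdot>\<^sub>C (\<phi> (?X \<otimes>\<^sub>D ?Y) ?Z \<cdot>\<^sub>C
        (\<phi> ?X ?Y \<otimes>\<^sub>a\<^sub>C Ide C (fob R ?Z)))) \<cdot>\<^sub>C ((\<eta> X \<otimes>\<^sub>a\<^sub>C \<eta> Y) \<otimes>\<^sub>a\<^sub>C \<eta> Z))"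
      by (simp add: flat_far_Comp)
    also have "\<dots> = flat (?X \<otimes>\<^sub>D (?Y \<otimes>\<^sub>D ?Z)) ((\<phi> ?X (?Y \<otimes>\<^sub>D ?Z) \<cdot>\<^sub>C ((Ide C (fob R ?X) \<otimes>\<^sub>a\<^sub>C \<phi> ?Y ?Z) \<cdot>\<^sub>C
        asc C (fob R ?X) (fob R ?Y) (fob R ?Z))) \<cdot>\<^sub>C ((\<eta> X \<otimes>\<^sub>a\<^sub>C \<eta> Y) \<otimes>\<^sub>a\<^sub>C \<eta> Z))"
      by (subst lax.lax_assoc) simp_all
    also have "\<dots> = flat (?X \<otimes>\<^sub>D (?Y \<otimes>\<^sub>D ?Z)) ((\<phi> ?X (?Y \<otimes>\<^sub>D ?Z) \<cdot>\<^sub>C (\<eta> X \<otimes>\<^sub>a\<^sub>C (\<phi> ?Y ?Z \<cdot>\<^sub>C (\<eta> Y \<otimes>\<^sub>a\<^sub>C \<eta> Z)))) \<cdot>\<^sub>C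
        asc C X Y Z)"
      by (simp add: lax.B.asc_nats)
    also have "\<dots> = (Ide D ?X \<otimes>\<^sub>a\<^sub>D cL Y Z) \<cdot>\<^sub>D (cL X (Y \<otimes>\<^sub>C Z) \<cdot>\<^sub>D far L (asc C X Y Z))"
      by (subst flat_Comp) (simp_all add: flat_\<phi> flat_unit)
    finally show "asc D ?X ?Y ?Z \<cdot>\<^sub>D ((cL X Y \<otimes>\<^sub>a\<^sub>D Ide D ?Z) \<cdot>\<^sub>D cL (X \<otimes>\<^sub>C Y) Z)
      = (Ide D ?X \<otimes>\<^sub>a\<^sub>D cL Y Z) \<cdot>\<^sub>D (cL X (Y \<otimes>\<^sub>C Z) \<cdot>\<^sub>D far L (asc C X Y Z))" . }
  { assume [simp]: "X \<in> Obj C"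
    let ?X = "fob L X"
    have "lun D ?X \<cdot>\<^sub>D ((eL \<otimes>\<^sub>a\<^sub>D Ide D ?X) \<cdot>\<^sub>D cL \<one>\<^bsub>C\<^esub> X)
      = lun D ?X \<cdot>\<^sub>D flat (\<one>\<^bsub>D\<^esub> \<otimes>\<^sub>D ?X) (\<phi> \<one>\<^bsub>D\<^esub> ?X \<cdot>\<^sub>C (\<phi>\<^sub>0 \<otimes>\<^sub>a\<^sub>C \<eta> X))"
      by (subst flat_\<phi>) (simp_all add: flat_unit eL_flat)
    also have "\<dots> = flat ?X ((far R (lun D ?X) \<cdot>\<^sub>C (\<phi> \<one>\<^bsub>D\<^esub> ?X \<cdot>\<^sub>C (\<phi>\<^sub>0 \<otimes>\<^sub>a\<^sub>C Ide C (fob R ?X)))) \<cdot>\<^sub>C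
        (Ide C \<one>\<^bsub>C\<^esub> \<otimes>\<^sub>a\<^sub>C \<eta> X))"
      by (simp add: flat_far_Comp)
    also have "\<dots> = far L (lun C X)"
      by (subst lax.lax_unit_left) (simp_all add: lax.B.lun_nat flat_Comp flat_unit)
    finally show "lun D ?X \<cdot>\<^sub>D ((eL \<otimes>\<^sub>a\<^sub>D Ide D ?X) \<cdot>\<^sub>D cL \<one>\<^bsub>C\<^esub> X) = far L (lun C X)" .
    have "run D ?X \<cdot>\<^sub>D ((Ide D ?X \<otimes>\<^sub>a\<^sub>D eL) \<cdot>\<^sub>D cL X \<one>\<^bsub>C\<^esub>)
      = run D ?X \<cdot>\<^sub>D flat (?X \<otimes>\<^sub>D \<one>\<^bsub>D\<^esub>) (\<phi> ?X \<one>\<^bsub>D\<^esub> \<cdot>\<^sub>C (\<eta> X \<otimes>\<^sub>a\<^sub>C \<phi>\<^sub>0))"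
      by (subst flat_\<phi>) (simp_all add: flat_unit eL_flat)
    also have "\<dots> = flat ?X ((far R (run D ?X) \<cdot>\<^sub>C (\<phi> ?X \<one>\<^bsub>D\<^esub> \<cdot>\<^sub>C (Ide C (fob R ?X) \<otimes>\<^sub>a\<^sub>C \<phi>\<^sub>0))) \<cdot>\<^sub>C
        (\<eta> X \<otimes>\<^sub>a\<^sub>C Ide C \<one>\<^bsub>C\<^esub>))"
      by (simp add: flat_far_Comp)
    also have "\<dots> = far L (run C X)"
      by (subst lax.lax_unit_right) (simp_all add: lax.B.run_nat flat_Comp flat_unit)
    finally show "run D ?X \<cdot>\<^sub>D ((Ide D ?X \<otimes>\<^sub>a\<^sub>D eL) \<cdot>\<^sub>D cL X \<one>\<^bsub>C\<^esub>) = far L (run C X)" . }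
qed

end

lemma colax_monoidal_cong:
  assumes "colax_monoidal A B F c e" and eq: "\<And>X Y. \<lbrakk>X \<in> Obj A; Y \<in> Obj A\<rbrakk> \<Longrightarrow> c' X Y = c X Y"
  shows "colax_monoidal A B F c' e"
proof -
  interpret colax_monoidal A B F c e by fact
  have Obj: "X \<in> Obj A" "Y \<in> Obj A" if "f \<in> hom A X Y" for f X Y
    using that by auto
  show ?thesis
    by unfold_locales
      (simp_all only: eq Obj A.tob_Obj A.uno_Obj c_hom c_natural e_hom coassoc counit_left counit_right)
qed

section \<open>Lax-monoidal functors on monoids\<close>

lemma Rmon_ob_simps [simp]:
  "Car (Rmon_ob C R \<phi> \<phi>\<^sub>0 x) = fob R (Car x)"
  "Mul (Rmon_ob C R \<phi> \<phi>\<^sub>0 x) = far R (Mul x) \<cdot>\<^bsub>C\<^esub> \<phi> (Car x) (Car x)"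
  "Unt (Rmon_ob C R \<phi> \<phi>\<^sub>0 x) = far R (Unt x) \<cdot>\<^bsub>C\<^esub> \<phi>\<^sub>0"
  by (simp_all add: Rmon_ob_def)

text \<open>The lax counterpart of quasi-symmetry.  It is what makes \<open>\<phi>\<close> multiplicative on the tensor product of monoids
  \<open>R A\<close> and \<open>R B\<close>, whose multiplication starts with an interchange.\<close>

locale lax_quasi_symmetric =
  S: symmetric_monoidal_category C + T: symmetric_monoidal_category D + lax: lax_monoidal D C R \<phi> \<phi>\<^sub>0
  for C :: "('o, 'a, 'm) smcat_scheme" and D :: "('p, 'b, 'n) smcat_scheme"
    and R :: "('p, 'b, 'o, 'a) ftr" and \<phi> :: "'p \<Rightarrow> 'p \<Rightarrow> 'a" and \<phi>\<^sub>0 :: "'a" +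
  assumes \<phi>_interchange: "\<lbrakk>X \<in> Obj D; Y \<in> Obj D; Z \<in> Obj D; W \<in> Obj D\<rbrakk> \<Longrightarrow>
    \<phi> (X \<otimes>\<^bsub>D\<^esub> Z) (Y \<otimes>\<^bsub>D\<^esub> W) \<cdot>\<^bsub>C\<^esub> ((\<phi> X Z \<otimes>\<^sub>a\<^bsub>C\<^esub> \<phi> Y W) \<cdot>\<^bsub>C\<^esub> interchange C (fob R X) (fob R Y) (fob R Z) (fob R W))
    = far R (interchange D X Y Z W) \<cdot>\<^bsub>C\<^esub> (\<phi> (X \<otimes>\<^bsub>D\<^esub> Y) (Z \<otimes>\<^bsub>D\<^esub> W) \<cdot>\<^bsub>C\<^esub> (\<phi> X Y \<otimes>\<^sub>a\<^bsub>C\<^esub> \<phi> Z W))"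
begin

abbreviation "RM \<equiv> Rmon_ob C R \<phi> \<phi>\<^sub>0"

lemma is_monoid_Rmon_ob [simp]:
  assumes x [simp]: "is_monoid D x"
  shows "is_monoid C (RM x)"
proof -
  define a where "a = Car x"
  have [simp]: "a \<in> Obj D" by (simp add: a_def)
  note [simp] = a_def [symmetric]
  note Mul_x = T.Mul_assoc [OF x, simplified] T.Mul_unit_left [OF x, simplified] T.Mul_unit_right [OF x, simplified]
  let ?i = "Ide C (fob R a)"
  have "Mul (RM x) \<cdot>\<^bsub>C\<^esub> (Mul (RM x) \<otimes>\<^sub>a\<^bsub>C\<^esub> ?i)
    = far R (Mul x) \<cdot>\<^bsub>C\<^esub> (\<phi> a a \<cdot>\<^bsub>C\<^esub> ((far R (Mul x) \<cdot>\<^bsub>C\<^esub> \<phi> a a) \<otimes>\<^sub>a\<^bsub>C\<^esub> (far R (Ide D a) \<cdot>\<^bsub>C\<^esub> ?i)))"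
    by simp
  also have "\<dots> = far R (Mul x \<cdot>\<^bsub>D\<^esub> (Mul x \<otimes>\<^sub>a\<^bsub>D\<^esub> Ide D a)) \<cdot>\<^bsub>C\<^esub> (\<phi> (a \<otimes>\<^bsub>D\<^esub> a) a \<cdot>\<^bsub>C\<^esub> (\<phi> a a \<otimes>\<^sub>a\<^bsub>C\<^esub> ?i))"
    by (subst lax.\<phi>_nat_Comp) simp_all
  also have "\<dots> = far R (Mul x \<cdot>\<^bsub>D\<^esub> (Ide D a \<otimes>\<^sub>a\<^bsub>D\<^esub> Mul x)) \<cdot>\<^bsub>C\<^esub> (far R (asc D a a a) \<cdot>\<^bsub>C\<^esub> (\<phi> (a \<otimes>\<^bsub>D\<^esub> a) a \<cdot>\<^bsub>C\<^esub> (\<phi> a a \<otimes>\<^sub>a\<^bsub>C\<^esub> ?i)))"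
    unfolding Mul_x by simp
  also have "\<dots> = far R (Mul x) \<cdot>\<^bsub>C\<^esub> ((far R (Ide D a \<otimes>\<^sub>a\<^bsub>D\<^esub> Mul x) \<cdot>\<^bsub>C\<^esub> (\<phi> a (a \<otimes>\<^bsub>D\<^esub> a) \<cdot>\<^bsub>C\<^esub> (?i \<otimes>\<^sub>a\<^bsub>C\<^esub> \<phi> a a))) \<cdot>\<^bsub>C\<^esub>
      asc C (fob R a) (fob R a) (fob R a))"
    by (subst lax.lax_assoc) simp_all
  also have "\<dots> = far R (Mul x) \<cdot>\<^bsub>C\<^esub> ((\<phi> a a \<cdot>\<^bsub>C\<^esub> ((far R (Ide D a) \<cdot>\<^bsub>C\<^esub> ?i) \<otimes>\<^sub>a\<^bsub>C\<^esub> (far R (Mul x) \<cdot>\<^bsub>C\<^esub> \<phi> a a))) \<cdot>\<^bsub>C\<^esub>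
      asc C (fob R a) (fob R a) (fob R a))"
    by (subst lax.\<phi>_nat_Comp) simp_all
  finally have assoc: "Mul (RM x) \<cdot>\<^bsub>C\<^esub> (Mul (RM x) \<otimes>\<^sub>a\<^bsub>C\<^esub> ?i)
    = Mul (RM x) \<cdot>\<^bsub>C\<^esub> ((?i \<otimes>\<^sub>a\<^bsub>C\<^esub> Mul (RM x)) \<cdot>\<^bsub>C\<^esub> asc C (fob R a) (fob R a) (fob R a))"
    by simp
  have "Mul (RM x) \<cdot>\<^bsub>C\<^esub> (Unt (RM x) \<otimes>\<^sub>a\<^bsub>C\<^esub> ?i)
    = far R (Mul x) \<cdot>\<^bsub>C\<^esub> (\<phi> a a \<cdot>\<^bsub>C\<^esub> ((far R (Unt x) \<cdot>\<^bsub>C\<^esub> \<phi>\<^sub>0) \<otimes>\<^sub>a\<^bsub>C\<^esub> (far R (Ide D a) \<cdot>\<^bsub>C\<^esub> ?i)))"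
    by simp
  also have "\<dots> = far R (Mul x \<cdot>\<^bsub>D\<^esub> (Unt x \<otimes>\<^sub>a\<^bsub>D\<^esub> Ide D a)) \<cdot>\<^bsub>C\<^esub> (\<phi> \<one>\<^bsub>D\<^esub> a \<cdot>\<^bsub>C\<^esub> (\<phi>\<^sub>0 \<otimes>\<^sub>a\<^bsub>C\<^esub> ?i))"
    by (subst lax.\<phi>_nat_Comp) simp_all
  also have "\<dots> = lun C (fob R a)"
    unfolding Mul_x by (simp add: lax.lax_unit_left)
  finally have left: "Mul (RM x) \<cdot>\<^bsub>C\<^esub> (Unt (RM x) \<otimes>\<^sub>a\<^bsub>C\<^esub> ?i) = lun C (fob R a)" .
  have "Mul (RM x) \<cdot>\<^bsub>C\<^esub> (?i \<otimes>\<^sub>a\<^bsub>C\<^esub> Unt (RM x))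
    = far R (Mul x) \<cdot>\<^bsub>C\<^esub> (\<phi> a a \<cdot>\<^bsub>C\<^esub> ((far R (Ide D a) \<cdot>\<^bsub>C\<^esub> ?i) \<otimes>\<^sub>a\<^bsub>C\<^esub> (far R (Unt x) \<cdot>\<^bsub>C\<^esub> \<phi>\<^sub>0)))"
    by simp
  also have "\<dots> = far R (Mul x \<cdot>\<^bsub>D\<^esub> (Ide D a \<otimes>\<^sub>a\<^bsub>D\<^esub> Unt x)) \<cdot>\<^bsub>C\<^esub> (\<phi> a \<one>\<^bsub>D\<^esub> \<cdot>\<^bsub>C\<^esub> (?i \<otimes>\<^sub>a\<^bsub>C\<^esub> \<phi>\<^sub>0))"
    by (subst lax.\<phi>_nat_Comp) simp_all
  also have "\<dots> = run C (fob R a)"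
    unfolding Mul_x by (simp add: lax.lax_unit_right)
  finally have right: "Mul (RM x) \<cdot>\<^bsub>C\<^esub> (?i \<otimes>\<^sub>a\<^bsub>C\<^esub> Unt (RM x)) = run C (fob R a)" .
  show ?thesis
    unfolding is_monoid_def using assoc left right by (intro conjI) (simp_all del: Rmon_ob_simps(2,3), simp_all)
qed

lemma is_monoid_map_far_R:
  assumes [simp]: "is_monoid D x" "is_monoid D y" and f: "is_monoid_map D x f y"
  shows "is_monoid_map C (RM x) (far R f) (RM y)"
proof (rule S.is_monoid_mapI)
  note [simp] = T.is_monoid_map_arr [OF f]
  have "far R f \<cdot>\<^bsub>C\<^esub> Mul (RM x) = far R (f \<cdot>\<^bsub>D\<^esub> Mul x) \<cdot>\<^bsub>C\<^esub> \<phi> (Car x) (Car x)"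
    by simp
  also have "\<dots> = Mul (RM y) \<cdot>\<^bsub>C\<^esub> (far R f \<otimes>\<^sub>a\<^bsub>C\<^esub> far R f)"
    by (subst T.is_monoid_map_Mul [OF f]) (simp add: lax.\<phi>_nat)
  finally show "far R f \<cdot>\<^bsub>C\<^esub> Mul (RM x) = Mul (RM y) \<cdot>\<^bsub>C\<^esub> (far R f \<otimes>\<^sub>a\<^bsub>C\<^esub> far R f)" .
  have "far R f \<cdot>\<^bsub>C\<^esub> Unt (RM x) = far R (f \<cdot>\<^bsub>D\<^esub> Unt x) \<cdot>\<^bsub>C\<^esub> \<phi>\<^sub>0"
    by simp
  then show "far R f \<cdot>\<^bsub>C\<^esub> Unt (RM x) = Unt (RM y)"
    by (subst (asm) T.is_monoid_map_Unt [OF f]) simp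
qed (use T.is_monoid_map_arr [OF f] in simp_all)

text \<open>The unit law of \<open>\<phi>\<close> at the unit object, in the form in which units of tensor products of monoids involve it.\<close>

lemma \<phi>\<^sub>0_square: "\<phi> \<one>\<^bsub>D\<^esub> \<one>\<^bsub>D\<^esub> \<cdot>\<^bsub>C\<^esub> (\<phi>\<^sub>0 \<otimes>\<^sub>a\<^bsub>C\<^esub> \<phi>\<^sub>0) = far R (arr_inv D (lun D \<one>\<^bsub>D\<^esub>)) \<cdot>\<^bsub>C\<^esub> (\<phi>\<^sub>0 \<cdot>\<^bsub>C\<^esub> lun C \<one>\<^bsub>C\<^esub>)"
proof -
  have i: "far R (arr_inv D (lun D \<one>\<^bsub>D\<^esub>)) \<cdot>\<^bsub>C\<^esub> far R (lun D \<one>\<^bsub>D\<^esub>) = Ide C (fob R (\<one>\<^bsub>D\<^esub> \<otimes>\<^bsub>D\<^esub> \<one>\<^bsub>D\<^esub>))"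
    by (simp flip: lax.far_Comp')
  have "\<phi>\<^sub>0 \<cdot>\<^bsub>C\<^esub> lun C \<one>\<^bsub>C\<^esub> = lun C (fob R \<one>\<^bsub>D\<^esub>) \<cdot>\<^bsub>C\<^esub> (Ide C \<one>\<^bsub>C\<^esub> \<otimes>\<^sub>a\<^bsub>C\<^esub> \<phi>\<^sub>0)"
    by (simp add: S.lun_nat)
  also have "\<dots> = (far R (lun D \<one>\<^bsub>D\<^esub>) \<cdot>\<^bsub>C\<^esub> (\<phi> \<one>\<^bsub>D\<^esub> \<one>\<^bsub>D\<^esub> \<cdot>\<^bsub>C\<^esub> (\<phi>\<^sub>0 \<otimes>\<^sub>a\<^bsub>C\<^esub> Ide C (fob R \<one>\<^bsub>D\<^esub>)))) \<cdot>\<^bsub>C\<^esub> (Ide C \<one>\<^bsub>C\<^esub> \<otimes>\<^sub>a\<^bsub>C\<^esub> \<phi>\<^sub>0)"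
    by (subst lax.lax_unit_left) simp_all
  also have "\<dots> = far R (lun D \<one>\<^bsub>D\<^esub>) \<cdot>\<^bsub>C\<^esub> (\<phi> \<one>\<^bsub>D\<^esub> \<one>\<^bsub>D\<^esub> \<cdot>\<^bsub>C\<^esub> (\<phi>\<^sub>0 \<otimes>\<^sub>a\<^bsub>C\<^esub> \<phi>\<^sub>0))"
    by simp
  finally show ?thesis
    by (simp add: S.Comp_reduce [OF i])
qed

lemma is_monoid_map_\<phi>:
  assumes [simp]: "is_monoid D x" "is_monoid D y"
  shows "is_monoid_map C (tensor_mnd C (RM x) (RM y)) (\<phi> (Car x) (Car y)) (RM (tensor_mnd D x y))"
proof (rule S.is_monoid_mapI)
  define a b where "a = Car x" and "b = Car y"
  have [simp]: "a \<in> Obj D" "b \<in> Obj D" by (simp_all add: a_def b_def)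
  note [simp] = a_def [symmetric] b_def [symmetric]
  let ?i = "interchange C (fob R a) (fob R b) (fob R a) (fob R b)"
  have "\<phi> a b \<cdot>\<^bsub>C\<^esub> Mul (tensor_mnd C (RM x) (RM y))
    = (\<phi> a b \<cdot>\<^bsub>C\<^esub> ((far R (Mul x) \<cdot>\<^bsub>C\<^esub> \<phi> a a) \<otimes>\<^sub>a\<^bsub>C\<^esub> (far R (Mul y) \<cdot>\<^bsub>C\<^esub> \<phi> b b))) \<cdot>\<^bsub>C\<^esub> ?i"
    by simp
  also have "\<dots> = far R (Mul x \<otimes>\<^sub>a\<^bsub>D\<^esub> Mul y) \<cdot>\<^bsub>C\<^esub> (\<phi> (a \<otimes>\<^bsub>D\<^esub> a) (b \<otimes>\<^bsub>D\<^esub> b) \<cdot>\<^bsub>C\<^esub> ((\<phi> a a \<otimes>\<^sub>a\<^bsub>C\<^esub> \<phi> b b) \<cdot>\<^bsub>C\<^esub> ?i))"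
    by (subst lax.\<phi>_nat_Comp) simp_all
  also have "\<dots> = Mul (RM (tensor_mnd D x y)) \<cdot>\<^bsub>C\<^esub> (\<phi> a b \<otimes>\<^sub>a\<^bsub>C\<^esub> \<phi> a b)"
    by (subst \<phi>_interchange) simp_all
  finally show "\<phi> (Car x) (Car y) \<cdot>\<^bsub>C\<^esub> Mul (tensor_mnd C (RM x) (RM y))
      = Mul (RM (tensor_mnd D x y)) \<cdot>\<^bsub>C\<^esub> (\<phi> (Car x) (Car y) \<otimes>\<^sub>a\<^bsub>C\<^esub> \<phi> (Car x) (Car y))"
    by simp
  have "\<phi> a b \<cdot>\<^bsub>C\<^esub> Unt (tensor_mnd C (RM x) (RM y))
    = (\<phi> a b \<cdot>\<^bsub>C\<^esub> ((far R (Unt x) \<cdot>\<^bsub>C\<^esub> \<phi>\<^sub>0) \<otimes>\<^sub>a\<^bsub>C\<^esub> (far R (Unt y) \<cdot>\<^bsub>C\<^esub> \<phi>\<^sub>0))) \<cdot>\<^bsub>C\<^esub> arr_inv C (lun C \<one>\<^bsub>C\<^esub>)"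
    by simp
  also have "\<dots> = far R (Unt x \<otimes>\<^sub>a\<^bsub>D\<^esub> Unt y) \<cdot>\<^bsub>C\<^esub> ((\<phi> \<one>\<^bsub>D\<^esub> \<one>\<^bsub>D\<^esub> \<cdot>\<^bsub>C\<^esub> (\<phi>\<^sub>0 \<otimes>\<^sub>a\<^bsub>C\<^esub> \<phi>\<^sub>0)) \<cdot>\<^bsub>C\<^esub> arr_inv C (lun C \<one>\<^bsub>C\<^esub>))"
    by (subst lax.\<phi>_nat_Comp) simp_all
  finally show "\<phi> (Car x) (Car y) \<cdot>\<^bsub>C\<^esub> Unt (tensor_mnd C (RM x) (RM y)) = Unt (RM (tensor_mnd D x y))"
    unfolding \<phi>\<^sub>0_square by simp
qed simp_all

lemma is_monoid_map_\<phi>\<^sub>0: "is_monoid_map C (unit_mnd C) \<phi>\<^sub>0 (RM (unit_mnd D))"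
proof (rule S.is_monoid_mapI)
  have i: "far R (lun D \<one>\<^bsub>D\<^esub>) \<cdot>\<^bsub>C\<^esub> far R (arr_inv D (lun D \<one>\<^bsub>D\<^esub>)) = Ide C (fob R \<one>\<^bsub>D\<^esub>)"
    by (simp flip: lax.far_Comp')
  show "\<phi>\<^sub>0 \<cdot>\<^bsub>C\<^esub> Mul (unit_mnd C) = Mul (RM (unit_mnd D)) \<cdot>\<^bsub>C\<^esub> (\<phi>\<^sub>0 \<otimes>\<^sub>a\<^bsub>C\<^esub> \<phi>\<^sub>0)"
    by (simp add: \<phi>\<^sub>0_square S.Comp_reduce [OF i])
qed simp_all

lemma fob_Rmon [simp]: "fob (Rmon C R \<phi> \<phi>\<^sub>0) x = RM x"
  by (simp add: Rmon_def)

lemma far_Rmon: "far (Rmon C R \<phi> \<phi>\<^sub>0) F = (RM (Dom (Mon D) F), far R (und F), RM (Cod (Mon D) F))"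
  by (cases F) (simp add: Rmon_def)

theorem lax_monoidal_Rmon:
  "lax_monoidal (Mon D) (Mon C) (Rmon C R \<phi> \<phi>\<^sub>0) (\<phi>_mon C D R \<phi> \<phi>\<^sub>0) (\<phi>_mon_unit C D R \<phi> \<phi>\<^sub>0)"
  by unfold_locales
    (auto simp: far_Rmon \<phi>_mon_def \<phi>_mon_unit_def T.is_monoid_map_arr is_monoid_map_far_R
      is_monoid_map_\<phi> is_monoid_map_\<phi>\<^sub>0 lax.\<phi>_nat lax.lax_assoc lax.lax_unit_left lax.lax_unit_right
      elim!: Mon_ArrE)

end

section \<open>Coequalizers and their induced arrows\<close>

context category
begin

lemma is_coequalizer_coeq: "\<exists>q. is_coequalizer K f g q \<Longrightarrow> is_coequalizer K f g (coeq K f g)"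
  unfolding coeq_def by (rule someI_ex)

lemma is_coequalizer_arr:
  assumes "is_coequalizer K f g q"
  shows "f \<in> Arr K" "g \<in> Arr K" "q \<in> Arr K" "Dom K g = Dom K f" "Cod K g = Cod K f" "Dom K q = Cod K f"
    and "q \<cdot> f = q \<cdot> g"
  using assms unfolding is_coequalizer_def in_hom by blast+

lemma coequalizer_ext:
  assumes q: "is_coequalizer K f g q" and *: "h \<in> Arr K" "k \<in> Arr K" "Dom K h = Cod K q" "Dom K k = Cod K q"
    "Cod K h = Cod K k" "h \<cdot> q = k \<cdot> q"
  shows "h = k"
proof -
  note a = is_coequalizer_arr [OF q]
  have "(k \<cdot> q) \<cdot> f = k \<cdot> (q \<cdot> f)" "(k \<cdot> q) \<cdot> g = k \<cdot> (q \<cdot> g)"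
    by (rule Comp_assoc'; simp add: a(1-6) *)+
  then have "(k \<cdot> q) \<cdot> f = (k \<cdot> q) \<cdot> g"
    using a(7) by metis
  moreover have "k \<cdot> q \<in> Arr K" "Dom K (k \<cdot> q) = Cod K f" "Cod K (k \<cdot> q) = Cod K k"
    using a(1-6) * by simp_all
  ultimately have "\<exists>!l. l \<in> hom K (Cod K q) (Cod K k) \<and> l \<cdot> q = k \<cdot> q"
    using q unfolding is_coequalizer_def by metis
  then show ?thesis
    using * by (metis in_hom)
qed

text \<open>The components \<open>s\<close> and \<open>t\<close> of an arrow out of the colimit of a parallel pair are tied by \<open>s = t \<cdot> f\<close>; given
  this, its existence and uniqueness are those for the coequalizer.\<close>

lemma coeq_desc_arr:
  assumes q: "is_coequalizer K f g (coeq K f g)"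
    and t: "t \<in> Arr K" "Dom K t = Cod K f" "t \<cdot> f = t \<cdot> g" and s: "s = t \<cdot> f"
  shows "coeq_desc K f g s t \<in> Arr K" "Dom K (coeq_desc K f g s t) = Cod K (coeq K f g)"
    "Cod K (coeq_desc K f g s t) = Cod K t" "coeq_desc K f g s t \<cdot> coeq K f g = t"
proof -
  note a = is_coequalizer_arr [OF q]
  let ?P = "\<lambda>h. h \<in> hom K (Cod K (coeq K f g)) (Cod K t) \<and> h \<cdot> (coeq K f g \<cdot> f) = s \<and> h \<cdot> coeq K f g = t"
  obtain h where h: "h \<in> Arr K" "Dom K h = Cod K (coeq K f g)" "Cod K h = Cod K t" "h \<cdot> coeq K f g = t"
    using q t unfolding is_coequalizer_def by (metis in_hom)
  have "h \<cdot> (coeq K f g \<cdot> f) = t \<cdot> f"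
    by (rule Comp_reduce [OF h(4)]) (simp_all add: a(1-6) h(1-3))
  then have "?P h" using h s by simp
  moreover have "k = h" if "?P k" for k
    by (rule coequalizer_ext [OF q]) (use that h in simp_all)
  ultimately have "?P (coeq_desc K f g s t)"
    unfolding coeq_desc_def by (rule theI)
  then show "coeq_desc K f g s t \<in> Arr K" "Dom K (coeq_desc K f g s t) = Cod K (coeq K f g)"
    "Cod K (coeq_desc K f g s t) = Cod K t" "coeq_desc K f g s t \<cdot> coeq K f g = t"
    by simp_all
qed

end

section \<open>The left adjoint on monoids\<close>

locale quasi_symmetric_adjunction =
  C: free_monoids C + D: free_monoids D + lax_adjunction C D L R \<eta> \<epsilon> \<phi> \<phi>\<^sub>0
  for C :: "('o, 'a, 'm) smcat_scheme" and D :: "('p, 'b, 'n) smcat_scheme"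
    and L :: "('o, 'a, 'p, 'b) ftr" and R :: "('p, 'b, 'o, 'a) ftr"
    and \<eta> :: "'o \<Rightarrow> 'a" and \<epsilon> :: "'p \<Rightarrow> 'b"
    and \<phi> :: "'p \<Rightarrow> 'p \<Rightarrow> 'a" and \<phi>\<^sub>0 :: "'a" +
  assumes quasi_symmetric: "quasi_symmetric C D L cL"
begin

lemma flat_Ide: "Y \<in> Obj D \<Longrightarrow> flat Y (Ide C (fob R Y)) = \<epsilon> Y"
  by (simp add: flat_def)

lemma flat_\<phi>_alone: "\<lbrakk>A \<in> Obj D; B \<in> Obj D\<rbrakk>
    \<Longrightarrow> flat (A \<otimes>\<^sub>D B) (\<phi> A B) = (\<epsilon> A \<otimes>\<^sub>a\<^sub>D \<epsilon> B) \<cdot>\<^sub>D cL (fob R A) (fob R B)"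
  using flat_\<phi> [of "Ide C (fob R A)" "Ide C (fob R B)" A B] by (simp add: flat_Ide)

text \<open>Both sides are compared through their transposes, which by \<open>flat_\<phi>\<close> are the two composites in the definition of
  quasi-symmetry for the objects \<open>R X, R Y, R Z, R W\<close>, followed by counits.\<close>

lemma \<phi>_quasi_symmetric:
  assumes [simp]: "X \<in> Obj D" "Y \<in> Obj D" "Z \<in> Obj D" "W \<in> Obj D"
  shows "\<phi> (X \<otimes>\<^sub>D Z) (Y \<otimes>\<^sub>D W) \<cdot>\<^sub>C ((\<phi> X Z \<otimes>\<^sub>a\<^sub>C \<phi> Y W) \<cdot>\<^sub>C interchange C (fob R X) (fob R Y) (fob R Z) (fob R W))
    = far R (interchange D X Y Z W) \<cdot>\<^sub>C (\<phi> (X \<otimes>\<^sub>D Y) (Z \<otimes>\<^sub>D W) \<cdot>\<^sub>C (\<phi> X Y \<otimes>\<^sub>a\<^sub>C \<phi> Z W))"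
    (is "?l = ?r")
proof (rule flat_inject [of "(X \<otimes>\<^sub>D Z) \<otimes>\<^sub>D (Y \<otimes>\<^sub>D W)"])
  let ?X = "fob R X" and ?Y = "fob R Y" and ?Z = "fob R Z" and ?W = "fob R W"
  have *: "flat ((P \<otimes>\<^sub>D Q) \<otimes>\<^sub>D (S \<otimes>\<^sub>D T)) (\<phi> (P \<otimes>\<^sub>D Q) (S \<otimes>\<^sub>D T) \<cdot>\<^sub>C (\<phi> P Q \<otimes>\<^sub>a\<^sub>C \<phi> S T))
      = ((\<epsilon> P \<otimes>\<^sub>a\<^sub>D \<epsilon> Q) \<otimes>\<^sub>a\<^sub>D (\<epsilon> S \<otimes>\<^sub>a\<^sub>D \<epsilon> T)) \<cdot>\<^sub>D
        ((cL (fob R P) (fob R Q) \<otimes>\<^sub>a\<^sub>D cL (fob R S) (fob R T)) \<cdot>\<^sub>D cL (fob R P \<otimes>\<^sub>C fob R Q) (fob R S \<otimes>\<^sub>C fob R T))"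
    if "P \<in> Obj D" "Q \<in> Obj D" "S \<in> Obj D" "T \<in> Obj D" for P Q S T
    using that by (simp add: flat_\<phi> flat_\<phi>_alone)
  have "flat ((X \<otimes>\<^sub>D Z) \<otimes>\<^sub>D (Y \<otimes>\<^sub>D W)) ?l
    = flat ((X \<otimes>\<^sub>D Z) \<otimes>\<^sub>D (Y \<otimes>\<^sub>D W)) ((\<phi> (X \<otimes>\<^sub>D Z) (Y \<otimes>\<^sub>D W) \<cdot>\<^sub>C (\<phi> X Z \<otimes>\<^sub>a\<^sub>C \<phi> Y W)) \<cdot>\<^sub>C interchange C ?X ?Y ?Z ?W)"
    by simp
  also have "\<dots> = flat ((X \<otimes>\<^sub>D Z) \<otimes>\<^sub>D (Y \<otimes>\<^sub>D W)) (\<phi> (X \<otimes>\<^sub>D Z) (Y \<otimes>\<^sub>D W) \<cdot>\<^sub>C (\<phi> X Z \<otimes>\<^sub>a\<^sub>C \<phi> Y W)) \<cdot>\<^sub>D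
      far L (interchange C ?X ?Y ?Z ?W)"
    by (subst flat_Comp) simp_all
  also have "\<dots> = ((\<epsilon> X \<otimes>\<^sub>a\<^sub>D \<epsilon> Z) \<otimes>\<^sub>a\<^sub>D (\<epsilon> Y \<otimes>\<^sub>a\<^sub>D \<epsilon> W)) \<cdot>\<^sub>D ((cL ?X ?Z \<otimes>\<^sub>a\<^sub>D cL ?Y ?W) \<cdot>\<^sub>D
      (cL (?X \<otimes>\<^sub>C ?Z) (?Y \<otimes>\<^sub>C ?W) \<cdot>\<^sub>D far L (interchange C ?X ?Y ?Z ?W)))"
    unfolding * [OF assms(1,3,2,4)] by simp
  also have "\<dots> = ((\<epsilon> X \<otimes>\<^sub>a\<^sub>D \<epsilon> Z) \<otimes>\<^sub>a\<^sub>D (\<epsilon> Y \<otimes>\<^sub>a\<^sub>D \<epsilon> W)) \<cdot>\<^sub>D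
      (interchange D (fob L ?X) (fob L ?Y) (fob L ?Z) (fob L ?W) \<cdot>\<^sub>D
        ((cL ?X ?Y \<otimes>\<^sub>a\<^sub>D cL ?Z ?W) \<cdot>\<^sub>D cL (?X \<otimes>\<^sub>C ?Y) (?Z \<otimes>\<^sub>C ?W)))"
    using quasi_symmetric by (simp add: quasi_symmetric_def)
  also have "\<dots> = interchange D X Y Z W \<cdot>\<^sub>D (((\<epsilon> X \<otimes>\<^sub>a\<^sub>D \<epsilon> Y) \<otimes>\<^sub>a\<^sub>D (\<epsilon> Z \<otimes>\<^sub>a\<^sub>D \<epsilon> W)) \<cdot>\<^sub>D
        ((cL ?X ?Y \<otimes>\<^sub>a\<^sub>D cL ?Z ?W) \<cdot>\<^sub>D cL (?X \<otimes>\<^sub>C ?Y) (?Z \<otimes>\<^sub>C ?W)))"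
    by (subst D.Comp_reduce [OF D.interchange_nat]) simp_all
  also have "\<dots> = flat ((X \<otimes>\<^sub>D Z) \<otimes>\<^sub>D (Y \<otimes>\<^sub>D W)) ?r"
    using * [OF assms] by (subst flat_far_Comp) simp_all
  finally show "flat ((X \<otimes>\<^sub>D Z) \<otimes>\<^sub>D (Y \<otimes>\<^sub>D W)) ?l = flat ((X \<otimes>\<^sub>D Z) \<otimes>\<^sub>D (Y \<otimes>\<^sub>D W)) ?r" .
qed simp_all

end

sublocale quasi_symmetric_adjunction \<subseteq> Q: lax_quasi_symmetric C D R \<phi> \<phi>\<^sub>0
  by unfold_locales (rule \<phi>_quasi_symmetric)

context quasi_symmetric_adjunction
begin

abbreviation cLs :: "'o \<Rightarrow> nat \<Rightarrow> 'b" where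
  "cLs \<equiv> colax_iter C D L cL eL"

lemma cLs_arr [unfolded D.in_hom, simp]:
  "X \<in> Obj C \<Longrightarrow> cLs X n \<in> hom D (fob L (tpow C X n)) (tpow D (fob L X) n)"
  by (induction n) simp_all

text \<open>The formula \<open>flat_\<phi>\<close>, iterated: an \<open>n\<close>-fold product in \<open>R A\<close> transposes to an \<open>n\<close>-fold product in \<open>A\<close>,
  preceded by the iterated colax map.\<close>

lemma flat_mprod:
  assumes [simp]: "is_monoid D A" "f \<in> Arr C" and f [simp]: "Cod C f = fob R (Car A)"
  shows "flat (Car A) (mprod C (Q.RM A) f n) = mprod D A (flat (Car A) f) n \<cdot>\<^sub>D cLs (Dom C f) n"
proof (induction n)
  case 0
  show ?case by (simp add: flat_far_Comp eL_flat)
next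
  case (Suc n)
  have "flat (Car A) (mprod C (Q.RM A) f (Suc n))
    = Mul A \<cdot>\<^sub>D flat (Car A \<otimes>\<^sub>D Car A) (\<phi> (Car A) (Car A) \<cdot>\<^sub>C (mprod C (Q.RM A) f n \<otimes>\<^sub>a\<^sub>C f))"
    by (simp add: flat_far_Comp)
  also have "\<dots> = Mul A \<cdot>\<^sub>D ((flat (Car A) (mprod C (Q.RM A) f n) \<otimes>\<^sub>a\<^sub>D flat (Car A) f) \<cdot>\<^sub>D cL (tpow C (Dom C f) n) (Dom C f))"
    by (subst flat_\<phi>) simp_all
  finally show ?case
    unfolding Suc by simp
qed

lemma mprod_sharp:
  assumes "is_monoid D A" "X \<in> Obj C" "g \<in> Arr D" "Dom D g = fob L X" "Cod D g = Car A"
  shows "sharp (tpow C X n) (mprod D A g n \<cdot>\<^sub>D cLs X n) = mprod C (Q.RM A) (sharp X g) n"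
  using flat_mprod [of A "sharp X g" n] assms
  by (intro flat_inject [of "Car A"]) simp_all

text \<open>As a left adjoint, \<open>L\<close> preserves the coproduct of the tensor powers.\<close>

lemma L_TC_ext:
  assumes [simp]: "X \<in> Obj C" "f \<in> Arr D" "g \<in> Arr D" and f: "Dom D f = fob L (TC C X)" and g: "Dom D g = fob L (TC C X)"
    and c: "Cod D f = Cod D g" and eq: "\<And>n. f \<cdot>\<^sub>D far L (tinj C X n) = g \<cdot>\<^sub>D far L (tinj C X n)"
  shows "f = g"
proof (rule sharp_inject [of "TC C X"])
  note [simp] = f g
  show "sharp (TC C X) f = sharp (TC C X) g"
  proof (rule C.TC_ext [of X])
    fix n
    show "sharp (TC C X) f \<cdot>\<^sub>C tinj C X n = sharp (TC C X) g \<cdot>\<^sub>C tinj C X n"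
      using sharp_Comp_far [of "tinj C X n" f "tpow C X n"] sharp_Comp_far [of "tinj C X n" g "tpow C X n"] eq [of n]
      by simp
  qed (simp_all add: c)
qed (use assms in simp_all)

lemma \<beta>_gen_arr:
  assumes [simp]: "X \<in> Obj C"
  shows "\<beta>_gen C D L cL eL X \<in> Arr D" "Dom D (\<beta>_gen C D L cL eL X) = fob L (TC C X)"
    "Cod D (\<beta>_gen C D L cL eL X) = TC D (fob L X)"
    "\<beta>_gen C D L cL eL X \<cdot>\<^sub>D far L (tinj C X n) = tinj D (fob L X) n \<cdot>\<^sub>D cLs X n"
proof -
  let ?P = "\<lambda>b. b \<in> hom D (fob L (TC C X)) (TC D (fob L X)) \<and>
     (\<forall>n. b \<cdot>\<^sub>D far L (tinj C X n) = tinj D (fob L X) n \<cdot>\<^sub>D cLs X n)"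
  obtain h where h [simp]: "h \<in> Arr C" "Dom C h = TC C X" "Cod C h = fob R (TC D (fob L X))"
      "\<And>n. h \<cdot>\<^sub>C tinj C X n = sharp (tpow C X n) (tinj D (fob L X) n \<cdot>\<^sub>D cLs X n)"
    by (rule C.TC_desc [of X "fob R (TC D (fob L X))" "\<lambda>n. sharp (tpow C X n) (tinj D (fob L X) n \<cdot>\<^sub>D cLs X n)"]) simp_all
  have "flat (TC D (fob L X)) h \<cdot>\<^sub>D far L (tinj C X n) = tinj D (fob L X) n \<cdot>\<^sub>D cLs X n" for n
    by (subst flat_Comp [symmetric]) simp_all
  then have P: "?P (flat (TC D (fob L X)) h)" by simp
  moreover have "b = flat (TC D (fob L X)) h" if "?P b" for b
    by (rule L_TC_ext [of X]) (use that P in simp_all)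
  ultimately have "?P (\<beta>_gen C D L cL eL X)"
    unfolding \<beta>_gen_def by (rule theI)
  then show "\<beta>_gen C D L cL eL X \<in> Arr D" "Dom D (\<beta>_gen C D L cL eL X) = fob L (TC C X)"
    "Cod D (\<beta>_gen C D L cL eL X) = TC D (fob L X)"
    "\<beta>_gen C D L cL eL X \<cdot>\<^sub>D far L (tinj C X n) = tinj D (fob L X) n \<cdot>\<^sub>D cLs X n"
    by simp_all
qed

lemma \<alpha>_arr [simp]:
  assumes [simp]: "is_monoid C x"
  shows "\<alpha> C D L x \<in> Arr (Mon D)" "Dom (Mon D) (\<alpha> C D L x) = free_monoid D (fob L (TC C (Car x)))"
    "Cod (Mon D) (\<alpha> C D L x) = free_monoid D (fob L (Car x))"
    "und (\<alpha> C D L x) \<cdot>\<^sub>D tgen D (fob L (TC C (Car x))) = tgen D (fob L (Car x)) \<cdot>\<^sub>D far L (und (product_map C x))"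
  using D.Tmap_arr [of "far L (und (product_map C x))"] by (simp_all add: \<alpha>_def)

lemma \<beta>_arr [simp]:
  assumes [simp]: "is_monoid C x"
  shows "\<beta> C D L cL eL x \<in> Arr (Mon D)" "Dom (Mon D) (\<beta> C D L cL eL x) = free_monoid D (fob L (TC C (Car x)))"
    "Cod (Mon D) (\<beta> C D L cL eL x) = free_monoid D (fob L (Car x))"
    "und (\<beta> C D L cL eL x) \<cdot>\<^sub>D tgen D (fob L (TC C (Car x))) = \<beta>_gen C D L cL eL (Car x)"
  using D.free_ext_arr [of "free_monoid D (fob L (Car x))" "\<beta>_gen C D L cL eL (Car x)"]
  by (simp_all add: \<beta>_def \<D>\<^sub>2_def \<beta>_gen_arr)

text \<open>The cases \<open>n = 0\<close> and \<open>n = 2\<close> are preservation of unit and multiplication.\<close>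

lemma is_monoid_map_iff_mprod:
  assumes x [simp]: "is_monoid C x" and y [simp]: "is_monoid C y" and [simp]: "f \<in> Arr C"
    and f [simp]: "Dom C f = Car x" "Cod C f = Car y"
  shows "is_monoid_map C x f y \<longleftrightarrow> (\<forall>n. f \<cdot>\<^sub>C mprod C x (Ide C (Car x)) n = mprod C y f n)"
proof (intro iffI allI)
  fix n
  assume "is_monoid_map C x f y"
  then show "f \<cdot>\<^sub>C mprod C x (Ide C (Car x)) n = mprod C y f n"
    using C.mprod_map [of x y f "Ide C (Car x)" n] by simp
next
  assume *: "\<forall>n. f \<cdot>\<^sub>C mprod C x (Ide C (Car x)) n = mprod C y f n"
  show "is_monoid_map C x f y"
  proof (rule C.is_monoid_mapI)
    show "f \<cdot>\<^sub>C Unt x = Unt y" using * [THEN spec, of 0] by simp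
    show "f \<cdot>\<^sub>C Mul x = Mul y \<cdot>\<^sub>C (f \<otimes>\<^sub>a\<^sub>C f)" (is "?lhs = ?rhs")
    proof (rule C.iso_epi [of "lun C (Car x) \<otimes>\<^sub>a\<^sub>C Ide C (Car x)"])
      have 2: "mprod C A g (Suc 1) = Mul A \<cdot>\<^sub>C ((g \<cdot>\<^sub>C lun C (Dom C g)) \<otimes>\<^sub>a\<^sub>C g)"
        if "is_monoid C A" "g \<in> Arr C" "Cod C g = Car A" for A g
        unfolding mprod.simps(2) [of C A g 1] C.mprod_1 [OF that] ..
      show "?lhs \<cdot>\<^sub>C (lun C (Car x) \<otimes>\<^sub>a\<^sub>C Ide C (Car x))
        = ?rhs \<cdot>\<^sub>C (lun C (Car x) \<otimes>\<^sub>a\<^sub>C Ide C (Car x))"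
        using * [THEN spec, of "Suc 1", unfolded 2 [of y f, OF y \<open>f \<in> Arr C\<close> f(2)] 2 [of x "Ide C (Car x)", simplified]]
        by (simp add: C.Mul_unit_left [OF x])
    qed simp_all
  qed simp_all
qed

text \<open>Both composites are determined on the generators \<open>L (T X)\<close>, hence on each \<open>L (X\<^sup>n)\<close>.  There they are the
  restriction \<open>g\<close> of \<open>H\<close> to \<open>L X\<close> after the \<open>n\<close>-fold product of \<open>X\<close>, and the \<open>n\<close>-fold product of \<open>g\<close> after the
  iterated colax map.  By \<open>mprod_sharp\<close> their transposes agree iff the transpose of \<open>g\<close> commutes with
  \<open>n\<close>-fold products.\<close>

lemma coequalizes_iff:
  assumes x [simp]: "is_monoid C x" and H [simp]: "H \<in> Arr (Mon D)"
    and d [simp]: "Dom (Mon D) H = free_monoid D (fob L (Car x))"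
  shows "H \<cdot>\<^bsub>Mon D\<^esub> \<alpha> C D L x = H \<cdot>\<^bsub>Mon D\<^esub> \<beta> C D L cL eL x \<longleftrightarrow>
    is_monoid_map C x (sharp (Car x) (und H \<cdot>\<^sub>D tgen D (fob L (Car x)))) (Q.RM (Cod (Mon D) H))"
proof -
  define A where "A = Cod (Mon D) H"
  define X where "X = Car x"
  define g where "g = und H \<cdot>\<^sub>D tgen D (fob L X)"
  define m where "m = und (product_map C x)"
  have A [simp]: "is_monoid D A" and X [simp]: "X \<in> Obj C" by (simp_all add: A_def X_def)
  have H' [simp]: "und H \<in> Arr D" "Dom D (und H) = TC D (fob L X)" "Cod D (und H) = Car A"
    using D.und_arr [OF H] by (simp_all add: A_def X_def)
  have g [simp]: "g \<in> Arr D" "Dom D g = fob L X" "Cod D g = Car A" by (simp_all add: g_def)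
  have m [simp]: "m \<in> Arr C" "Dom C m = TC C X" "Cod C m = X"
    by (simp_all add: m_def X_def)
  note [simp] = \<beta>_gen_arr
  have "H \<cdot>\<^bsub>Mon D\<^esub> \<alpha> C D L x = H \<cdot>\<^bsub>Mon D\<^esub> \<beta> C D L cL eL x \<longleftrightarrow> g \<cdot>\<^sub>D far L m = und H \<cdot>\<^sub>D \<beta>_gen C D L cL eL X"
  proof
    assume "H \<cdot>\<^bsub>Mon D\<^esub> \<alpha> C D L x = H \<cdot>\<^bsub>Mon D\<^esub> \<beta> C D L cL eL x"
    then have "und (H \<cdot>\<^bsub>Mon D\<^esub> \<alpha> C D L x) \<cdot>\<^sub>D tgen D (fob L (TC C X)) = und (H \<cdot>\<^bsub>Mon D\<^esub> \<beta> C D L cL eL x) \<cdot>\<^sub>D tgen D (fob L (TC C X))"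
      by simp
    then show "g \<cdot>\<^sub>D far L m = und H \<cdot>\<^sub>D \<beta>_gen C D L cL eL X"
      by (simp add: g_def m_def X_def)
  next
    assume *: "g \<cdot>\<^sub>D far L m = und H \<cdot>\<^sub>D \<beta>_gen C D L cL eL X"
    have "und (H \<cdot>\<^bsub>Mon D\<^esub> \<alpha> C D L x) \<cdot>\<^sub>D tgen D (fob L (TC C X)) = g \<cdot>\<^sub>D far L m"
      by (simp add: g_def m_def X_def)
    moreover have "und (H \<cdot>\<^bsub>Mon D\<^esub> \<beta> C D L cL eL x) \<cdot>\<^sub>D tgen D (fob L (TC C X)) = und H \<cdot>\<^sub>D \<beta>_gen C D L cL eL X"
      by (simp add: X_def)
    ultimately show "H \<cdot>\<^bsub>Mon D\<^esub> \<alpha> C D L x = H \<cdot>\<^bsub>Mon D\<^esub> \<beta> C D L cL eL x"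
      by (intro D.free_Mon_eqI [of "fob L (TC C X)"]) (simp_all add: * X_def [symmetric])
  qed
  also have "\<dots> \<longleftrightarrow> (\<forall>n. (g \<cdot>\<^sub>D far L m) \<cdot>\<^sub>D far L (tinj C X n) = (und H \<cdot>\<^sub>D \<beta>_gen C D L cL eL X) \<cdot>\<^sub>D far L (tinj C X n))"
  proof
    assume *: "\<forall>n. (g \<cdot>\<^sub>D far L m) \<cdot>\<^sub>D far L (tinj C X n) = (und H \<cdot>\<^sub>D \<beta>_gen C D L cL eL X) \<cdot>\<^sub>D far L (tinj C X n)"
    show "g \<cdot>\<^sub>D far L m = und H \<cdot>\<^sub>D \<beta>_gen C D L cL eL X"
      by (rule L_TC_ext [of X, OF _ _ _ _ _ _ * [THEN spec]]) simp_all
  qed simp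
  also have "\<dots> \<longleftrightarrow> (\<forall>n. sharp X g \<cdot>\<^sub>C mprod C x (Ide C X) n = mprod C (Q.RM A) (sharp X g) n)"
  proof (intro all_cong1)
    fix n
    have "(g \<cdot>\<^sub>D far L m) \<cdot>\<^sub>D far L (tinj C X n) = g \<cdot>\<^sub>D far L (m \<cdot>\<^sub>C tinj C X n)"
      by simp
    also have "m \<cdot>\<^sub>C tinj C X n = mprod C x (Ide C X) n"
      by (simp add: m_def X_def)
    finally have 1: "(g \<cdot>\<^sub>D far L m) \<cdot>\<^sub>D far L (tinj C X n) = g \<cdot>\<^sub>D far L (mprod C x (Ide C X) n)" .
    have "is_monoid_map D (free_monoid D (fob L X)) (und H) A"
      using D.Mon_is_monoid_map [OF H] by (simp add: A_def X_def)
    then have "und H \<cdot>\<^sub>D tinj D (fob L X) n = mprod D A g n"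
      using D.free_map_tinj [of "fob L X" A "und H" n] by (simp add: g_def)
    then have 2: "(und H \<cdot>\<^sub>D \<beta>_gen C D L cL eL X) \<cdot>\<^sub>D far L (tinj C X n) = mprod D A g n \<cdot>\<^sub>D cLs X n"
      by (simp add: D.Comp_reduce)
    have 3: "mprod C x (Ide C X) n \<in> Arr C" "Dom C (mprod C x (Ide C X) n) = tpow C X n" "Cod C (mprod C x (Ide C X) n) = X"
      by (simp_all add: X_def)
    have "sharp (tpow C X n) (g \<cdot>\<^sub>D far L (mprod C x (Ide C X) n)) = sharp X g \<cdot>\<^sub>C mprod C x (Ide C X) n"
      using sharp_Comp_far [of "mprod C x (Ide C X) n" g "tpow C X n"] 3 by simp
    moreover have "sharp (tpow C X n) (mprod D A g n \<cdot>\<^sub>D cLs X n) = mprod C (Q.RM A) (sharp X g) n"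
      by (rule mprod_sharp) simp_all
    moreover have "g \<cdot>\<^sub>D far L (mprod C x (Ide C X) n) = mprod D A g n \<cdot>\<^sub>D cLs X n"
      if "sharp (tpow C X n) (g \<cdot>\<^sub>D far L (mprod C x (Ide C X) n)) = sharp (tpow C X n) (mprod D A g n \<cdot>\<^sub>D cLs X n)"
      by (rule sharp_inject [OF _ _ _ _ _ _ that]) (simp_all add: 3)
    ultimately show "(g \<cdot>\<^sub>D far L m) \<cdot>\<^sub>D far L (tinj C X n) = (und H \<cdot>\<^sub>D \<beta>_gen C D L cL eL X) \<cdot>\<^sub>D far L (tinj C X n)
      \<longleftrightarrow> sharp X g \<cdot>\<^sub>C mprod C x (Ide C X) n = mprod C (Q.RM A) (sharp X g) n"
      unfolding 1 2 by metis
  qed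
  also have "\<dots> \<longleftrightarrow> is_monoid_map C x (sharp X g) (Q.RM A)"
    by (subst is_monoid_map_iff_mprod) (simp_all add: X_def [symmetric])
  finally show ?thesis
    unfolding g_def X_def A_def .
qed

end

locale monoid_left_adjoint = quasi_symmetric_adjunction C D L R \<eta> \<epsilon> \<phi> \<phi>\<^sub>0
  for C :: "('o, 'a, 'm) smcat_scheme" and D :: "('p, 'b, 'n) smcat_scheme"
    and L :: "('o, 'a, 'p, 'b) ftr" and R :: "('p, 'b, 'o, 'a) ftr"
    and \<eta> :: "'o \<Rightarrow> 'a" and \<epsilon> :: "'p \<Rightarrow> 'b"
    and \<phi> :: "'p \<Rightarrow> 'p \<Rightarrow> 'a" and \<phi>\<^sub>0 :: "'a" +
  assumes coequalizers: "is_monoid C x \<Longrightarrow>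
    \<exists>q. is_coequalizer (Mon D) (\<alpha> C D L x) (\<beta> C D L cL eL x) q"
begin

abbreviation "LM \<equiv> fob (Lmon C D L cL eL)"

abbreviation "proj \<equiv> Lmon_proj C D L cL eL"

text \<open>The universal arrow \<open>L X \<rightarrow> L\<^sup>m\<^sup>o\<^sup>n X\<close>; its transpose is the unit of the adjunction on monoids.\<close>

definition gen :: "('o, 'a) mnd \<Rightarrow> 'b" where
  "gen x = und (proj x) \<cdot>\<^sub>D tgen D (fob L (Car x))"

lemma is_coequalizer_proj: "is_monoid C x \<Longrightarrow> is_coequalizer (Mon D) (\<alpha> C D L x) (\<beta> C D L cL eL x) (proj x)"
  unfolding Lmon_proj_def by (rule D.Mon.is_coequalizer_coeq [OF coequalizers])

lemma proj_arr [simp]: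
  assumes x [simp]: "is_monoid C x"
  shows "proj x \<in> Arr (Mon D)" "Dom (Mon D) (proj x) = free_monoid D (fob L (Car x))"
    "Cod (Mon D) (proj x) = LM x" "is_monoid D (LM x)"
proof -
  note a = D.Mon.is_coequalizer_arr [OF is_coequalizer_proj [OF x]]
  show p: "proj x \<in> Arr (Mon D)" by (rule a)
  show "Dom (Mon D) (proj x) = free_monoid D (fob L (Car x))" using a(6) by simp
  show c: "Cod (Mon D) (proj x) = LM x" by (simp add: Lmon_def)
  show "is_monoid D (LM x)" using D.Mon_is_monoid(2) [OF p] unfolding c .
qed

lemma gen_arr [unfolded D.in_hom, simp]: "is_monoid C x \<Longrightarrow> gen x \<in> hom D (fob L (Car x)) (Car (LM x))"
  by (simp add: gen_def)

text \<open>The direction of \<open>coequalizes_iff\<close> that yields the unit, applied to the universal map itself; in \<open>LM_desc\<close> the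
  other direction yields the arrow corresponding to a monoid map \<open>X \<rightarrow> R A\<close>.\<close>

lemma is_monoid_map_sharp_gen:
  assumes x [simp]: "is_monoid C x"
  shows "is_monoid_map C x (sharp (Car x) (gen x)) (Q.RM (LM x))"
proof -
  have "proj x \<cdot>\<^bsub>Mon D\<^esub> \<alpha> C D L x = proj x \<cdot>\<^bsub>Mon D\<^esub> \<beta> C D L cL eL x"
    by (rule D.Mon.is_coequalizer_arr(7) [OF is_coequalizer_proj [OF x]])
  then show ?thesis
    unfolding coequalizes_iff [OF x proj_arr(1,2) [OF x]] gen_def by simp
qed

lemma LM_ext:
  assumes x [simp]: "is_monoid C x" and F: "F \<in> Arr (Mon D)" "Dom (Mon D) F = LM x"
    and G: "G \<in> Arr (Mon D)" "Dom (Mon D) G = LM x" and "Cod (Mon D) F = Cod (Mon D) G"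
    and eq: "und F \<cdot>\<^sub>D gen x = und G \<cdot>\<^sub>D gen x"
  shows "F = G"
proof (rule D.Mon.coequalizer_ext [OF is_coequalizer_proj [OF x]])
  show "F \<cdot>\<^bsub>Mon D\<^esub> proj x = G \<cdot>\<^bsub>Mon D\<^esub> proj x"
    by (rule D.free_Mon_eqI [of "fob L (Car x)"]) (use assms in \<open>simp_all add: gen_def\<close>)
qed (use assms in simp_all)

lemma LM_desc:
  assumes x [simp]: "is_monoid C x" and t: "t \<in> Arr (Mon D)" "Dom (Mon D) t = free_monoid D (fob L (Car x))"
    and m: "is_monoid_map C x (sharp (Car x) (und t \<cdot>\<^sub>D tgen D (fob L (Car x)))) (Q.RM (Cod (Mon D) t))"
    and s: "s = t \<cdot>\<^bsub>Mon D\<^esub> \<alpha> C D L x"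
  defines "h \<equiv> coeq_desc (Mon D) (\<alpha> C D L x) (\<beta> C D L cL eL x) s t"
  shows "h \<in> Arr (Mon D)" "Dom (Mon D) h = LM x" "Cod (Mon D) h = Cod (Mon D) t"
    "und h \<cdot>\<^sub>D gen x = und t \<cdot>\<^sub>D tgen D (fob L (Car x))" "h \<cdot>\<^bsub>Mon D\<^esub> proj x = t"
proof -
  have eq: "t \<cdot>\<^bsub>Mon D\<^esub> \<alpha> C D L x = t \<cdot>\<^bsub>Mon D\<^esub> \<beta> C D L cL eL x"
    using m unfolding coequalizes_iff [OF x t] .
  have d: "Dom (Mon D) t = Cod (Mon D) (\<alpha> C D L x)" by (simp add: t)
  have *: "h \<in> Arr (Mon D)" "Dom (Mon D) h = LM x" "Cod (Mon D) h = Cod (Mon D) t"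
    and p: "h \<cdot>\<^bsub>Mon D\<^esub> proj x = t"
    using D.Mon.coeq_desc_arr [OF is_coequalizer_proj [OF x, unfolded Lmon_proj_def] t(1) d eq s]
    unfolding h_def by (simp_all add: Lmon_proj_def Lmon_def)
  then show "h \<in> Arr (Mon D)" "Dom (Mon D) h = LM x" "Cod (Mon D) h = Cod (Mon D) t" "h \<cdot>\<^bsub>Mon D\<^esub> proj x = t"
    by simp_all
  have "und t = und h \<cdot>\<^sub>D und (proj x)"
    unfolding p [symmetric] by simp
  then show "und h \<cdot>\<^sub>D gen x = und t \<cdot>\<^sub>D tgen D (fob L (Car x))"
    using * by (simp add: gen_def)
qed

text \<open>The arrow \<open>T (L f)\<close>, followed by the universal map for the target, transposes to the composite of \<open>f\<close> with the unit;
  both are maps of monoids, so it factors through the coequalizer.  The naturality square of \<open>\<alpha>\<close>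
  matches the component on the source of the pair.\<close>

lemma far_LM:
  assumes F [simp]: "F \<in> Arr (Mon C)"
  defines "x \<equiv> Dom (Mon C) F" and "y \<equiv> Cod (Mon C) F" and "h \<equiv> far (Lmon C D L cL eL) F"
  shows "h \<in> Arr (Mon D)" "Dom (Mon D) h = LM x" "Cod (Mon D) h = LM y"
    "und h \<cdot>\<^sub>D gen x = gen y \<cdot>\<^sub>D far L (und F)"
proof -
  have x [simp]: "is_monoid C x" and y [simp]: "is_monoid C y" by (simp_all add: x_def y_def)
  define f where "f = und F"
  have f [simp]: "f \<in> Arr C" "Dom C f = Car x" "Cod C f = Car y" by (simp_all add: f_def x_def y_def)
  have f_map: "is_monoid_map C x f y"
    using C.Mon_is_monoid_map [OF F] by (simp add: f_def x_def y_def)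
  have Fx: "Dom (Mon C) F = x" "Cod (Mon C) F = y" "und F = f" by (simp_all add: x_def y_def f_def)
  have h: "h = coeq_desc (Mon D) (\<alpha> C D L x) (\<beta> C D L cL eL x)
      ((proj y \<cdot>\<^bsub>Mon D\<^esub> \<alpha> C D L y) \<cdot>\<^bsub>Mon D\<^esub> Tmap D (far L (und (Tmap C f)))) (proj y \<cdot>\<^bsub>Mon D\<^esub> Tmap D (far L f))"
    unfolding h_def x_def y_def f_def
    by (cases F) (simp add: Lmon_def coeq_map_def Lmon_proj_def)
  have t: "proj y \<cdot>\<^bsub>Mon D\<^esub> Tmap D (far L f) \<in> Arr (Mon D)"
    "Dom (Mon D) (proj y \<cdot>\<^bsub>Mon D\<^esub> Tmap D (far L f)) = free_monoid D (fob L (Car x))"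
    "Cod (Mon D) (proj y \<cdot>\<^bsub>Mon D\<^esub> Tmap D (far L f)) = LM y"
    by simp_all
  have Tf [simp]: "und (Tmap D (far L f)) \<cdot>\<^sub>D tgen D (fob L (Car x)) = tgen D (fob L (Car y)) \<cdot>\<^sub>D far L f"
    using D.Tmap_arr(4) [of "far L f"] by simp
  have g: "und (proj y \<cdot>\<^bsub>Mon D\<^esub> Tmap D (far L f)) \<cdot>\<^sub>D tgen D (fob L (Car x)) = gen y \<cdot>\<^sub>D far L f"
    by (simp add: gen_def)
  have "sharp (Car x) (gen y \<cdot>\<^sub>D far L f) = sharp (Car y) (gen y) \<cdot>\<^sub>C f"
    using sharp_Comp_far [of f "gen y" "Car x"] by simp
  then have m: "is_monoid_map C x (sharp (Car x) (und (proj y \<cdot>\<^bsub>Mon D\<^esub> Tmap D (far L f)) \<cdot>\<^sub>D tgen D (fob L (Car x))))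
      (Q.RM (Cod (Mon D) (proj y \<cdot>\<^bsub>Mon D\<^esub> Tmap D (far L f))))"
    unfolding g t(3) by (simp add: C.is_monoid_map_Comp [OF x y _ f_map is_monoid_map_sharp_gen])
  have nat: "product_map C y \<cdot>\<^bsub>Mon C\<^esub> Tmap C f = F \<cdot>\<^bsub>Mon C\<^esub> product_map C x"
  proof (rule C.free_Mon_eqI [of "Car x"])
    have "und (Tmap C f) \<cdot>\<^sub>C tgen C (Car x) = tgen C (Car y) \<cdot>\<^sub>C f"
      using C.Tmap_arr(4) [of f] by simp
    moreover have "und (product_map C y) \<cdot>\<^sub>C (tgen C (Car y) \<cdot>\<^sub>C f) = f"
      by (subst C.Comp_reduce [OF C.product_map_arr(4) [OF y]]) simp_all
    ultimately show "und (product_map C y \<cdot>\<^bsub>Mon C\<^esub> Tmap C f) \<cdot>\<^sub>C tgen C (Car x) = und (F \<cdot>\<^bsub>Mon C\<^esub> product_map C x) \<cdot>\<^sub>C tgen C (Car x)"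
      by (simp add: Fx)
  qed (simp_all add: Fx)
  define mx my where "mx = und (product_map C x)" and "my = und (product_map C y)"
  have mxy [simp]: "mx \<in> Arr C" "Dom C mx = TC C (Car x)" "Cod C mx = Car x"
      "my \<in> Arr C" "Dom C my = TC C (Car y)" "Cod C my = Car y"
    by (simp_all add: mx_def my_def)
  have m_nat: "my \<cdot>\<^sub>C und (Tmap C f) = f \<cdot>\<^sub>C mx"
    using arg_cong [OF nat, of und] by (simp add: mx_def my_def Fx)
  have "\<alpha> C D L y \<cdot>\<^bsub>Mon D\<^esub> Tmap D (far L (und (Tmap C f))) = Tmap D (far L f) \<cdot>\<^bsub>Mon D\<^esub> \<alpha> C D L x"
  proof (rule D.free_Mon_eqI [of "fob L (TC C (Car x))"])
    have "und (Tmap D (far L (und (Tmap C f)))) \<cdot>\<^sub>D tgen D (fob L (TC C (Car x)))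
      = tgen D (fob L (TC C (Car y))) \<cdot>\<^sub>D far L (und (Tmap C f))"
      using D.Tmap_arr(4) [of "far L (und (Tmap C f))"] by simp
    then have "und (\<alpha> C D L y \<cdot>\<^bsub>Mon D\<^esub> Tmap D (far L (und (Tmap C f)))) \<cdot>\<^sub>D tgen D (fob L (TC C (Car x)))
      = und (\<alpha> C D L y) \<cdot>\<^sub>D (tgen D (fob L (TC C (Car y))) \<cdot>\<^sub>D far L (und (Tmap C f)))"
      by simp
    also have "\<dots> = tgen D (fob L (Car y)) \<cdot>\<^sub>D far L (my \<cdot>\<^sub>C und (Tmap C f))"
      by (subst D.Comp_reduce [OF \<alpha>_arr(4) [OF y]]) (simp_all add: my_def)
    also have "\<dots> = und (Tmap D (far L f)) \<cdot>\<^sub>D (tgen D (fob L (Car x)) \<cdot>\<^sub>D far L mx)"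
      unfolding m_nat by (subst D.Comp_reduce [OF Tf]) simp_all
    finally show "und (\<alpha> C D L y \<cdot>\<^bsub>Mon D\<^esub> Tmap D (far L (und (Tmap C f)))) \<cdot>\<^sub>D tgen D (fob L (TC C (Car x)))
      = und (Tmap D (far L f) \<cdot>\<^bsub>Mon D\<^esub> \<alpha> C D L x) \<cdot>\<^sub>D tgen D (fob L (TC C (Car x)))"
      by (simp add: mx_def)
  qed simp_all
  then have s: "(proj y \<cdot>\<^bsub>Mon D\<^esub> \<alpha> C D L y) \<cdot>\<^bsub>Mon D\<^esub> Tmap D (far L (und (Tmap C f)))
      = (proj y \<cdot>\<^bsub>Mon D\<^esub> Tmap D (far L f)) \<cdot>\<^bsub>Mon D\<^esub> \<alpha> C D L x"
    by simp
  show "h \<in> Arr (Mon D)" "Dom (Mon D) h = LM x" "Cod (Mon D) h = LM y"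
    "und h \<cdot>\<^sub>D gen x = gen y \<cdot>\<^sub>D far L (und F)"
    using LM_desc [OF x t(1,2) m s] unfolding h g t(3) Fx by simp_all
qed

lemma cat_functor_Lmon: "cat_functor (Mon C) (Mon D) (Lmon C D L cL eL)"
proof
  fix x y z F G
  { assume "x \<in> Obj (Mon C)"
    then have [simp]: "is_monoid C x" by simp
    show "LM x \<in> Obj (Mon D)" by simp
    show "far (Lmon C D L cL eL) (Ide (Mon C) x) = Ide (Mon D) (LM x)"
      using far_LM [of "Ide (Mon C) x"] C.Mon.Ide_arr [of x] D.Mon.Ide_arr [of "LM x"]
      by (intro LM_ext [of x]) simp_all }
  { assume "F \<in> hom (Mon C) x y"
    then show "far (Lmon C D L cL eL) F \<in> hom (Mon D) (LM x) (LM y)"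
      using far_LM [of F] by auto }
  { assume "F \<in> hom (Mon C) x y" "G \<in> hom (Mon C) y z"
    then have F: "F \<in> Arr (Mon C)" "Dom (Mon C) F = x" "Cod (Mon C) F = y"
      and G: "G \<in> Arr (Mon C)" "Dom (Mon C) G = y" "Cod (Mon C) G = z" by simp_all
    then have [simp]: "is_monoid C x" "is_monoid C y" "is_monoid C z"
      using C.Mon_is_monoid by metis+
    note [simp] = F G far_LM(1-3) [OF F(1), unfolded F] far_LM(1-3) [OF G(1), unfolded G]
    have FG: "G \<cdot>\<^bsub>Mon C\<^esub> F \<in> Arr (Mon C)" by simp
    show "far (Lmon C D L cL eL) (G \<cdot>\<^bsub>Mon C\<^esub> F) = far (Lmon C D L cL eL) G \<cdot>\<^bsub>Mon D\<^esub> far (Lmon C D L cL eL) F" (is "?lhs = ?rhs")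
    proof (rule LM_ext [of x])
      show "und ?lhs \<cdot>\<^sub>D gen x
        = und ?rhs \<cdot>\<^sub>D gen x"
        using far_LM(4) [OF FG] far_LM(4) [OF F(1)] D.Comp_reduce [OF far_LM(4) [OF G(1)], of "far L (und F)"]
        by simp
    qed (use far_LM(1-3) [OF FG] in simp_all)
  }
qed

lemma \<eta>_mon_eq: "\<eta>_mon C D L R \<eta> \<phi> \<phi>\<^sub>0 cL eL x = (x, sharp (Car x) (gen x), Q.RM (LM x))"
  by (simp add: \<eta>_mon_def sharp_def gen_def)

lemma \<epsilon>_mon_arr:
  assumes y [simp]: "is_monoid D y"
  defines "h \<equiv> \<epsilon>_mon C D L R \<epsilon> \<phi> \<phi>\<^sub>0 cL eL y"
  shows "h \<in> Arr (Mon D)" "Dom (Mon D) h = LM (Q.RM y)" "Cod (Mon D) h = y"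
    "und h \<cdot>\<^sub>D gen (Q.RM y) = \<epsilon> (Car y)"
proof -
  let ?t = "free_ext D y (\<epsilon> (Car y))"
  have t: "?t \<in> Arr (Mon D)" "Dom (Mon D) ?t = free_monoid D (fob L (Car (Q.RM y)))"
    "Cod (Mon D) ?t = y" "und ?t \<cdot>\<^sub>D tgen D (fob L (Car (Q.RM y))) = \<epsilon> (Car y)"
    using D.free_ext_arr(1-4) [of y "\<epsilon> (Car y)"] by simp_all
  have m: "is_monoid_map C (Q.RM y) (sharp (Car (Q.RM y)) (und ?t \<cdot>\<^sub>D tgen D (fob L (Car (Q.RM y))))) (Q.RM (Cod (Mon D) ?t))"
    unfolding t(3,4) using C.is_monoid_map_Ide [of "Q.RM y"] by (simp add: sharp_counit del: Rmon_ob_simps(2,3))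
  show "h \<in> Arr (Mon D)" "Dom (Mon D) h = LM (Q.RM y)" "Cod (Mon D) h = y"
    "und h \<cdot>\<^sub>D gen (Q.RM y) = \<epsilon> (Car y)"
    using LM_desc(1-4) [OF _ t(1,2) m refl] unfolding h_def \<epsilon>_mon_def Let_def t(3,4) by simp_all
qed

text \<open>All equations between arrows out of \<open>L\<^sup>m\<^sup>o\<^sup>n X\<close> are tested on \<open>gen\<close>, where they become the
  corresponding equations of the adjunction between \<open>C\<close> and \<open>D\<close>.\<close>

theorem adjunction_Mon:
  "adjunction (Mon C) (Mon D) (Lmon C D L cL eL) (Rmon C R \<phi> \<phi>\<^sub>0)
    (\<eta>_mon C D L R \<eta> \<phi> \<phi>\<^sub>0 cL eL) (\<epsilon>_mon C D L R \<epsilon> \<phi> \<phi>\<^sub>0 cL eL)"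
    (is "adjunction _ _ ?L ?R ?\<eta> ?\<epsilon>")
proof -
  interpret L': cat_functor "Mon C" "Mon D" ?L by (rule cat_functor_Lmon)
  interpret R': lax_monoidal "Mon D" "Mon C" ?R "\<phi>_mon C D R \<phi> \<phi>\<^sub>0" "\<phi>_mon_unit C D R \<phi> \<phi>\<^sub>0"
    by (rule Q.lax_monoidal_Rmon)
  show ?thesis
  proof
    note [simp] = is_monoid_map_sharp_gen
    show "natural (Mon C) (Mon C) id_ftr (comp_ftr ?R ?L) ?\<eta>"
      unfolding natural_def
    proof (intro conjI ballI)
      fix x assume "x \<in> Obj (Mon C)"
      then show "?\<eta> x \<in> hom (Mon C) (fob id_ftr x) (fob (comp_ftr ?R ?L) x)"
        by (simp add: id_ftr_def comp_ftr_def \<eta>_mon_eq)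
    next
      fix F assume F: "F \<in> Arr (Mon C)"
      define x y f where "x = Dom (Mon C) F" and "y = Cod (Mon C) F" and "f = und F"
      have [simp]: "is_monoid C x" "is_monoid C y" using F by (simp_all add: x_def y_def)
      have f [simp]: "f \<in> Arr C" "Dom C f = Car x" "Cod C f = Car y" using F by (simp_all add: x_def y_def f_def)
      have F': "F = (x, f, y)" unfolding x_def y_def f_def by (cases F) simp
      note h = far_LM [OF F, folded x_def y_def f_def]
      have "sharp (Car y) (gen y) \<cdot>\<^sub>C f = sharp (Car x) (gen y \<cdot>\<^sub>D far L f)"
        using sharp_Comp_far [of f "gen y" "Car x"] by simp
      also have "\<dots> = far R (und (far ?L F)) \<cdot>\<^sub>C sharp (Car x) (gen x)"
        unfolding h(4) [symmetric] by (rule sharp_Comp) (simp_all add: h(1-3))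
      finally show "?\<eta> (Cod (Mon C) F) \<cdot>\<^bsub>Mon C\<^esub> far id_ftr F = far (comp_ftr ?R ?L) F \<cdot>\<^bsub>Mon C\<^esub> ?\<eta> (Dom (Mon C) F)"
        using h(1-3) by (simp add: id_ftr_def comp_ftr_def \<eta>_mon_eq Q.far_Rmon F')
    qed
    show "natural (Mon D) (Mon D) (comp_ftr ?L ?R) id_ftr ?\<epsilon>"
      unfolding natural_def
    proof (intro conjI ballI)
      fix y assume "y \<in> Obj (Mon D)"
      then show "?\<epsilon> y \<in> hom (Mon D) (fob (comp_ftr ?L ?R) y) (fob id_ftr y)"
        by (simp add: id_ftr_def comp_ftr_def \<epsilon>_mon_arr)
    next
      fix G assume G: "G \<in> Arr (Mon D)"
      define x y g where "x = Dom (Mon D) G" and "y = Cod (Mon D) G" and "g = und G"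
      have xy [simp]: "is_monoid D x" "is_monoid D y" using G by (simp_all add: x_def y_def)
      have g [simp]: "g \<in> Arr D" "Dom D g = Car x" "Cod D g = Car y" using G by (simp_all add: x_def y_def g_def)
      have RG: "far ?R G \<in> Arr (Mon C)" "Dom (Mon C) (far ?R G) = Q.RM x" "Cod (Mon C) (far ?R G) = Q.RM y"
        "und (far ?R G) = far R g"
        using R'.far_arr [OF G] by (simp_all add: Q.far_Rmon x_def y_def g_def)
      note h = far_LM [OF RG(1), unfolded RG(2-4)] and ex = \<epsilon>_mon_arr [OF xy(1)] and ey = \<epsilon>_mon_arr [OF xy(2)]
      have "?\<epsilon> y \<cdot>\<^bsub>Mon D\<^esub> far ?L (far ?R G) = G \<cdot>\<^bsub>Mon D\<^esub> ?\<epsilon> x"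
      proof (rule LM_ext [of "Q.RM x"])
        have "und (?\<epsilon> y \<cdot>\<^bsub>Mon D\<^esub> far ?L (far ?R G)) \<cdot>\<^sub>D gen (Q.RM x) = und (?\<epsilon> y) \<cdot>\<^sub>D (gen (Q.RM y) \<cdot>\<^sub>D far L (far R g))"
          using h ey(1-3) by simp
        also have "\<dots> = \<epsilon> (Cod D g) \<cdot>\<^sub>D far L (far R g)"
          using ey(1-3) by (subst D.Comp_reduce [OF ey(4)]) simp_all
        also have "\<dots> = g \<cdot>\<^sub>D \<epsilon> (Car x)"
          by (subst counit_nat) simp_all
        finally show "und (?\<epsilon> y \<cdot>\<^bsub>Mon D\<^esub> far ?L (far ?R G)) \<cdot>\<^sub>D gen (Q.RM x) = und (G \<cdot>\<^bsub>Mon D\<^esub> ?\<epsilon> x) \<cdot>\<^sub>D gen (Q.RM x)"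
          using ex by (simp add: g_def [symmetric])
      qed (use h ex ey G in \<open>simp_all add: x_def [symmetric] y_def [symmetric]\<close>)
      then show "?\<epsilon> (Cod (Mon D) G) \<cdot>\<^bsub>Mon D\<^esub> far (comp_ftr ?L ?R) G = far id_ftr G \<cdot>\<^bsub>Mon D\<^esub> ?\<epsilon> (Dom (Mon D) G)"
        by (simp add: id_ftr_def comp_ftr_def x_def y_def)
    qed
    fix x assume "x \<in> Obj (Mon C)"
    then have x [simp]: "is_monoid C x" by simp
    have \<eta>: "?\<eta> x \<in> Arr (Mon C)" "Dom (Mon C) (?\<eta> x) = x" "Cod (Mon C) (?\<eta> x) = Q.RM (LM x)" "und (?\<eta> x) = sharp (Car x) (gen x)"
      by (simp_all add: \<eta>_mon_eq)
    note h = far_LM [OF \<eta>(1), unfolded \<eta>(2-4)] and e = \<epsilon>_mon_arr [of "LM x", OF proj_arr(4) [OF x]]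
    show "?\<epsilon> (LM x) \<cdot>\<^bsub>Mon D\<^esub> far ?L (?\<eta> x) = Ide (Mon D) (LM x)"
    proof (rule LM_ext [of x])
      have "und (?\<epsilon> (LM x) \<cdot>\<^bsub>Mon D\<^esub> far ?L (?\<eta> x)) \<cdot>\<^sub>D gen x = und (?\<epsilon> (LM x)) \<cdot>\<^sub>D (gen (Q.RM (LM x)) \<cdot>\<^sub>D far L (sharp (Car x) (gen x)))"
        using h e(1-3) by simp
      also have "\<dots> = flat (Car (LM x)) (sharp (Car x) (gen x))"
        unfolding flat_def using e(1-3) by (subst D.Comp_reduce [OF e(4)]) simp_all
      finally show "und (?\<epsilon> (LM x) \<cdot>\<^bsub>Mon D\<^esub> far ?L (?\<eta> x)) \<cdot>\<^sub>D gen x = und (Ide (Mon D) (LM x)) \<cdot>\<^sub>D gen x"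
        by simp
    qed (use h e D.Mon.Ide_arr [of "LM x"] in simp_all)
  next
    fix y assume "y \<in> Obj (Mon D)"
    then have y [simp]: "is_monoid D y" by simp
    note e = \<epsilon>_mon_arr [OF y]
    have "far R (und (?\<epsilon> y)) \<cdot>\<^sub>C sharp (Car (Q.RM y)) (gen (Q.RM y)) = sharp (Car (Q.RM y)) (und (?\<epsilon> y) \<cdot>\<^sub>D gen (Q.RM y))"
      using e(1-3) by (intro sharp_Comp [symmetric]) simp_all
    then show "far ?R (?\<epsilon> y) \<cdot>\<^bsub>Mon C\<^esub> ?\<eta> (fob ?R y) = Ide (Mon C) (fob ?R y)"
      using e by (simp add: Q.far_Rmon \<eta>_mon_eq sharp_counit)
  qed
qed

end

section \<open>The colax-monoidal structure from the diagrams\<close>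

context quasi_symmetric_adjunction
begin

lemma cL_nat:
  "\<lbrakk>f \<in> Arr C; g \<in> Arr C; Cod C f = X'; Cod C g = Y'\<rbrakk>
    \<Longrightarrow> cL X' Y' \<cdot>\<^sub>D far L (f \<otimes>\<^sub>a\<^sub>C g) = (far L f \<otimes>\<^sub>a\<^sub>D far L g) \<cdot>\<^sub>D cL (Dom C f) (Dom C g)"
  using colax_monoidal.c_natural [OF colax_monoidal_left_adjoint, of f "Dom C f" X' g "Dom C g" Y'] by simp

text \<open>Splitting \<open>L ((X \<otimes> Y)\<^sup>n)\<close> into factors \<open>L (X \<otimes> Y)\<close> and these into \<open>L X \<otimes> L Y\<close> agrees with first shuffling to \<open>X\<^sup>n \<otimes> Y\<^sup>n\<close>.
  The transposed statement is that the map of monoids \<open>\<phi>\<close> commutes with \<open>n\<close>-fold products, which in a tensor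
  product of monoids are computed by the shuffle.\<close>

lemma mprod_tensor_cL:
  assumes [simp]: "is_monoid D x" "is_monoid D y" "X \<in> Obj C" "Y \<in> Obj C" "f \<in> Arr D" "g \<in> Arr D"
    and f [simp]: "Dom D f = fob L X" "Cod D f = Car x" and g [simp]: "Dom D g = fob L Y" "Cod D g = Car y"
  shows "mprod D (tensor_mnd D x y) ((f \<otimes>\<^sub>a\<^sub>D g) \<cdot>\<^sub>D cL X Y) n \<cdot>\<^sub>D cLs (X \<otimes>\<^sub>C Y) n
    = ((mprod D x f n \<cdot>\<^sub>D cLs X n) \<otimes>\<^sub>a\<^sub>D (mprod D y g n \<cdot>\<^sub>D cLs Y n)) \<cdot>\<^sub>D
      (cL (tpow C X n) (tpow C Y n) \<cdot>\<^sub>D far L (tpow_shuffle C X Y n))"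
proof -
  define f' g' where "f' = sharp X f" and "g' = sharp Y g"
  have [simp]: "f' \<in> Arr C" "Dom C f' = X" "Cod C f' = fob R (Car x)" "flat (Car x) f' = f"
    "g' \<in> Arr C" "Dom C g' = Y" "Cod C g' = fob R (Car y)" "flat (Car y) g' = g"
    by (simp_all add: f'_def g'_def)
  let ?\<phi> = "\<phi> (Car x) (Car y)"
  have "mprod D (tensor_mnd D x y) ((f \<otimes>\<^sub>a\<^sub>D g) \<cdot>\<^sub>D cL X Y) n \<cdot>\<^sub>D cLs (X \<otimes>\<^sub>C Y) n
    = flat (Car x \<otimes>\<^sub>D Car y) (mprod C (Q.RM (tensor_mnd D x y)) (?\<phi> \<cdot>\<^sub>C (f' \<otimes>\<^sub>a\<^sub>C g')) n)"
    using flat_mprod [of "tensor_mnd D x y" "?\<phi> \<cdot>\<^sub>C (f' \<otimes>\<^sub>a\<^sub>C g')" n] by (simp add: flat_\<phi>)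
  also have "mprod C (Q.RM (tensor_mnd D x y)) (?\<phi> \<cdot>\<^sub>C (f' \<otimes>\<^sub>a\<^sub>C g')) n
    = ?\<phi> \<cdot>\<^sub>C mprod C (tensor_mnd C (Q.RM x) (Q.RM y)) (f' \<otimes>\<^sub>a\<^sub>C g') n"
    by (rule C.mprod_map [symmetric, OF _ _ Q.is_monoid_map_\<phi>]) simp_all
  also have "\<dots> = (?\<phi> \<cdot>\<^sub>C (mprod C (Q.RM x) f' n \<otimes>\<^sub>a\<^sub>C mprod C (Q.RM y) g' n)) \<cdot>\<^sub>C tpow_shuffle C X Y n"
    by (simp add: C.mprod_tensor)
  also have "flat (Car x \<otimes>\<^sub>D Car y) \<dots>
    = flat (Car x \<otimes>\<^sub>D Car y) (?\<phi> \<cdot>\<^sub>C (mprod C (Q.RM x) f' n \<otimes>\<^sub>a\<^sub>C mprod C (Q.RM y) g' n)) \<cdot>\<^sub>D far L (tpow_shuffle C X Y n)"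
    by (subst flat_Comp) simp_all
  also have "\<dots> = ((mprod D x f n \<cdot>\<^sub>D cLs X n) \<otimes>\<^sub>a\<^sub>D (mprod D y g n \<cdot>\<^sub>D cLs Y n)) \<cdot>\<^sub>D
      (cL (tpow C X n) (tpow C Y n) \<cdot>\<^sub>D far L (tpow_shuffle C X Y n))"
    by (subst flat_\<phi>) (simp_all add: flat_mprod)
  finally show ?thesis .
qed

lemma \<Psi>''_arr [simp]:
  assumes [simp]: "is_monoid C x" "is_monoid C y"
  shows "\<Psi>'' D L cL x y \<in> Arr (Mon D)"
    "Dom (Mon D) (\<Psi>'' D L cL x y) = free_monoid D (fob L (Car x \<otimes>\<^sub>C Car y))"
    "Cod (Mon D) (\<Psi>'' D L cL x y) = tensor_mnd D (free_monoid D (fob L (Car x))) (free_monoid D (fob L (Car y)))"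
    "und (\<Psi>'' D L cL x y) \<cdot>\<^sub>D tgen D (fob L (Car x \<otimes>\<^sub>C Car y))
      = (tgen D (fob L (Car x)) \<otimes>\<^sub>a\<^sub>D tgen D (fob L (Car y))) \<cdot>\<^sub>D cL (Car x) (Car y)"
proof -
  show "\<Psi>'' D L cL x y \<in> Arr (Mon D)"
    "Dom (Mon D) (\<Psi>'' D L cL x y) = free_monoid D (fob L (Car x \<otimes>\<^sub>C Car y))"
    "Cod (Mon D) (\<Psi>'' D L cL x y) = tensor_mnd D (free_monoid D (fob L (Car x))) (free_monoid D (fob L (Car y)))"
    by (simp_all add: \<Psi>''_def)
  show "und (\<Psi>'' D L cL x y) \<cdot>\<^sub>D tgen D (fob L (Car x \<otimes>\<^sub>C Car y))
      = (tgen D (fob L (Car x)) \<otimes>\<^sub>a\<^sub>D tgen D (fob L (Car y))) \<cdot>\<^sub>D cL (Car x) (Car y)"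
    using D.Tmap_arr(4) [of "cL (Car x) (Car y)"]
    by (simp add: \<Psi>''_def D.Comp_reduce [OF D.\<theta>_arr(5)] del: D.tar_Comp' D.tar_Comp_Comp)
qed

lemma \<Psi>'_arr [simp]:
  assumes [simp]: "is_monoid C x" "is_monoid C y"
  defines "X \<equiv> TC C (Car x)" and "Y \<equiv> TC C (Car y)" and "Z \<equiv> fob L (TC C (Car x \<otimes>\<^sub>C Car y))"
  shows "\<Psi>' C D L cL x y \<in> Arr (Mon D)"
    "Dom (Mon D) (\<Psi>' C D L cL x y) = free_monoid D Z"
    "Cod (Mon D) (\<Psi>' C D L cL x y) = tensor_mnd D (free_monoid D (fob L X)) (free_monoid D (fob L Y))"
    "und (\<Psi>' C D L cL x y) \<cdot>\<^sub>D tgen D Z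
      = (tgen D (fob L X) \<otimes>\<^sub>a\<^sub>D tgen D (fob L Y)) \<cdot>\<^sub>D (cL X Y \<cdot>\<^sub>D far L (und (\<theta> C (Car x) (Car y))))"
proof -
  have [simp]: "X \<in> Obj C" "Y \<in> Obj C" by (simp_all add: X_def Y_def)
  define t where "t = und (\<theta> C (Car x) (Car y))"
  have t [simp]: "t \<in> Arr C" "Dom C t = TC C (Car x \<otimes>\<^sub>C Car y)" "Cod C t = X \<otimes>\<^sub>C Y"
    by (simp_all add: t_def X_def Y_def)
  have P: "\<Psi>' C D L cL x y = \<theta> D (fob L X) (fob L Y) \<cdot>\<^bsub>Mon D\<^esub> (Tmap D (cL X Y) \<cdot>\<^bsub>Mon D\<^esub> Tmap D (far L t))"
    by (simp add: \<Psi>'_def X_def Y_def t_def)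
  show "\<Psi>' C D L cL x y \<in> Arr (Mon D)"
    "Dom (Mon D) (\<Psi>' C D L cL x y) = free_monoid D Z"
    "Cod (Mon D) (\<Psi>' C D L cL x y) = tensor_mnd D (free_monoid D (fob L X)) (free_monoid D (fob L Y))"
    unfolding P by (simp_all add: Z_def)
  have 1: "und (Tmap D (far L t)) \<cdot>\<^sub>D tgen D Z = tgen D (fob L (X \<otimes>\<^sub>C Y)) \<cdot>\<^sub>D far L t"
    using D.Tmap_arr(4) [of "far L t"] by (simp add: Z_def)
  have 2: "und (Tmap D (cL X Y)) \<cdot>\<^sub>D tgen D (fob L (X \<otimes>\<^sub>C Y)) = tgen D (fob L X \<otimes>\<^sub>D fob L Y) \<cdot>\<^sub>D cL X Y"
    using D.Tmap_arr(4) [of "cL X Y"] by simp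
  have "und (\<Psi>' C D L cL x y) \<cdot>\<^sub>D tgen D Z
    = und (\<theta> D (fob L X) (fob L Y)) \<cdot>\<^sub>D (und (Tmap D (cL X Y)) \<cdot>\<^sub>D (und (Tmap D (far L t)) \<cdot>\<^sub>D tgen D Z))"
    unfolding P by (simp add: Z_def)
  also have "\<dots> = und (\<theta> D (fob L X) (fob L Y)) \<cdot>\<^sub>D (tgen D (fob L X \<otimes>\<^sub>D fob L Y) \<cdot>\<^sub>D (cL X Y \<cdot>\<^sub>D far L t))"
    unfolding 1 by (simp add: D.Comp_reduce [OF 2])
  also have "\<dots> = (tgen D (fob L X) \<otimes>\<^sub>a\<^sub>D tgen D (fob L Y)) \<cdot>\<^sub>D (cL X Y \<cdot>\<^sub>D far L t)"
    by (subst D.Comp_reduce [OF D.\<theta>_arr(5)]) simp_all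
  finally show "und (\<Psi>' C D L cL x y) \<cdot>\<^sub>D tgen D Z
      = (tgen D (fob L X) \<otimes>\<^sub>a\<^sub>D tgen D (fob L Y)) \<cdot>\<^sub>D (cL X Y \<cdot>\<^sub>D far L (und (\<theta> C (Car x) (Car y))))"
    unfolding t_def .
qed

text \<open>Both sides are monoid maps \<open>T (X \<otimes> Y) \<rightarrow> X \<otimes> Y\<close> restricting to the identity on generators.\<close>

lemma product_map_\<theta>:
  assumes [simp]: "is_monoid C x" "is_monoid C y"
  shows "(und (product_map C x) \<otimes>\<^sub>a\<^sub>C und (product_map C y)) \<cdot>\<^sub>C und (\<theta> C (Car x) (Car y))
    = und (product_map C (tensor_mnd C x y))"
proof -
  have "(product_map C x \<otimes>\<^sub>a\<^bsub>Mon C\<^esub> product_map C y) \<cdot>\<^bsub>Mon C\<^esub> \<theta> C (Car x) (Car y) = product_map C (tensor_mnd C x y)"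
  proof (rule C.free_Mon_eqI [of "Car x \<otimes>\<^sub>C Car y"])
    show "und ((product_map C x \<otimes>\<^sub>a\<^bsub>Mon C\<^esub> product_map C y) \<cdot>\<^bsub>Mon C\<^esub> \<theta> C (Car x) (Car y)) \<cdot>\<^sub>C tgen C (Car x \<otimes>\<^sub>C Car y)
      = und (product_map C (tensor_mnd C x y)) \<cdot>\<^sub>C tgen C (Car x \<otimes>\<^sub>C Car y)"
      using C.product_map_arr(4) [of "tensor_mnd C x y"] by simp
  qed simp_all
  from arg_cong [OF this, of und] show ?thesis by simp
qed

text \<open>On generators, this is naturality of \<open>c\<close> for the two product maps, together with \<open>product_map_\<theta>\<close>.\<close>

lemma \<alpha>\<alpha>_\<Psi>':
  assumes [simp]: "is_monoid C x" "is_monoid C y"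
  shows "\<alpha>\<alpha> C D L x y \<cdot>\<^bsub>Mon D\<^esub> \<Psi>' C D L cL x y = \<Psi>'' D L cL x y \<cdot>\<^bsub>Mon D\<^esub> \<alpha> C D L (tensor_mnd C x y)" (is "?lhs = ?rhs")
proof (rule D.free_Mon_eqI [of "fob L (TC C (Car x \<otimes>\<^sub>C Car y))"])
  define mx my t where "mx = und (product_map C x)" and "my = und (product_map C y)" and "t = und (\<theta> C (Car x) (Car y))"
  have [simp]: "mx \<in> Arr C" "Dom C mx = TC C (Car x)" "Cod C mx = Car x"
    "my \<in> Arr C" "Dom C my = TC C (Car y)" "Cod C my = Car y"
    "t \<in> Arr C" "Dom C t = TC C (Car x \<otimes>\<^sub>C Car y)" "Cod C t = TC C (Car x) \<otimes>\<^sub>C TC C (Car y)"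
    by (simp_all add: mx_def my_def t_def)
  let ?gx = "tgen D (fob L (Car x))" and ?gy = "tgen D (fob L (Car y))"
  let ?Z = "fob L (TC C (Car x \<otimes>\<^sub>C Car y))"
  have "und ?lhs \<cdot>\<^sub>D tgen D ?Z
    = (und (\<alpha> C D L x) \<otimes>\<^sub>a\<^sub>D und (\<alpha> C D L y)) \<cdot>\<^sub>D ((tgen D (fob L (TC C (Car x))) \<otimes>\<^sub>a\<^sub>D tgen D (fob L (TC C (Car y)))) \<cdot>\<^sub>D
        (cL (TC C (Car x)) (TC C (Car y)) \<cdot>\<^sub>D far L t))"
    by (simp add: \<alpha>\<alpha>_def t_def del: D.tar_Comp' D.tar_Comp_Comp)
  also have "\<dots> = (?gx \<otimes>\<^sub>a\<^sub>D ?gy) \<cdot>\<^sub>D (((far L mx \<otimes>\<^sub>a\<^sub>D far L my) \<cdot>\<^sub>D cL (TC C (Car x)) (TC C (Car y))) \<cdot>\<^sub>D far L t)"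
    by (simp add: mx_def my_def)
  also have "\<dots> = (?gx \<otimes>\<^sub>a\<^sub>D ?gy) \<cdot>\<^sub>D ((cL (Car x) (Car y) \<cdot>\<^sub>D far L (mx \<otimes>\<^sub>a\<^sub>C my)) \<cdot>\<^sub>D far L t)"
    by (subst cL_nat) simp_all
  also have "\<dots> = (?gx \<otimes>\<^sub>a\<^sub>D ?gy) \<cdot>\<^sub>D (cL (Car x) (Car y) \<cdot>\<^sub>D far L ((mx \<otimes>\<^sub>a\<^sub>C my) \<cdot>\<^sub>C t))"
    by simp
  also have "(mx \<otimes>\<^sub>a\<^sub>C my) \<cdot>\<^sub>C t = und (product_map C (tensor_mnd C x y))"
    unfolding mx_def my_def t_def by (rule product_map_\<theta>) simp_all
  also have "(?gx \<otimes>\<^sub>a\<^sub>D ?gy) \<cdot>\<^sub>D (cL (Car x) (Car y) \<cdot>\<^sub>D far L (und (product_map C (tensor_mnd C x y))))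
    = und (\<Psi>'' D L cL x y) \<cdot>\<^sub>D (tgen D (fob L (Car x \<otimes>\<^sub>C Car y)) \<cdot>\<^sub>D far L (und (product_map C (tensor_mnd C x y))))"
    by (subst D.Comp_reduce [OF \<Psi>''_arr(4)]) simp_all
  also have "\<dots> = und ?rhs \<cdot>\<^sub>D tgen D ?Z"
    using \<alpha>_arr(4) [of "tensor_mnd C x y"] by simp
  finally show "und ?lhs \<cdot>\<^sub>D tgen D ?Z
    = und ?rhs \<cdot>\<^sub>D tgen D ?Z" .
qed (simp_all add: \<alpha>\<alpha>_def)

text \<open>On the summand \<open>L ((X \<otimes> Y)\<^sup>n)\<close> of the generators this is \<open>mprod_tensor_cL\<close> for the inclusions of the generators
  \<open>L X\<close> and \<open>L Y\<close>.\<close>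

lemma \<beta>\<beta>_\<Psi>':
  assumes [simp]: "is_monoid C x" "is_monoid C y"
  shows "\<beta>\<beta> C D L cL eL x y \<cdot>\<^bsub>Mon D\<^esub> \<Psi>' C D L cL x y = \<Psi>'' D L cL x y \<cdot>\<^bsub>Mon D\<^esub> \<beta> C D L cL eL (tensor_mnd C x y)" (is "?lhs = ?rhs")
proof (rule D.free_Mon_eqI [of "fob L (TC C (Car x \<otimes>\<^sub>C Car y))"])
  define X Y where "X = Car x" and "Y = Car y"
  have [simp]: "X \<in> Obj C" "Y \<in> Obj C" by (simp_all add: X_def Y_def)
  note \<beta>_gen_arr [simp]
  define bx bY b t where "bx = \<beta>_gen C D L cL eL X" and "bY = \<beta>_gen C D L cL eL Y"
    and "b = \<beta>_gen C D L cL eL (X \<otimes>\<^sub>C Y)" and "t = und (\<theta> C X Y)"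
  have [simp]: "bx \<in> Arr D" "Dom D bx = fob L (TC C X)" "Cod D bx = TC D (fob L X)"
    "bY \<in> Arr D" "Dom D bY = fob L (TC C Y)" "Cod D bY = TC D (fob L Y)"
    "b \<in> Arr D" "Dom D b = fob L (TC C (X \<otimes>\<^sub>C Y))" "Cod D b = TC D (fob L (X \<otimes>\<^sub>C Y))"
    "t \<in> Arr C" "Dom C t = TC C (X \<otimes>\<^sub>C Y)" "Cod C t = TC C X \<otimes>\<^sub>C TC C Y"
    by (simp_all add: bx_def bY_def b_def t_def)
  let ?Tx = "free_monoid D (fob L X)" and ?Ty = "free_monoid D (fob L Y)"
  let ?p = "und (\<Psi>'' D L cL x y)"
  have p [simp]: "?p \<in> Arr D" "Dom D ?p = TC D (fob L (X \<otimes>\<^sub>C Y))" "Cod D ?p = TC D (fob L X) \<otimes>\<^sub>D TC D (fob L Y)"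
    by (simp_all add: X_def Y_def)
  have "(bx \<otimes>\<^sub>a\<^sub>D bY) \<cdot>\<^sub>D (cL (TC C X) (TC C Y) \<cdot>\<^sub>D far L t) = ?p \<cdot>\<^sub>D b"
  proof (rule L_TC_ext [of "X \<otimes>\<^sub>C Y"])
    fix n
    let ?s = "tpow_shuffle C X Y n" and ?ix = "tinj C X n" and ?iy = "tinj C Y n"
    have "((bx \<otimes>\<^sub>a\<^sub>D bY) \<cdot>\<^sub>D (cL (TC C X) (TC C Y) \<cdot>\<^sub>D far L t)) \<cdot>\<^sub>D far L (tinj C (X \<otimes>\<^sub>C Y) n)
      = (bx \<otimes>\<^sub>a\<^sub>D bY) \<cdot>\<^sub>D (cL (TC C X) (TC C Y) \<cdot>\<^sub>D far L (t \<cdot>\<^sub>C tinj C (X \<otimes>\<^sub>C Y) n))"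
      by simp
    also have "t \<cdot>\<^sub>C tinj C (X \<otimes>\<^sub>C Y) n = (?ix \<otimes>\<^sub>a\<^sub>C ?iy) \<cdot>\<^sub>C ?s"
      by (simp add: t_def)
    also have "(bx \<otimes>\<^sub>a\<^sub>D bY) \<cdot>\<^sub>D (cL (TC C X) (TC C Y) \<cdot>\<^sub>D far L ((?ix \<otimes>\<^sub>a\<^sub>C ?iy) \<cdot>\<^sub>C ?s))
      = (bx \<otimes>\<^sub>a\<^sub>D bY) \<cdot>\<^sub>D ((cL (TC C X) (TC C Y) \<cdot>\<^sub>D far L (?ix \<otimes>\<^sub>a\<^sub>C ?iy)) \<cdot>\<^sub>D far L ?s)"
      by simp
    also have "\<dots> = ((bx \<cdot>\<^sub>D far L ?ix) \<otimes>\<^sub>a\<^sub>D (bY \<cdot>\<^sub>D far L ?iy)) \<cdot>\<^sub>D (cL (tpow C X n) (tpow C Y n) \<cdot>\<^sub>D far L ?s)"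
      by (subst cL_nat) simp_all
    also have "\<dots> = ((tinj D (fob L X) n \<cdot>\<^sub>D cLs X n) \<otimes>\<^sub>a\<^sub>D (tinj D (fob L Y) n \<cdot>\<^sub>D cLs Y n)) \<cdot>\<^sub>D
        (cL (tpow C X n) (tpow C Y n) \<cdot>\<^sub>D far L ?s)"
      by (simp add: bx_def bY_def)
    also have "\<dots> = mprod D (tensor_mnd D ?Tx ?Ty) ((tgen D (fob L X) \<otimes>\<^sub>a\<^sub>D tgen D (fob L Y)) \<cdot>\<^sub>D cL X Y) n \<cdot>\<^sub>D cLs (X \<otimes>\<^sub>C Y) n"
      using mprod_tensor_cL [of ?Tx ?Ty X Y "tgen D (fob L X)" "tgen D (fob L Y)" n] by (simp add: D.mprod_tgen)
    also have "mprod D (tensor_mnd D ?Tx ?Ty) ((tgen D (fob L X) \<otimes>\<^sub>a\<^sub>D tgen D (fob L Y)) \<cdot>\<^sub>D cL X Y) n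
      = ?p \<cdot>\<^sub>D tinj D (fob L (X \<otimes>\<^sub>C Y)) n"
    proof -
      have "is_monoid_map D (free_monoid D (fob L (X \<otimes>\<^sub>C Y))) ?p (tensor_mnd D ?Tx ?Ty)"
        using D.Mon_is_monoid_map [OF \<Psi>''_arr(1) [of x y]] by (simp add: X_def Y_def)
      from D.free_map_tinj [OF _ _ this, of n] show ?thesis
        using \<Psi>''_arr(4) [of x y] by (simp add: X_def Y_def)
    qed
    finally show "((bx \<otimes>\<^sub>a\<^sub>D bY) \<cdot>\<^sub>D (cL (TC C X) (TC C Y) \<cdot>\<^sub>D far L t)) \<cdot>\<^sub>D far L (tinj C (X \<otimes>\<^sub>C Y) n)
      = (?p \<cdot>\<^sub>D b) \<cdot>\<^sub>D far L (tinj C (X \<otimes>\<^sub>C Y) n)"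
      by (simp add: b_def)
  qed simp_all
  moreover have "und ?lhs \<cdot>\<^sub>D tgen D (fob L (TC C (Car x \<otimes>\<^sub>C Car y)))
    = (bx \<otimes>\<^sub>a\<^sub>D bY) \<cdot>\<^sub>D (cL (TC C X) (TC C Y) \<cdot>\<^sub>D far L t)"
    by (simp add: \<beta>\<beta>_def bx_def bY_def t_def X_def Y_def)
  moreover have "und ?rhs \<cdot>\<^sub>D tgen D (fob L (TC C (Car x \<otimes>\<^sub>C Car y)))
    = ?p \<cdot>\<^sub>D b"
    using \<beta>_arr(4) [of "tensor_mnd C x y"] by (simp add: b_def X_def Y_def)
  ultimately show "und ?lhs \<cdot>\<^sub>D tgen D (fob L (TC C (Car x \<otimes>\<^sub>C Car y)))
    = und ?rhs \<cdot>\<^sub>D tgen D (fob L (TC C (Car x \<otimes>\<^sub>C Car y)))"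
    by simp
qed (simp_all add: \<beta>\<beta>_def)

end

locale monoid_left_adjoint_tensor = monoid_left_adjoint C D L R \<eta> \<epsilon> \<phi> \<phi>\<^sub>0
  for C :: "('o, 'a, 'm) smcat_scheme" and D :: "('p, 'b, 'n) smcat_scheme"
    and L :: "('o, 'a, 'p, 'b) ftr" and R :: "('p, 'b, 'o, 'a) ftr"
    and \<eta> :: "'o \<Rightarrow> 'a" and \<epsilon> :: "'p \<Rightarrow> 'b"
    and \<phi> :: "'p \<Rightarrow> 'p \<Rightarrow> 'a" and \<phi>\<^sub>0 :: "'a" +
  assumes coequalizers_tensor: "\<lbrakk>is_monoid C x; is_monoid C y\<rbrakk> \<Longrightarrow>
    \<exists>q. is_coequalizer (Mon D) (\<alpha>\<alpha> C D L x y) (\<beta>\<beta> C D L cL eL x y) q"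
begin

text \<open>Composed with the universal map, \<open>\<Theta>\<close> is \<open>\<Psi>''\<close> followed by the tensor product of the universal maps; on the
  generators \<open>\<Psi>''\<close> is \<open>c\<close>.\<close>

lemma \<Theta>_arr:
  assumes x [simp]: "is_monoid C x" and y [simp]: "is_monoid C y"
  shows "\<Theta> C D L cL eL x y \<in> Arr (Mon D)" "Dom (Mon D) (\<Theta> C D L cL eL x y) = LM (tensor_mnd C x y)"
    "Cod (Mon D) (\<Theta> C D L cL eL x y) = tensor_mnd D (LM x) (LM y)"
    "und (\<Theta> C D L cL eL x y) \<cdot>\<^sub>D gen (tensor_mnd C x y) = (gen x \<otimes>\<^sub>a\<^sub>D gen y) \<cdot>\<^sub>D cL (Car x) (Car y)"
proof -
  let ?xy = "tensor_mnd C x y"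
  let ?\<alpha>\<alpha> = "\<alpha>\<alpha> C D L x y" and ?\<beta>\<beta> = "\<beta>\<beta> C D L cL eL x y" and ?\<Psi>' = "\<Psi>' C D L cL x y" and ?\<Psi>'' = "\<Psi>'' D L cL x y"
  define Q where "Q = coeq (Mon D) ?\<alpha>\<alpha> ?\<beta>\<beta>"
  have coeq: "is_coequalizer (Mon D) ?\<alpha>\<alpha> ?\<beta>\<beta> Q"
    unfolding Q_def by (rule D.Mon.is_coequalizer_coeq [OF coequalizers_tensor [OF x y]])
  note q = D.Mon.is_coequalizer_arr [OF coeq]
  have \<alpha>\<alpha> [simp]: "?\<alpha>\<alpha> \<in> Arr (Mon D)"
    "Dom (Mon D) ?\<alpha>\<alpha> = tensor_mnd D (free_monoid D (fob L (TC C (Car x)))) (free_monoid D (fob L (TC C (Car y))))"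
    "Cod (Mon D) ?\<alpha>\<alpha> = tensor_mnd D (free_monoid D (fob L (Car x))) (free_monoid D (fob L (Car y)))"
    by (simp_all add: \<alpha>\<alpha>_def)
  have \<beta>\<beta> [simp]: "?\<beta>\<beta> \<in> Arr (Mon D)" "Dom (Mon D) ?\<beta>\<beta> = Dom (Mon D) ?\<alpha>\<alpha>" "Cod (Mon D) ?\<beta>\<beta> = Cod (Mon D) ?\<alpha>\<alpha>"
    by (simp_all add: \<beta>\<beta>_def \<alpha>\<alpha>_def)
  have Q [simp]: "Q \<in> Arr (Mon D)" "Dom (Mon D) Q = tensor_mnd D (free_monoid D (fob L (Car x))) (free_monoid D (fob L (Car y)))"
    using q(3,6) by simp_all
  define P where "P = proj x \<otimes>\<^sub>a\<^bsub>Mon D\<^esub> proj y"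
  have P [simp]: "P \<in> Arr (Mon D)" "Dom (Mon D) P = tensor_mnd D (free_monoid D (fob L (Car x))) (free_monoid D (fob L (Car y)))"
    "Cod (Mon D) P = tensor_mnd D (LM x) (LM y)"
    by (simp_all add: P_def)
  have eq: "proj z \<cdot>\<^bsub>Mon D\<^esub> \<alpha> C D L z = proj z \<cdot>\<^bsub>Mon D\<^esub> \<beta> C D L cL eL z" if "is_monoid C z" for z
    by (rule D.Mon.is_coequalizer_arr(7) [OF is_coequalizer_proj [OF that]])
  have P\<alpha>: "P \<cdot>\<^bsub>Mon D\<^esub> ?\<alpha>\<alpha> = (proj x \<cdot>\<^bsub>Mon D\<^esub> \<alpha> C D L x) \<otimes>\<^sub>a\<^bsub>Mon D\<^esub> (proj y \<cdot>\<^bsub>Mon D\<^esub> \<alpha> C D L y)"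
    by (simp add: P_def \<alpha>\<alpha>_def)
  also have "\<dots> = P \<cdot>\<^bsub>Mon D\<^esub> ?\<beta>\<beta>"
    unfolding eq [OF x] eq [OF y] by (simp add: P_def \<beta>\<beta>_def)
  finally have P\<alpha>\<beta>: "P \<cdot>\<^bsub>Mon D\<^esub> ?\<alpha>\<alpha> = P \<cdot>\<^bsub>Mon D\<^esub> ?\<beta>\<beta>" .
  have d: "Dom (Mon D) P = Cod (Mon D) ?\<alpha>\<alpha>" by simp
  note i = D.Mon.coeq_desc_arr [OF coeq [unfolded Q_def] P(1) d P\<alpha>\<beta> P\<alpha> [symmetric], folded Q_def,
      folded i_map_def [of C D L cL eL x y, folded P_def]]
  have \<Psi>\<alpha>: "(Q \<cdot>\<^bsub>Mon D\<^esub> ?\<alpha>\<alpha>) \<cdot>\<^bsub>Mon D\<^esub> ?\<Psi>' = (Q \<cdot>\<^bsub>Mon D\<^esub> ?\<Psi>'') \<cdot>\<^bsub>Mon D\<^esub> \<alpha> C D L ?xy"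
    by (simp add: \<alpha>\<alpha>_\<Psi>')
  also have "Q \<cdot>\<^bsub>Mon D\<^esub> ?\<alpha>\<alpha> = Q \<cdot>\<^bsub>Mon D\<^esub> ?\<beta>\<beta>" by (rule q(7))
  also have "(Q \<cdot>\<^bsub>Mon D\<^esub> ?\<beta>\<beta>) \<cdot>\<^bsub>Mon D\<^esub> ?\<Psi>' = (Q \<cdot>\<^bsub>Mon D\<^esub> ?\<Psi>'') \<cdot>\<^bsub>Mon D\<^esub> \<beta> C D L cL eL ?xy"
    by (simp add: \<beta>\<beta>_\<Psi>')
  finally have \<Psi>\<alpha>\<beta>: "(Q \<cdot>\<^bsub>Mon D\<^esub> ?\<Psi>'') \<cdot>\<^bsub>Mon D\<^esub> \<alpha> C D L ?xy = (Q \<cdot>\<^bsub>Mon D\<^esub> ?\<Psi>'') \<cdot>\<^bsub>Mon D\<^esub> \<beta> C D L cL eL ?xy" ..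
  have t: "Q \<cdot>\<^bsub>Mon D\<^esub> ?\<Psi>'' \<in> Arr (Mon D)" "Dom (Mon D) (Q \<cdot>\<^bsub>Mon D\<^esub> ?\<Psi>'') = Cod (Mon D) (\<alpha> C D L ?xy)"
    by simp_all
  have xy: "is_monoid C ?xy" by simp
  note \<psi> = D.Mon.coeq_desc_arr [OF is_coequalizer_proj [OF xy, unfolded Lmon_proj_def] t \<Psi>\<alpha>\<beta> \<Psi>\<alpha>,
      folded coeq_map_def Lmon_proj_def]
  have \<Psi>: "\<Psi> C D L cL eL x y = coeq_desc (Mon D) (\<alpha> C D L ?xy) (\<beta> C D L cL eL ?xy)
      ((Q \<cdot>\<^bsub>Mon D\<^esub> ?\<alpha>\<alpha>) \<cdot>\<^bsub>Mon D\<^esub> ?\<Psi>') (Q \<cdot>\<^bsub>Mon D\<^esub> ?\<Psi>'')"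
    by (simp add: \<Psi>_def coeq_map_def Q_def)
  note \<psi>' = \<psi> [folded \<Psi>]
  have \<Psi>_arr [simp]: "\<Psi> C D L cL eL x y \<in> Arr (Mon D)" "Dom (Mon D) (\<Psi> C D L cL eL x y) = LM ?xy"
    "Cod (Mon D) (\<Psi> C D L cL eL x y) = Cod (Mon D) Q"
    using \<psi>' by simp_all
  show \<Theta>: "\<Theta> C D L cL eL x y \<in> Arr (Mon D)" "Dom (Mon D) (\<Theta> C D L cL eL x y) = LM ?xy"
    "Cod (Mon D) (\<Theta> C D L cL eL x y) = tensor_mnd D (LM x) (LM y)"
    using i by (simp_all add: \<Theta>_def)
  have "\<Theta> C D L cL eL x y \<cdot>\<^bsub>Mon D\<^esub> proj ?xy = i_map C D L cL eL x y \<cdot>\<^bsub>Mon D\<^esub> (Q \<cdot>\<^bsub>Mon D\<^esub> ?\<Psi>'')"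
    using i(1-3) \<psi>'(4) by (simp add: \<Theta>_def)
  also have "\<dots> = P \<cdot>\<^bsub>Mon D\<^esub> ?\<Psi>''"
    by (rule D.Mon.Comp_reduce [OF i(4)]) (use i(1-3) in simp_all)
  finally have \<Theta>p: "\<Theta> C D L cL eL x y \<cdot>\<^bsub>Mon D\<^esub> proj ?xy = P \<cdot>\<^bsub>Mon D\<^esub> ?\<Psi>''" .
  have "und (\<Theta> C D L cL eL x y) \<cdot>\<^sub>D gen ?xy
    = und (\<Theta> C D L cL eL x y \<cdot>\<^bsub>Mon D\<^esub> proj ?xy) \<cdot>\<^sub>D tgen D (fob L (Car x \<otimes>\<^sub>C Car y))"
    using \<Theta> proj_arr [OF xy] by (simp add: gen_def)
  also have "\<dots> = (und (proj x) \<otimes>\<^sub>a\<^sub>D und (proj y)) \<cdot>\<^sub>D (und ?\<Psi>'' \<cdot>\<^sub>D tgen D (fob L (Car x \<otimes>\<^sub>C Car y)))"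
    unfolding \<Theta>p by (simp add: P_def del: \<Psi>''_arr(4))
  also have "\<dots> = (gen x \<otimes>\<^sub>a\<^sub>D gen y) \<cdot>\<^sub>D cL (Car x) (Car y)"
    by (simp add: gen_def)
  finally show "und (\<Theta> C D L cL eL x y) \<cdot>\<^sub>D gen ?xy = (gen x \<otimes>\<^sub>a\<^sub>D gen y) \<cdot>\<^sub>D cL (Car x) (Car y)" .
qed

end

sublocale monoid_left_adjoint \<subseteq> MA: lax_adjunction "Mon C" "Mon D" "Lmon C D L cL eL" "Rmon C R \<phi> \<phi>\<^sub>0"
  "\<eta>_mon C D L R \<eta> \<phi> \<phi>\<^sub>0 cL eL" "\<epsilon>_mon C D L R \<epsilon> \<phi> \<phi>\<^sub>0 cL eL" "\<phi>_mon C D R \<phi> \<phi>\<^sub>0" "\<phi>_mon_unit C D R \<phi> \<phi>\<^sub>0"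
  by (intro lax_adjunction.intro adjunction_Mon Q.lax_monoidal_Rmon)

context monoid_left_adjoint_tensor
begin

text \<open>The unit of the adjunction on monoids is the transpose of \<open>gen\<close>, so the restriction of the adjoint structure to
  generators is computed by \<open>flat_\<phi>\<close> and agrees with that of \<open>\<Theta>\<close>.\<close>

theorem \<Theta>_eq_adjoint:
  assumes x [simp]: "is_monoid C x" and y [simp]: "is_monoid C y"
  shows "\<Theta> C D L cL eL x y = MA.cL x y" (is "?lhs = _")
proof (rule LM_ext [of "tensor_mnd C x y"])
  let ?xy = "tensor_mnd C x y"
  have cL: "MA.cL x y \<in> Arr (Mon D)" "Dom (Mon D) (MA.cL x y) = LM ?xy" "Cod (Mon D) (MA.cL x y) = tensor_mnd D (LM x) (LM y)"
    using MA.cL_arr [of x y] by simp_all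
  show "is_monoid C ?xy" by simp
  show "\<Theta> C D L cL eL x y \<in> Arr (Mon D)" "Dom (Mon D) ?lhs = LM ?xy"
    "MA.cL x y \<in> Arr (Mon D)" "Dom (Mon D) (MA.cL x y) = LM ?xy"
    "Cod (Mon D) ?lhs = Cod (Mon D) (MA.cL x y)"
    by (simp_all add: cL \<Theta>_arr)
  have xy [simp]: "is_monoid D (LM ?xy)" "is_monoid D (LM x)" "is_monoid D (LM y)"
    by (rule proj_arr, simp)+
  let ?g = "sharp (Car x) (gen x)" and ?h = "sharp (Car y) (gen y)"
  show "und ?lhs \<cdot>\<^sub>D gen ?xy = und (MA.cL x y) \<cdot>\<^sub>D gen ?xy" (is "?l1 = ?r1")
  proof (rule sharp_inject [of "Car ?xy"])
    have "sharp (Car ?xy) ?r1 = far R (und (MA.cL x y)) \<cdot>\<^sub>C sharp (Car ?xy) (gen ?xy)"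
      using cL by (intro sharp_Comp) simp_all
    also have "\<dots> = und (MA.sharp ?xy (MA.cL x y))"
      by (simp add: MA.sharp_def \<eta>_mon_eq Q.far_Rmon)
    also have "MA.sharp ?xy (MA.cL x y) = \<phi>_mon C D R \<phi> \<phi>\<^sub>0 (LM x) (LM y) \<cdot>\<^bsub>Mon C\<^esub>
        (\<eta>_mon C D L R \<eta> \<phi> \<phi>\<^sub>0 cL eL x \<otimes>\<^sub>a\<^bsub>Mon C\<^esub> \<eta>_mon C D L R \<eta> \<phi> \<phi>\<^sub>0 cL eL y)"
      by (subst MA.cL_flat, simp, simp, rule MA.sharp_flat) (simp_all add: \<phi>_mon_def \<eta>_mon_eq Q.is_monoid_map_\<phi> C.is_monoid_map_tar is_monoid_map_sharp_gen C.is_monoid_map_Comp [OF _ _ _ C.is_monoid_map_tar Q.is_monoid_map_\<phi>])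
    also have "und \<dots> = \<phi> (Car (LM x)) (Car (LM y)) \<cdot>\<^sub>C (?g \<otimes>\<^sub>a\<^sub>C ?h)"
      by (simp add: \<phi>_mon_def \<eta>_mon_eq)
    also have "\<dots> = sharp (Car ?xy) (flat (Car (LM x) \<otimes>\<^sub>D Car (LM y)) (\<phi> (Car (LM x)) (Car (LM y)) \<cdot>\<^sub>C (?g \<otimes>\<^sub>a\<^sub>C ?h)))"
      by (subst sharp_flat) simp_all
    also have "\<dots> = sharp (Car ?xy) ((gen x \<otimes>\<^sub>a\<^sub>D gen y) \<cdot>\<^sub>D cL (Car x) (Car y))"
      by (subst flat_\<phi>) simp_all
    finally show "sharp (Car ?xy) ?l1 = sharp (Car ?xy) ?r1"
      by (simp add: \<Theta>_arr)
  qed (use cL in \<open>simp_all add: \<Theta>_arr(1-3)\<close>)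
qed

theorem colax_monoidal_\<Theta>: "colax_monoidal (Mon C) (Mon D) (Lmon C D L cL eL) (\<Theta> C D L cL eL) MA.eL"
  by (rule colax_monoidal_cong [OF MA.colax_monoidal_left_adjoint]) (simp add: \<Theta>_eq_adjoint)

theorem colax_isomorphic_\<Theta>:
  "colax_isomorphic (Mon C) (Mon D) (Lmon C D L cL eL) (\<Theta> C D L cL eL) MA.eL MA.cL MA.eL"
  unfolding colax_isomorphic_def
proof (intro exI [of _ "\<lambda>x. Ide (Mon D) (LM x)"] conjI ballI)
  show "natural (Mon C) (Mon D) (Lmon C D L cL eL) (Lmon C D L cL eL) (\<lambda>x. Ide (Mon D) (LM x))"
    unfolding natural_def by (simp add: MA.L.far_arr del: Mon_simps(5))
  fix x y assume o: "x \<in> Obj (Mon C)" "y \<in> Obj (Mon C)"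
  then show "is_iso (Mon D) (Ide (Mon D) (LM x))"
    by (intro D.Mon.is_iso_Ide MA.L.fob_Obj)
  have "\<Theta> C D L cL eL x y = MA.cL x y"
    using o by (simp add: \<Theta>_eq_adjoint)
  then show "(Ide (Mon D) (LM x) \<otimes>\<^sub>a\<^bsub>Mon D\<^esub> Ide (Mon D) (LM y)) \<cdot>\<^bsub>Mon D\<^esub> \<Theta> C D L cL eL x y
      = MA.cL x y \<cdot>\<^bsub>Mon D\<^esub> Ide (Mon D) (LM (x \<otimes>\<^bsub>Mon C\<^esub> y))"
    using MA.cL_arr [OF o] D.Mon.tar_Ide [OF MA.L.fob_Obj MA.L.fob_Obj, OF o] by (simp del: Mon_simps(5,8))
next
  show "MA.eL = MA.eL \<cdot>\<^bsub>Mon D\<^esub> Ide (Mon D) (LM \<one>\<^bsub>Mon C\<^esub>)"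
    using MA.eL_arr by (simp del: Mon_simps(5))
qed

end

lemma good_imp_free_monoids: "good_monoidal_category M \<Longrightarrow> free_monoids M"
  by (intro free_monoids.intro free_monoids_axioms.intro good_monoidal_category.axioms(1)
      good_monoidal_category.power_coproducts good_monoidal_category.tensor_power_coproducts)

theorem theorem4p7:
  fixes C :: "('o, 'a) smcat" and D :: "('p, 'b) smcat"
    and L :: "('o, 'a, 'p, 'b) ftr" and R :: "('p, 'b, 'o, 'a) ftr"
    and \<eta> :: "'o \<Rightarrow> 'a" and \<epsilon> :: "'p \<Rightarrow> 'b"
    and \<phi> :: "'p \<Rightarrow> 'p \<Rightarrow> 'a" and \<phi>\<^sub>0 :: "'a"
    and c :: "'o \<Rightarrow> 'o \<Rightarrow> 'b" and e :: "'b"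
  assumes good_C: "good_monoidal_category C"
    and good_D: "good_monoidal_category D"
    and adj: "adjunction C D L R \<eta> \<epsilon>"
    and lax: "lax_monoidal D C R \<phi> \<phi>\<^sub>0"
    and c_def: "c = adj_colax C D L \<eta> \<epsilon> \<phi>"
    and e_def: "e = adj_colax_unit D L \<epsilon> \<phi>\<^sub>0"
    and quasi_sym: "quasi_symmetric C D L c"
    and coequalizers: "\<And>x. x \<in> Obj (Mon C) \<Longrightarrow>
          \<exists>q. is_coequalizer (Mon D) (\<alpha> C D L x) (\<beta> C D L c e x) q"
    and coequalizers_tensor: "\<And>x y. \<lbrakk>x \<in> Obj (Mon C); y \<in> Obj (Mon C)\<rbrakk> \<Longrightarrow>
          \<exists>q. is_coequalizer (Mon D) (\<alpha>\<alpha> C D L x y) (\<beta>\<beta> C D L c e x y) q"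
  shows "lax_monoidal (Mon D) (Mon C) (Rmon C R \<phi> \<phi>\<^sub>0) (\<phi>_mon C D R \<phi> \<phi>\<^sub>0) (\<phi>_mon_unit C D R \<phi> \<phi>\<^sub>0) \<and>
    adjunction (Mon C) (Mon D) (Lmon C D L c e) (Rmon C R \<phi> \<phi>\<^sub>0)
      (\<eta>_mon C D L R \<eta> \<phi> \<phi>\<^sub>0 c e) (\<epsilon>_mon C D L R \<epsilon> \<phi> \<phi>\<^sub>0 c e) \<and>
    (\<exists>e'. colax_monoidal (Mon C) (Mon D) (Lmon C D L c e) (\<Theta> C D L c e) e' \<and>
      colax_isomorphic (Mon C) (Mon D) (Lmon C D L c e) (\<Theta> C D L c e) e'
        (adj_colax (Mon C) (Mon D) (Lmon C D L c e)
          (\<eta>_mon C D L R \<eta> \<phi> \<phi>\<^sub>0 c e) (\<epsilon>_mon C D L R \<epsilon> \<phi> \<phi>\<^sub>0 c e) (\<phi>_mon C D R \<phi> \<phi>\<^sub>0))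
        (adj_colax_unit (Mon D) (Lmon C D L c e)
          (\<epsilon>_mon C D L R \<epsilon> \<phi> \<phi>\<^sub>0 c e) (\<phi>_mon_unit C D R \<phi> \<phi>\<^sub>0)))"
proof -
  interpret monoid_left_adjoint_tensor C D L R \<eta> \<epsilon> \<phi> \<phi>\<^sub>0
    using quasi_sym coequalizers coequalizers_tensor unfolding c_def e_def
    by (intro monoid_left_adjoint_tensor.intro monoid_left_adjoint_tensor_axioms.intro
        monoid_left_adjoint.intro monoid_left_adjoint_axioms.intro
        quasi_symmetric_adjunction.intro quasi_symmetric_adjunction_axioms.intro
        lax_adjunction.intro good_imp_free_monoids good_C good_D adj lax) simp_all
  show ?thesis
    unfolding c_def e_def
    using Q.lax_monoidal_Rmon adjunction_Mon colax_monoidal_\<Theta> colax_isomorphic_\<Theta> by blast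
qed

end
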